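(* Let $(M^n,g)$ be a Riemannian manifold of dimension $n>2$, let $X$ be a smooth vector field on $M$ and let $f$ be a smooth real-valued function on $M$. Then: (1) There is a function $\psi:M\to\mathbb{R}$ such that $\sec_X=\psi$ if and only if $g$ has constant sectional curvature and $X$ is a conformal field on $(M,g)$. (2) There is a function $\psi:M\to\mathbb{R}$ such that $\overline{\sec}_f=\psi$ if and only if both $g$ and $e^{-2f}g$ have constant sectional curvature.
   Context: Manifolds are connected. For a smooth vector field $X$ on $(M,g)$ and an orthonormal pair $(V,U)$ in $T_pM$, define $\sec_X^V(U)=\sec(V,U)+\frac12 (L_Xg)(V,V)$ and $\overline{\sec}_X^V(U)=\sec(V,U)+\frac12 (L_Xg)(V,V)+g(X,V)^2$, where $\sec(V,U)$ is the sectional curvature of the plane spanned by $V$ and $U$ and $L_X$ is the Lie derivative. When $X=\nabla f$ write $\sec_f$ and $\overline{\sec}_f$; thus $\overline{\sec}_f^V(U)=\sec(V,U)+\mathrm{Hess} f(V,V)+df(V)^2$. The condition $\sec_X=\psi$ means that $\sec_X^V(U)=\psi(p)$ for all $p\in M$ and all orthonormal pairs $(V,U)$ in $T_pM$; $\overline{\sec}_f=\psi$ is defined in the same way. A conformal field is a vector field $X$ with $L_Xg=\phi g$ for some function $\phi:M\to\mathbb{R}$. *)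

theory Defs
  imports "HOL-Analysis.Analysis"
begin

(* Geometric objects live on a manifold given by a topology M and a smooth atlas A (not
   necessarily maximal) of charts into real^'n, so the dimension is CARD('n).  Tensors built from
   derivatives of the metric are given by their classical component formulas in a chart c.  The
   values do not depend on c; every condition on them is imposed in all charts of A. *)

subsection \<open>Partial derivatives and smoothness in Euclidean space\<close>

definition pd :: "'n::finite \<Rightarrow> (real^'n \<Rightarrow> real) \<Rightarrow> real^'n \<Rightarrow> real" where
  "pd i f x = frechet_derivative f (at x) (axis i 1)"

fun pds :: "'n::finite list \<Rightarrow> (real^'n \<Rightarrow> real) \<Rightarrow> real^'n \<Rightarrow> real" where
  "pds [] f = f"
| "pds (i # is) f = pd i (pds is f)"

(* Meant for open S: all iterated partial derivatives exist and are (totally) differentiable at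
   the points of S, that is, f is of class C^infinity on S. *)
definition smooth_on :: "(real^'n::finite) set \<Rightarrow> (real^'n \<Rightarrow> real) \<Rightarrow> bool" where
  "smooth_on S f \<longleftrightarrow> (\<forall>is. \<forall>x\<in>S. pds is f differentiable (at x))"

subsection \<open>Smooth manifolds\<close>

type_synonym ('a, 'n) chart = "'a set \<times> ('a \<Rightarrow> real^'n)"

definition chart_on :: "'a topology \<Rightarrow> ('a, 'n::finite) chart \<Rightarrow> bool" where
  "chart_on M c \<longleftrightarrow> openin M (fst c) \<and> open (snd c ` fst c) \<and>
     homeomorphic_map (subtopology M (fst c)) (top_of_set (snd c ` fst c)) (snd c)"

definition chart_inv :: "('a, 'n::finite) chart \<Rightarrow> real^'n \<Rightarrow> 'a" where
  "chart_inv c = inv_into (fst c) (snd c)"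

definition transition :: "('a, 'n::finite) chart \<Rightarrow> ('a, 'n) chart \<Rightarrow> real^'n \<Rightarrow> real^'n" where
  "transition c d = snd d \<circ> chart_inv c"

definition smooth_atlas :: "'a topology \<Rightarrow> ('a, 'n::finite) chart set \<Rightarrow> bool" where
  "smooth_atlas M A \<longleftrightarrow>
     (\<forall>c\<in>A. chart_on M c) \<and> (\<Union>c\<in>A. fst c) = topspace M \<and>
     (\<forall>c\<in>A. \<forall>d\<in>A. \<forall>i. smooth_on (snd c ` (fst c \<inter> fst d)) (\<lambda>x. transition c d x $ i))"

definition smooth_manifold :: "'a topology \<Rightarrow> ('a, 'n::finite) chart set \<Rightarrow> bool" where
  "smooth_manifold M A \<longleftrightarrow>
     Hausdorff_space M \<and> second_countable M \<and> connected_space M \<and> smooth_atlas M A"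

definition charts_at :: "('a, 'n::finite) chart set \<Rightarrow> 'a \<Rightarrow> ('a, 'n) chart set" where
  "charts_at A p = {c \<in> A. p \<in> fst c}"

definition smooth_function :: "('a, 'n::finite) chart set \<Rightarrow> ('a \<Rightarrow> real) \<Rightarrow> bool" where
  "smooth_function A f \<longleftrightarrow> (\<forall>c\<in>A. smooth_on (snd c ` fst c) (f \<circ> chart_inv c))"

subsection \<open>Tangent vectors, vector fields and Riemannian metrics\<close>

(* A tangent vector at p is the family of its coordinate vectors, one for each chart around p,
   related by the Jacobians of the transition maps (and 0 for all other charts, so that equal
   tangent vectors are equal as functions). *)
type_synonym ('a, 'n) tvec = "('a, 'n) chart \<Rightarrow> real^'n"

definition tangent_space :: "('a, 'n::finite) chart set \<Rightarrow> 'a \<Rightarrow> ('a, 'n) tvec set" where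
  "tangent_space A p = {V.
     (\<forall>c\<in>charts_at A p. \<forall>d\<in>charts_at A p.
        V d = frechet_derivative (transition c d) (at (snd c p)) (V c)) \<and>
     (\<forall>c. c \<notin> charts_at A p \<longrightarrow> V c = 0)}"

(* The i-th coordinate vector of the chart c at p. *)
definition coord_vec ::
    "('a, 'n::finite) chart set \<Rightarrow> ('a, 'n) chart \<Rightarrow> 'a \<Rightarrow> 'n \<Rightarrow> ('a, 'n) tvec" where
  "coord_vec A c p i = (\<lambda>d. if d \<in> charts_at A p
     then frechet_derivative (transition c d) (at (snd c p)) (axis i 1) else 0)"

type_synonym ('a, 'n) vfield = "'a \<Rightarrow> ('a, 'n) tvec"

definition vf_comp :: "('a, 'n::finite) chart \<Rightarrow> ('a, 'n) vfield \<Rightarrow> 'n \<Rightarrow> real^'n \<Rightarrow> real" where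
  "vf_comp c X i x = X (chart_inv c x) c $ i"

definition smooth_vector_field ::
    "'a topology \<Rightarrow> ('a, 'n::finite) chart set \<Rightarrow> ('a, 'n) vfield \<Rightarrow> bool" where
  "smooth_vector_field M A X \<longleftrightarrow>
     (\<forall>p\<in>topspace M. X p \<in> tangent_space A p) \<and>
     (\<forall>c\<in>A. \<forall>i. smooth_on (snd c ` fst c) (vf_comp c X i))"

type_synonym ('a, 'n) metric = "'a \<Rightarrow> ('a, 'n) tvec \<Rightarrow> ('a, 'n) tvec \<Rightarrow> real"

definition metric_matrix ::
    "('a, 'n::finite) chart set \<Rightarrow> ('a, 'n) chart \<Rightarrow> ('a, 'n) metric \<Rightarrow> real^'n \<Rightarrow> real^'n^'n" where
  "metric_matrix A c g x = (\<chi> i j. g (chart_inv c x)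
     (coord_vec A c (chart_inv c x) i) (coord_vec A c (chart_inv c x) j))"

definition riemannian_metric ::
    "'a topology \<Rightarrow> ('a, 'n::finite) chart set \<Rightarrow> ('a, 'n) metric \<Rightarrow> bool" where
  "riemannian_metric M A g \<longleftrightarrow>
     (\<forall>p\<in>topspace M.
        (\<forall>V\<in>tangent_space A p. \<forall>W\<in>tangent_space A p. g p V W = g p W V) \<and>
        (\<forall>V\<in>tangent_space A p. \<forall>W\<in>tangent_space A p. \<forall>Z\<in>tangent_space A p. \<forall>a b.
           g p (\<lambda>c. a *\<^sub>R V c + b *\<^sub>R W c) Z = a * g p V Z + b * g p W Z) \<and>
        (\<forall>V\<in>tangent_space A p. V \<noteq> (\<lambda>c. 0) \<longrightarrow> g p V V > 0)) \<and>
     (\<forall>c\<in>A. \<forall>i j. smooth_on (snd c ` fst c) (\<lambda>x. metric_matrix A c g x $ i $ j))"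

definition orthonormal_pair ::
    "('a, 'n::finite) chart set \<Rightarrow> ('a, 'n) metric \<Rightarrow> 'a \<Rightarrow> ('a, 'n) tvec \<Rightarrow> ('a, 'n) tvec \<Rightarrow> bool" where
  "orthonormal_pair A g p V U \<longleftrightarrow>
     V \<in> tangent_space A p \<and> U \<in> tangent_space A p \<and> g p V V = 1 \<and> g p U U = 1 \<and> g p V U = 0"

subsection \<open>Sectional curvature\<close>

(* The coefficient of the k-th coordinate field in the covariant derivative of the j-th
   coordinate field along the i-th, for the Levi-Civita connection. *)
definition christoffel ::
    "('a, 'n::finite) chart set \<Rightarrow> ('a, 'n) chart \<Rightarrow> ('a, 'n) metric \<Rightarrow> 'n \<Rightarrow> 'n \<Rightarrow> 'n \<Rightarrow> real^'n \<Rightarrow> real" where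
  "christoffel A c g k i j x = (1/2) * (\<Sum>l\<in>UNIV. matrix_inv (metric_matrix A c g x) $ k $ l *
     (pd i (\<lambda>y. metric_matrix A c g y $ j $ l) x + pd j (\<lambda>y. metric_matrix A c g y $ i $ l) x
      - pd l (\<lambda>y. metric_matrix A c g y $ i $ j) x))"

(* The l-th component of R(e_i,e_j)e_k for the coordinate fields e_i, with the convention
   R(X,Y)Z = D_X D_Y Z - D_Y D_X Z - D_[X,Y] Z. *)
definition riemann ::
    "('a, 'n::finite) chart set \<Rightarrow> ('a, 'n) chart \<Rightarrow> ('a, 'n) metric
       \<Rightarrow> 'n \<Rightarrow> 'n \<Rightarrow> 'n \<Rightarrow> 'n \<Rightarrow> real^'n \<Rightarrow> real" where
  "riemann A c g l i j k x =
     pd i (christoffel A c g l j k) x - pd j (christoffel A c g l i k) x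
     + (\<Sum>m\<in>UNIV. christoffel A c g m j k x * christoffel A c g l i m x
              - christoffel A c g m i k x * christoffel A c g l j m x)"

(* The quotient g(R(V,U)U,V) / (g(V,V) g(U,U) - g(V,U)^2), computed in the chart c. *)
definition sec ::
    "('a, 'n::finite) chart set \<Rightarrow> ('a, 'n) chart \<Rightarrow> ('a, 'n) metric
       \<Rightarrow> 'a \<Rightarrow> ('a, 'n) tvec \<Rightarrow> ('a, 'n) tvec \<Rightarrow> real" where
  "sec A c g p V U =
     (\<Sum>l\<in>UNIV. \<Sum>m\<in>UNIV. metric_matrix A c g (snd c p) $ l $ m * V c $ m *
        (\<Sum>i\<in>UNIV. \<Sum>j\<in>UNIV. \<Sum>k\<in>UNIV.
           riemann A c g l i j k (snd c p) * V c $ i * U c $ j * U c $ k))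
     / (g p V V * g p U U - (g p V U)\<^sup>2)"

definition constant_sectional_curvature ::
    "'a topology \<Rightarrow> ('a, 'n::finite) chart set \<Rightarrow> ('a, 'n) metric \<Rightarrow> bool" where
  "constant_sectional_curvature M A g \<longleftrightarrow> (\<exists>\<kappa>. \<forall>p\<in>topspace M. \<forall>c\<in>charts_at A p.
     \<forall>V\<in>tangent_space A p. \<forall>U\<in>tangent_space A p.
       (\<forall>a b. (\<lambda>d. a *\<^sub>R V d + b *\<^sub>R U d) = (\<lambda>d. 0) \<longrightarrow> a = 0 \<and> b = 0) \<longrightarrow> sec A c g p V U = \<kappa>)"

subsection \<open>Lie derivative, conformal fields and gradient\<close>

(* (L_X g)(V,W) in the chart c. *)
definition lie_metric ::
    "('a, 'n::finite) chart set \<Rightarrow> ('a, 'n) chart \<Rightarrow> ('a, 'n) vfield \<Rightarrow> ('a, 'n) metric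
       \<Rightarrow> 'a \<Rightarrow> ('a, 'n) tvec \<Rightarrow> ('a, 'n) tvec \<Rightarrow> real" where
  "lie_metric A c X g p V W = (\<Sum>i\<in>UNIV. \<Sum>j\<in>UNIV.
     (\<Sum>k\<in>UNIV. vf_comp c X k (snd c p) * pd k (\<lambda>y. metric_matrix A c g y $ i $ j) (snd c p)
       + metric_matrix A c g (snd c p) $ k $ j * pd i (vf_comp c X k) (snd c p)
       + metric_matrix A c g (snd c p) $ i $ k * pd j (vf_comp c X k) (snd c p))
     * V c $ i * W c $ j)"

definition conformal_field ::
    "'a topology \<Rightarrow> ('a, 'n::finite) chart set \<Rightarrow> ('a, 'n) metric \<Rightarrow> ('a, 'n) vfield \<Rightarrow> bool" where
  "conformal_field M A g X \<longleftrightarrow> (\<exists>\<phi>. \<forall>p\<in>topspace M. \<forall>c\<in>charts_at A p.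
     \<forall>V\<in>tangent_space A p. \<forall>W\<in>tangent_space A p. lie_metric A c X g p V W = \<phi> p * g p V W)"

definition grad ::
    "('a, 'n::finite) chart set \<Rightarrow> ('a, 'n) metric \<Rightarrow> ('a \<Rightarrow> real) \<Rightarrow> ('a, 'n) vfield" where
  "grad A g f p = (\<lambda>c. if c \<in> charts_at A p
     then matrix_inv (metric_matrix A c g (snd c p)) *v (\<chi> i. pd i (f \<circ> chart_inv c) (snd c p))
     else 0)"

subsection \<open>Weighted sectional curvatures\<close>

definition sec_X ::
    "('a, 'n::finite) chart set \<Rightarrow> ('a, 'n) chart \<Rightarrow> ('a, 'n) metric \<Rightarrow> ('a, 'n) vfield
       \<Rightarrow> 'a \<Rightarrow> ('a, 'n) tvec \<Rightarrow> ('a, 'n) tvec \<Rightarrow> real" where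
  "sec_X A c g X p V U = sec A c g p V U + (1/2) * lie_metric A c X g p V V"

definition sec_bar_X ::
    "('a, 'n::finite) chart set \<Rightarrow> ('a, 'n) chart \<Rightarrow> ('a, 'n) metric \<Rightarrow> ('a, 'n) vfield
       \<Rightarrow> 'a \<Rightarrow> ('a, 'n) tvec \<Rightarrow> ('a, 'n) tvec \<Rightarrow> real" where
  "sec_bar_X A c g X p V U =
     sec A c g p V U + (1/2) * lie_metric A c X g p V V + (g p (X p) V)\<^sup>2"

definition sec_X_eq ::
    "'a topology \<Rightarrow> ('a, 'n::finite) chart set \<Rightarrow> ('a, 'n) metric \<Rightarrow> ('a, 'n) vfield
       \<Rightarrow> ('a \<Rightarrow> real) \<Rightarrow> bool" where
  "sec_X_eq M A g X \<psi> \<longleftrightarrow> (\<forall>p\<in>topspace M. \<forall>c\<in>charts_at A p. \<forall>V U.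
     orthonormal_pair A g p V U \<longrightarrow> sec_X A c g X p V U = \<psi> p)"

definition sec_bar_X_eq ::
    "'a topology \<Rightarrow> ('a, 'n::finite) chart set \<Rightarrow> ('a, 'n) metric \<Rightarrow> ('a, 'n) vfield
       \<Rightarrow> ('a \<Rightarrow> real) \<Rightarrow> bool" where
  "sec_bar_X_eq M A g X \<psi> \<longleftrightarrow> (\<forall>p\<in>topspace M. \<forall>c\<in>charts_at A p. \<forall>V U.
     orthonormal_pair A g p V U \<longrightarrow> sec_bar_X A c g X p V U = \<psi> p)"

definition sec_bar_f_eq ::
    "'a topology \<Rightarrow> ('a, 'n::finite) chart set \<Rightarrow> ('a, 'n) metric \<Rightarrow> ('a \<Rightarrow> real)
       \<Rightarrow> ('a \<Rightarrow> real) \<Rightarrow> bool" where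
  "sec_bar_f_eq M A g f \<psi> \<longleftrightarrow> sec_bar_X_eq M A g (grad A g f) \<psi>"

end

theory Submission
  imports Defs
begin

text \<open>Both parts rest on linear algebra at a point together with Schur's lemma.

  The sectional curvature of a pair is symmetric in the two vectors. So if \<open>sec(V,U) + B(V,V)\<close> is the
  same for all orthonormal pairs at a point, where \<open>B\<close> is a symmetric bilinear form, then
  \<open>B(V,V) = B(U,U)\<close> for all orthonormal pairs, and \<open>B\<close> is a multiple of the metric
  (\<open>proportional_if_equal_on_orthonormal\<close>). Hence the sectional curvature at each point does not depend
  on the plane, and by Schur's lemma (\<open>schur_global\<close>) it is constant. With \<open>B\<close> half the Lie derivative
  of the metric this is the harder half of (1); the converse is immediate.

  For (2), \<open>B = Hess f + df \<otimes> df\<close>. The metric \<open>e\<^sup>-\<^sup>2\<^sup>f g\<close> has on a \<open>g\<close>-orthonormal pair the sectional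
  curvature \<open>e\<^sup>2\<^sup>f (sec(V,U) + B(V,V) + B(U,U) - |\<nabla>f|\<^sup>2)\<close> (\<open>conf_curv_unit\<close>). If \<open>B\<close> is a multiple of the metric
  this does not depend on the pair, and Schur's lemma applies to \<open>e\<^sup>-\<^sup>2\<^sup>f g\<close> as well. Conversely, if both
  metrics have constant curvature, then \<open>B(V,V) + B(U,U)\<close> is the same for all orthonormal pairs at a
  point; as three orthonormal vectors exist, \<open>B\<close> is constant on unit vectors.

  Schur's lemma is proved in a chart, with the curvature as a two-form with values in matrices. The
  second Bianchi identity (\<open>bianchi2\<close>) then needs only the Jacobi identity and the symmetry of second
  derivatives, and the curvature form of constant curvature satisfies the same identity
  (\<open>const_curv_bianchi2\<close>); comparing the two leaves the derivatives of the curvature function alone.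

  All tensors are given by components in a chart, and the functions to be found on the manifold must
  not depend on the chart. For the Lie derivative this is \<open>lie_metric_chart_independent\<close>, and for the
  weight in (2) it follows because the gradient is a tangent vector; for the curvatures it is then
  read off from the equations in which they occur.\<close>

section \<open>Partial derivatives and smooth functions\<close>

lemma has_derivative_pd:
  assumes "(f has_derivative f') (at x)"
  shows "pd i f x = f' (axis i 1)"
  using frechet_derivative_at[OF assms] by (simp add: pd_def)

lemma frechet_derivative_eq_sum_pd:
  assumes "f differentiable (at x)"
  shows "frechet_derivative f (at x) v = (\<Sum>i\<in>UNIV. v $ i * pd i f x)"
proof -
  have lin: "linear (frechet_derivative f (at x))"
    using assms by (rule linear_frechet_derivative)
  have "frechet_derivative f (at x) (\<Sum>i\<in>UNIV. v $ i *\<^sub>R axis i 1)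
      = (\<Sum>i\<in>UNIV. v $ i * pd i f x)"
    by (simp add: linear_sum[OF lin] linear_scale[OF lin] pd_def)
  then show ?thesis
    using basis_expansion[of v] by (simp add: scalar_mult_eq_scaleR)
qed

lemma pd_cong_open:
  assumes "open S" "x \<in> S" "\<And>y. y \<in> S \<Longrightarrow> f y = h y"
  shows "pd i f x = pd i h x"
proof -
  have "(f has_derivative d) (at x) \<longleftrightarrow> (h has_derivative d) (at x)" for d
    using has_derivative_transform_within_open[OF _ assms(1,2)] assms(3) by metis
  then show ?thesis
    by (simp add: pd_def frechet_derivative_def)
qed

lemma differentiable_cong_open:
  assumes "open S" "x \<in> S" "\<And>y. y \<in> S \<Longrightarrow> f y = h y" "f differentiable (at x)"
  shows "h differentiable (at x)"
  using assms has_derivative_transform_within_open[OF _ assms(1,2)]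
  unfolding differentiable_def by blast

lemma pd_const: "pd i (\<lambda>x. c) x = 0"
  by (simp add: pd_def)

lemma pd_add:
  assumes "f differentiable (at x)" "h differentiable (at x)"
  shows "pd i (\<lambda>y. f y + h y) x = pd i f x + pd i h x"
  using has_derivative_pd[OF has_derivative_add[OF
      assms[unfolded frechet_derivative_works]]] by (simp add: pd_def)

lemma pd_diff:
  assumes "f differentiable (at x)" "h differentiable (at x)"
  shows "pd i (\<lambda>y. f y - h y) x = pd i f x - pd i h x"
  using has_derivative_pd[OF has_derivative_diff[OF
      assms[unfolded frechet_derivative_works]]] by (simp add: pd_def)

lemma pd_mult:
  assumes "f differentiable (at x)" "h differentiable (at x)"
  shows "pd i (\<lambda>y. f y * h y) x = pd i f x * h x + f x * pd i h x"
  using has_derivative_pd[OF has_derivative_mult[OF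
      assms[unfolded frechet_derivative_works]]] by (simp add: pd_def)

lemma pd_cmult:
  assumes "f differentiable (at x)"
  shows "pd i (\<lambda>y. c * f y) x = c * pd i f x"
  using pd_mult[OF differentiable_const assms] by (simp add: pd_const)

lemma pd_sum:
  assumes "\<And>a. a \<in> I \<Longrightarrow> (\<lambda>y. f a y) differentiable (at x)"
  shows "pd i (\<lambda>y. \<Sum>a\<in>I. f a y) x = (\<Sum>a\<in>I. pd i (f a) x)"
proof -
  have "((\<lambda>y. \<Sum>a\<in>I. f a y) has_derivative (\<lambda>v. \<Sum>a\<in>I. frechet_derivative (f a) (at x) v)) (at x)"
    using assms by (intro has_derivative_sum) (simp add: frechet_derivative_works)
  from has_derivative_pd[OF this] show ?thesis by (simp add: pd_def)
qed

lemma pd_real_comp: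
  assumes "f differentiable (at x)" "(h has_real_derivative d) (at (f x))"
  shows "pd i (\<lambda>y. h (f y)) x = d * pd i f x"
    and "(\<lambda>y. h (f y)) differentiable (at x)"
proof -
  have *: "((\<lambda>y. h (f y)) has_derivative (\<lambda>v. d * frechet_derivative f (at x) v)) (at x)"
    using diff_chain_at[OF assms(1)[unfolded frechet_derivative_works]
        assms(2)[unfolded has_field_derivative_def]] by (simp add: o_def)
  show "pd i (\<lambda>y. h (f y)) x = d * pd i f x"
    using has_derivative_pd[OF *] by (simp add: pd_def)
  show "(\<lambda>y. h (f y)) differentiable (at x)"
    using * by (auto simp: differentiable_def)
qed

lemma pd_comp:
  assumes "\<And>a. (\<lambda>y. \<tau> y $ a) differentiable (at x)" "f differentiable (at (\<tau> x))"
  shows "(\<lambda>y. f (\<tau> y)) differentiable (at x)"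
    and "pd i (\<lambda>y. f (\<tau> y)) x = (\<Sum>a\<in>UNIV. pd i (\<lambda>y. \<tau> y $ a) x * pd a f (\<tau> x))"
proof -
  let ?d = "\<lambda>v. \<chi> a. frechet_derivative (\<lambda>y. \<tau> y $ a) (at x) v"
  have \<tau>: "(\<tau> has_derivative ?d) (at x)"
    by (subst has_derivative_componentwise_within)
      (use assms(1) in \<open>auto simp: Basis_vec_def inner_axis frechet_derivative_works\<close>)
  have *: "((\<lambda>y. f (\<tau> y)) has_derivative (\<lambda>v. frechet_derivative f (at (\<tau> x)) (?d v))) (at x)"
    using diff_chain_at[OF \<tau> assms(2)[unfolded frechet_derivative_works]] by (simp add: o_def)
  then show "(\<lambda>y. f (\<tau> y)) differentiable (at x)"
    by (auto simp: differentiable_def)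
  show "pd i (\<lambda>y. f (\<tau> y)) x = (\<Sum>a\<in>UNIV. pd i (\<lambda>y. \<tau> y $ a) x * pd a f (\<tau> x))"
    unfolding has_derivative_pd[OF *] frechet_derivative_eq_sum_pd[OF assms(2)] by (simp add: pd_def)
qed

text \<open>Closure properties of smoothness are proved by induction on the order of differentiability,
  for which the finite-order version is introduced; peeling off the innermost derivative makes the
  product and chain rules directly applicable.\<close>

primrec diff_order :: "nat \<Rightarrow> (real^'n::finite) set \<Rightarrow> (real^'n \<Rightarrow> real) \<Rightarrow> bool" where
  "diff_order 0 S f \<longleftrightarrow> True"
| "diff_order (Suc k) S f \<longleftrightarrow> (\<forall>x\<in>S. f differentiable (at x)) \<and> (\<forall>i. diff_order k S (pd i f))"

lemma pds_append: "pds (is @ js) f = pds is (pds js f)"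
  by (induction "is") auto

lemma smooth_on_imp_differentiable: "smooth_on S f \<Longrightarrow> x \<in> S \<Longrightarrow> f differentiable (at x)"
  unfolding smooth_on_def by (metis pds.simps(1))

lemma smooth_on_pd: "smooth_on S f \<Longrightarrow> smooth_on S (pd i f)"
  unfolding smooth_on_def by (metis pds_append pds.simps)

lemma smooth_on_iff_diff_order: "smooth_on S f \<longleftrightarrow> (\<forall>k. diff_order k S f)"
proof
  assume "smooth_on S f"
  then have "diff_order k S f" for k
    by (induction k arbitrary: f) (auto intro: smooth_on_imp_differentiable smooth_on_pd)
  then show "\<forall>k. diff_order k S f" ..
next
  assume *: "\<forall>k. diff_order k S f"
  have key: "diff_order (Suc (length is)) S f \<Longrightarrow> x \<in> S \<Longrightarrow> pds is f differentiable (at x)" for "is" x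
  proof (induction "is" arbitrary: f rule: rev_induct)
    case (snoc i js)
    then have "diff_order (Suc (length js)) S (pd i f)" by simp
    from snoc.IH[OF this snoc.prems(2)] show ?case by (simp add: pds_append)
  qed simp
  show "smooth_on S f"
    unfolding smooth_on_def by (intro allI ballI key *[rule_format])
qed

lemma diff_order_mono: "diff_order (Suc k) S f \<Longrightarrow> diff_order k S f"
proof (induction k arbitrary: f)
  case (Suc k)
  then have "\<forall>x\<in>S. f differentiable (at x)" "\<forall>i. diff_order (Suc k) S (pd i f)"
    by (auto simp only: diff_order.simps(2)[of "Suc k"])
  with Suc.IH show ?case by (simp only: diff_order.simps(2)) blast
qed simp

lemma diff_order_cong:
  assumes "open S"
  shows "(\<And>x. x \<in> S \<Longrightarrow> f x = h x) \<Longrightarrow> diff_order k S f \<Longrightarrow> diff_order k S h"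
proof (induction k arbitrary: f h)
  case (Suc k)
  have "diff_order k S (pd i h)" for i
    by (rule Suc.IH[of "pd i f"]) (use Suc.prems pd_cong_open[OF assms, of _ f h] in auto)
  moreover have "h differentiable (at x)" if "x \<in> S" for x
    using differentiable_cong_open[OF assms that, of f h] Suc.prems that by auto
  ultimately show ?case by simp
qed simp

lemma diff_order_const: "diff_order k S (\<lambda>x. c)"
proof (induction k arbitrary: c)
  case (Suc k)
  have "pd i (\<lambda>x. c) = (\<lambda>x. 0)" for i :: 'a
    by (rule ext) (rule pd_const)
  with Suc show ?case by simp
qed simp

lemma diff_order_add:
  assumes "open S"
  shows "diff_order k S f \<Longrightarrow> diff_order k S h \<Longrightarrow> diff_order k S (\<lambda>x. f x + h x)"
proof (induction k arbitrary: f h)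
  case (Suc k)
  have "diff_order k S (pd i (\<lambda>x. f x + h x))" for i
    by (rule diff_order_cong[OF assms, of "\<lambda>x. pd i f x + pd i h x"])
      (use Suc in \<open>auto simp: pd_add\<close>)
  then show ?case using Suc.prems by (auto intro: differentiable_add)
qed simp

lemma diff_order_mult:
  assumes "open S"
  shows "diff_order k S f \<Longrightarrow> diff_order k S h \<Longrightarrow> diff_order k S (\<lambda>x. f x * h x)"
proof (induction k arbitrary: f h)
  case (Suc k)
  have "diff_order k S (pd i (\<lambda>x. f x * h x))" for i
    by (rule diff_order_cong[OF assms, of "\<lambda>x. pd i f x * h x + f x * pd i h x"])
      (use Suc.prems diff_order_mono[OF Suc.prems(1)] diff_order_mono[OF Suc.prems(2)] in
        \<open>auto simp: pd_mult intro!: diff_order_add[OF assms] Suc.IH\<close>)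
  then show ?case using Suc.prems by (auto intro: differentiable_mult)
qed simp

lemma diff_order_inverse:
  assumes "open S" "\<And>x. x \<in> S \<Longrightarrow> f x \<noteq> 0"
  shows "diff_order k S f \<Longrightarrow> diff_order k S (\<lambda>x. inverse (f x))"
proof (induction k)
  case (Suc k)
  have inv: "(inverse has_real_derivative - (inverse (f x) * inverse (f x))) (at (f x))"
    if "x \<in> S" for x
    using DERIV_inverse'[OF DERIV_ident, of "f x"] assms(2)[OF that] by simp
  have ih: "diff_order k S (\<lambda>x. inverse (f x))"
    using Suc diff_order_mono by blast
  have "diff_order k S (pd i (\<lambda>x. inverse (f x)))" for i
  proof (rule diff_order_cong[OF assms(1)])
    show "diff_order k S (\<lambda>x. (- 1) * ((inverse (f x) * inverse (f x)) * pd i f x))"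
      using Suc.prems ih by (intro diff_order_mult[OF assms(1)] diff_order_const) auto
    show "(- 1) * ((inverse (f x) * inverse (f x)) * pd i f x) = pd i (\<lambda>x. inverse (f x)) x"
      if "x \<in> S" for x
      using pd_real_comp(1)[where f=f and h=inverse, OF _ inv[OF that]] Suc.prems that by simp
  qed
  moreover have "(\<lambda>x. inverse (f x)) differentiable (at x)" if "x \<in> S" for x
    using pd_real_comp(2)[where f=f and h=inverse, OF _ inv[OF that]] Suc.prems that by auto
  ultimately show ?case by auto
qed simp

lemma diff_order_exp:
  assumes "open S"
  shows "diff_order k S f \<Longrightarrow> diff_order k S (\<lambda>x. exp (f x))"
proof (induction k)
  case (Suc k)
  have ih: "diff_order k S (\<lambda>x. exp (f x))"
    using Suc diff_order_mono by blast
  have "diff_order k S (pd i (\<lambda>x. exp (f x)))" for i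
  proof (rule diff_order_cong[OF assms(1)])
    show "diff_order k S (\<lambda>x. exp (f x) * pd i f x)"
      using Suc.prems ih by (intro diff_order_mult[OF assms(1)]) auto
    show "exp (f x) * pd i f x = pd i (\<lambda>x. exp (f x)) x" if "x \<in> S" for x
      using pd_real_comp(1)[where f=f and h=exp, OF _ DERIV_exp] Suc.prems that by simp
  qed
  moreover have "(\<lambda>x. exp (f x)) differentiable (at x)" if "x \<in> S" for x
    using pd_real_comp(2)[where f=f and h=exp, OF _ DERIV_exp] Suc.prems that by auto
  ultimately show ?case by auto
qed simp

lemma smooth_on_cong:
  "open S \<Longrightarrow> (\<And>x. x \<in> S \<Longrightarrow> f x = h x) \<Longrightarrow> smooth_on S f \<Longrightarrow> smooth_on S h"
  unfolding smooth_on_iff_diff_order by (blast intro: diff_order_cong)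

lemma smooth_on_const: "smooth_on S (\<lambda>x. c)"
  by (simp add: smooth_on_iff_diff_order diff_order_const)

lemma smooth_on_add:
  "open S \<Longrightarrow> smooth_on S f \<Longrightarrow> smooth_on S h \<Longrightarrow> smooth_on S (\<lambda>x. f x + h x)"
  by (simp add: smooth_on_iff_diff_order diff_order_add)

lemma smooth_on_mult:
  "open S \<Longrightarrow> smooth_on S f \<Longrightarrow> smooth_on S h \<Longrightarrow> smooth_on S (\<lambda>x. f x * h x)"
  by (simp add: smooth_on_iff_diff_order diff_order_mult)

lemma smooth_on_diff:
  "open S \<Longrightarrow> smooth_on S f \<Longrightarrow> smooth_on S h \<Longrightarrow> smooth_on S (\<lambda>x. f x - h x)"
  using smooth_on_add[of S f "\<lambda>x. (- 1) * h x"] smooth_on_mult[of S "\<lambda>x. - 1" h]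
  by (simp add: smooth_on_const)

lemma smooth_on_inverse:
  "open S \<Longrightarrow> (\<And>x. x \<in> S \<Longrightarrow> f x \<noteq> 0) \<Longrightarrow> smooth_on S f \<Longrightarrow> smooth_on S (\<lambda>x. inverse (f x))"
  by (simp add: smooth_on_iff_diff_order diff_order_inverse)

lemma smooth_on_exp: "open S \<Longrightarrow> smooth_on S f \<Longrightarrow> smooth_on S (\<lambda>x. exp (f x))"
  by (simp add: smooth_on_iff_diff_order diff_order_exp)

lemma smooth_on_sum:
  assumes "open S" "\<And>a. a \<in> I \<Longrightarrow> smooth_on S (f a)"
  shows "smooth_on S (\<lambda>x. \<Sum>a\<in>I. f a x)"
  using assms(2) by (induction I rule: infinite_finite_induct)
    (auto intro: smooth_on_const smooth_on_add[OF assms(1)])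

lemma smooth_on_prod:
  assumes "open S" "\<And>a. a \<in> I \<Longrightarrow> smooth_on S (f a)"
  shows "smooth_on S (\<lambda>x. \<Prod>a\<in>I. f a x)"
  using assms(2) by (induction I rule: infinite_finite_induct)
    (auto intro: smooth_on_const smooth_on_mult[OF assms(1)])

lemma smooth_on_det:
  fixes B :: "real^'n::finite \<Rightarrow> real^'m::finite^'m"
  assumes "open S" "\<And>i j. smooth_on S (\<lambda>x. B x $ i $ j)"
  shows "smooth_on S (\<lambda>x. det (B x))"
  unfolding det_def
  by (intro smooth_on_sum smooth_on_mult smooth_on_prod smooth_on_const assms)

lemma matrix_inv_cancel:
  assumes "invertible A"
  shows "A ** matrix_inv A = mat 1" "matrix_inv A ** A = mat 1"
  using assms unfolding invertible_def matrix_inv_def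
  by (metis (mono_tags, lifting) someI_ex)+

lemma matrix_mult_entry: "(\<Sum>a\<in>UNIV. A $ k $ a * B $ a $ l) = (A ** B) $ k $ l"
  by (simp add: matrix_matrix_mult_def)

text \<open>By Cramer's rule the entries of the inverse are quotients of determinants.\<close>

lemma smooth_on_matrix_inv:
  fixes B :: "real^'n::finite \<Rightarrow> real^'m::finite^'m"
  assumes "open S" "\<And>i j. smooth_on S (\<lambda>x. B x $ i $ j)" "\<And>x. x \<in> S \<Longrightarrow> invertible (B x)"
  shows "smooth_on S (\<lambda>x. matrix_inv (B x) $ k $ l)"
proof (rule smooth_on_cong[OF assms(1)])
  let ?N = "\<lambda>x. (\<chi> i j. if j = k then axis l 1 $ i else B x $ i $ j) :: real^'m^'m"
  show "smooth_on S (\<lambda>x. det (?N x) * inverse (det (B x)))"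
  proof (intro smooth_on_mult smooth_on_inverse smooth_on_det assms)
    show "smooth_on S (\<lambda>x. ?N x $ i $ j)" for i j
      using assms(2) by (cases "j = k") (auto intro: smooth_on_const)
    show "det (B x) \<noteq> 0" if "x \<in> S" for x
      using assms(3)[OF that] by (simp add: invertible_det_nz)
  qed
  fix x assume "x \<in> S"
  then have inv: "invertible (B x)" by (rule assms(3))
  have "B x *v (matrix_inv (B x) *v axis l 1) = axis l 1"
    by (simp add: matrix_vector_mul_assoc matrix_inv_cancel[OF inv])
  then have "matrix_inv (B x) *v axis l 1
      = (\<chi> k. det (\<chi> i j. if j = k then axis l 1 $ i else B x $ i $ j) / det (B x))"
    using cramer[of "B x"] inv by (simp add: invertible_det_nz)
  then have "(matrix_inv (B x) *v axis l 1) $ k = det (?N x) * inverse (det (B x))"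
    by (simp add: divide_inverse)
  then show "det (?N x) * inverse (det (B x)) = matrix_inv (B x) $ k $ l"
    by (simp add: matrix_vector_mult_basis column_def)
qed

lemma pd_line:
  assumes "f differentiable (at (y + s *\<^sub>R axis i 1))"
  shows "((\<lambda>s. f (y + s *\<^sub>R axis i 1)) has_real_derivative pd i f (y + s *\<^sub>R axis i 1)) (at s)"
proof -
  have 1: "((\<lambda>s. y + s *\<^sub>R axis i 1) has_derivative (\<lambda>h. h *\<^sub>R axis i 1)) (at s)"
    by (auto intro!: derivative_eq_intros)
  have 2: "linear (frechet_derivative f (at (y + s *\<^sub>R axis i 1)))"
    using assms by (rule linear_frechet_derivative)
  show ?thesis
    using diff_chain_at[OF 1 assms[unfolded frechet_derivative_works]]
    by (simp add: o_def linear_scale[OF 2] pd_def has_field_derivative_def mult_commute_abs)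
qed

text \<open>Two applications of the mean value theorem evaluate the second difference quotient, which is
  symmetric in \<open>i\<close> and \<open>j\<close>, as a mixed derivative at a nearby point; with continuity this gives the
  symmetry of second derivatives.\<close>

lemma second_difference_mvt:
  assumes S: "ball x r \<subseteq> S" and f: "smooth_on S f" and t: "0 < t" "2 * t < r"
  shows "\<exists>p. dist x p \<le> 2 * t \<and> pd j (pd i f) p * (t * t)
    = f (x + t *\<^sub>R axis i 1 + t *\<^sub>R axis j 1) - f (x + t *\<^sub>R axis i 1)
      - f (x + t *\<^sub>R axis j 1) + f x"
proof -
  have near: "dist x (x + s *\<^sub>R axis i 1 + u *\<^sub>R axis j 1) \<le> 2 * t"
    if "0 \<le> s" "s \<le> t" "0 \<le> u" "u \<le> t" for s u
  proof -
    have "norm (s *\<^sub>R axis i 1 + u *\<^sub>R (axis j 1 :: real^'a)) \<le> s + u"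
      using norm_triangle_ineq[of "s *\<^sub>R axis i (1::real)" "u *\<^sub>R axis j 1"] that by simp
    then show ?thesis using that by (simp add: dist_norm algebra_simps norm_minus_commute)
  qed
  have inS: "x + s *\<^sub>R axis i 1 + u *\<^sub>R axis j 1 \<in> S"
    if "0 \<le> s" "s \<le> t" "0 \<le> u" "u \<le> t" for s u
    using near[OF that] S t by (auto simp: subset_iff)
  let ?F = "\<lambda>s. f ((x + t *\<^sub>R axis j 1) + s *\<^sub>R axis i 1) - f (x + s *\<^sub>R axis i 1)"
  let ?F' = "\<lambda>s. pd i f ((x + t *\<^sub>R axis j 1) + s *\<^sub>R axis i 1) - pd i f (x + s *\<^sub>R axis i 1)"
  have F: "(?F has_real_derivative ?F' s) (at s)"
    if "0 \<le> s" "s \<le> t" for s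
    using inS[of s t] inS[of s 0] that t smooth_on_imp_differentiable[OF f]
    by (intro DERIV_diff pd_line) (auto simp: algebra_simps)
  obtain \<theta> where \<theta>: "0 < \<theta>" "\<theta> < t" "?F t - ?F 0 = (t - 0) *
      (pd i f ((x + t *\<^sub>R axis j 1) + \<theta> *\<^sub>R axis i 1) - pd i f (x + \<theta> *\<^sub>R axis i 1))"
    using MVT2[of 0 t ?F ?F', OF t(1) F] by metis
  let ?H = "\<lambda>u. pd i f ((x + \<theta> *\<^sub>R axis i 1) + u *\<^sub>R axis j 1)"
  let ?H' = "\<lambda>u. pd j (pd i f) ((x + \<theta> *\<^sub>R axis i 1) + u *\<^sub>R axis j 1)"
  have H: "(?H has_real_derivative ?H' u) (at u)" if "0 \<le> u" "u \<le> t" for u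
    using inS[of \<theta> u] that \<theta> smooth_on_imp_differentiable[OF smooth_on_pd[OF f]] by (intro pd_line) auto
  obtain \<eta> where \<eta>: "0 < \<eta>" "\<eta> < t" "?H t - ?H 0 = (t - 0) * ?H' \<eta>"
    using MVT2[of 0 t ?H ?H', OF t(1) H] by metis
  have "?F t - ?F 0 = t * (t * pd j (pd i f) ((x + \<theta> *\<^sub>R axis i 1) + \<eta> *\<^sub>R axis j 1))"
    using \<theta>(3) \<eta>(3) by (simp add: ac_simps)
  then have "pd j (pd i f) ((x + \<theta> *\<^sub>R axis i 1) + \<eta> *\<^sub>R axis j 1) * (t * t)
    = f (x + t *\<^sub>R axis i 1 + t *\<^sub>R axis j 1) - f (x + t *\<^sub>R axis i 1)
      - f (x + t *\<^sub>R axis j 1) + f x"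
    by (simp add: ac_simps)
  then show ?thesis using near[of \<theta> \<eta>] \<theta> \<eta> by (intro exI) auto
qed

lemma pd_commute:
  assumes "open S" "smooth_on S f" "x \<in> S"
  shows "pd i (pd j f) x = pd j (pd i f) x"
proof (rule ccontr)
  let ?P = "pd i (pd j f)" and ?Q = "pd j (pd i f)"
  assume ne: "?P x \<noteq> ?Q x"
  define e where "e = \<bar>?P x - ?Q x\<bar> / 2"
  have e: "e > 0" using ne by (simp add: e_def)
  obtain r where r: "r > 0" "ball x r \<subseteq> S" using assms by (meson open_contains_ball)
  have near: "\<exists>d>0. \<forall>y. dist y x < d \<longrightarrow> dist (h y) (h x) < e" if "smooth_on S h" for h
  proof -
    have "isCont h x"
      using differentiable_imp_continuous_within[OF smooth_on_imp_differentiable[OF that assms(3)]] .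
    then show ?thesis using e unfolding continuous_at_eps_delta by simp
  qed
  obtain d1 where d1: "d1 > 0" "\<And>y. dist y x < d1 \<Longrightarrow> dist (?P y) (?P x) < e"
    using near[OF smooth_on_pd[OF smooth_on_pd[OF assms(2)]]] by blast
  obtain d2 where d2: "d2 > 0" "\<And>y. dist y x < d2 \<Longrightarrow> dist (?Q y) (?Q x) < e"
    using near[OF smooth_on_pd[OF smooth_on_pd[OF assms(2)]]] by blast
  define t where "t = min r (min d1 d2) / 3"
  have t: "0 < t" "2 * t < r" "2 * t < d1" "2 * t < d2"
    using r d1 d2 by (auto simp: t_def min_def)
  obtain p where p: "dist x p \<le> 2 * t" "?Q p * (t * t)
    = f (x + t *\<^sub>R axis i 1 + t *\<^sub>R axis j 1) - f (x + t *\<^sub>R axis i 1)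
      - f (x + t *\<^sub>R axis j 1) + f x"
    using second_difference_mvt[OF r(2) assms(2) t(1,2)] by blast
  obtain q where q: "dist x q \<le> 2 * t" "?P q * (t * t)
    = f (x + t *\<^sub>R axis j 1 + t *\<^sub>R axis i 1) - f (x + t *\<^sub>R axis j 1)
      - f (x + t *\<^sub>R axis i 1) + f x"
    using second_difference_mvt[OF r(2) assms(2) t(1,2)] by blast
  have "?P q * (t * t) = ?Q p * (t * t)"
    using p(2) q(2) by (simp add: ac_simps)
  then have "?P q = ?Q p" using t(1) by simp
  moreover have "dist (?P q) (?P x) < e" "dist (?Q p) (?Q x) < e"
    using d1(2)[of q] d2(2)[of p] p(1) q(1) t by (auto simp: dist_commute)
  ultimately show False
    by (auto simp: e_def dist_real_def abs_if split: if_splits)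
qed

section \<open>Riemannian metrics in a coordinate domain\<close>

definition coord_christoffel ::
    "(real^'n::finite \<Rightarrow> real^'n^'n) \<Rightarrow> 'n \<Rightarrow> 'n \<Rightarrow> 'n \<Rightarrow> real^'n \<Rightarrow> real" where
  "coord_christoffel G k i j x = (1/2) * (\<Sum>l\<in>UNIV. matrix_inv (G x) $ k $ l *
     (pd i (\<lambda>y. G y $ j $ l) x + pd j (\<lambda>y. G y $ i $ l) x - pd l (\<lambda>y. G y $ i $ j) x))"

definition coord_riemann ::
    "(real^'n::finite \<Rightarrow> real^'n^'n) \<Rightarrow> 'n \<Rightarrow> 'n \<Rightarrow> 'n \<Rightarrow> 'n \<Rightarrow> real^'n \<Rightarrow> real" where
  "coord_riemann G l i j k x =
     pd i (coord_christoffel G l j k) x - pd j (coord_christoffel G l i k) x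
     + (\<Sum>m\<in>UNIV. coord_christoffel G m j k x * coord_christoffel G l i m x
              - coord_christoffel G m i k x * coord_christoffel G l j m x)"

lemma christoffel_eq_coord: "christoffel A c g = coord_christoffel (metric_matrix A c g)"
  by (intro ext) (simp add: christoffel_def coord_christoffel_def)

lemma riemann_eq_coord: "riemann A c g = coord_riemann (metric_matrix A c g)"
  by (intro ext) (simp add: riemann_def coord_riemann_def christoffel_eq_coord)

text \<open>Entrywise differentiation of matrix functions; it turns the identities of Bianchi type into
  computations in the noncommutative algebra of matrices.\<close>

definition mpd :: "'n::finite \<Rightarrow> (real^'n \<Rightarrow> real^'m::finite^'m) \<Rightarrow> real^'n \<Rightarrow> real^'m^'m" where
  "mpd i F x = (\<chi> k l. pd i (\<lambda>y. F y $ k $ l) x)"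

definition smooth_mat :: "(real^'n::finite) set \<Rightarrow> (real^'n \<Rightarrow> real^'m::finite^'m) \<Rightarrow> bool" where
  "smooth_mat S F \<longleftrightarrow> (\<forall>k l. smooth_on S (\<lambda>x. F x $ k $ l))"

lemma smooth_matD: "smooth_mat S F \<Longrightarrow> smooth_on S (\<lambda>x. F x $ k $ l)"
  by (simp add: smooth_mat_def)

lemma smooth_mat_differentiable:
  "smooth_mat S F \<Longrightarrow> x \<in> S \<Longrightarrow> (\<lambda>x. F x $ k $ l) differentiable (at x)"
  by (rule smooth_on_imp_differentiable[OF smooth_matD])

lemma smooth_mat_mult:
  "open S \<Longrightarrow> smooth_mat S F \<Longrightarrow> smooth_mat S H \<Longrightarrow> smooth_mat S (\<lambda>x. F x ** H x)"
  by (simp add: smooth_mat_def matrix_matrix_mult_def smooth_on_sum smooth_on_mult)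

lemma smooth_mat_diff:
  "open S \<Longrightarrow> smooth_mat S F \<Longrightarrow> smooth_mat S H \<Longrightarrow> smooth_mat S (\<lambda>x. F x - H x)"
  by (simp add: smooth_mat_def smooth_on_diff)

lemma smooth_mat_transpose: "smooth_mat S F \<Longrightarrow> smooth_mat S (\<lambda>x. transpose (F x))"
  by (simp add: smooth_mat_def transpose_def)

lemma smooth_mat_mpd: "smooth_mat S F \<Longrightarrow> smooth_mat S (mpd i F)"
  by (simp add: smooth_mat_def mpd_def smooth_on_pd)

lemma mpd_cong_open:
  assumes "open S" "x \<in> S" "\<And>y. y \<in> S \<Longrightarrow> F y = H y"
  shows "mpd i F x = mpd i H x"
proof -
  have "pd i (\<lambda>y. F y $ k $ l) x = pd i (\<lambda>y. H y $ k $ l) x" for k l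
    by (rule pd_cong_open[OF assms(1,2)]) (simp add: assms(3))
  then show ?thesis by (simp add: mpd_def)
qed

lemma mpd_add:
  "smooth_mat S F \<Longrightarrow> smooth_mat S H \<Longrightarrow> x \<in> S \<Longrightarrow> mpd i (\<lambda>y. F y + H y) x = mpd i F x + mpd i H x"
  by (simp add: mpd_def vec_eq_iff pd_add smooth_mat_differentiable)

lemma mpd_diff:
  "smooth_mat S F \<Longrightarrow> smooth_mat S H \<Longrightarrow> x \<in> S \<Longrightarrow> mpd i (\<lambda>y. F y - H y) x = mpd i F x - mpd i H x"
  by (simp add: mpd_def vec_eq_iff pd_diff smooth_mat_differentiable)

lemma mpd_transpose: "mpd i (\<lambda>y. transpose (F y)) x = transpose (mpd i F x)"
  by (simp add: mpd_def vec_eq_iff transpose_def)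

lemma mpd_mult:
  assumes "smooth_mat S F" "smooth_mat S H" "x \<in> S"
  shows "mpd i (\<lambda>y. F y ** H y) x = mpd i F x ** H x + F x ** mpd i H x"
proof -
  have d: "(\<lambda>x. F x $ k $ a) differentiable (at x)" "(\<lambda>x. H x $ k $ a) differentiable (at x)" for k a
    using smooth_mat_differentiable assms by blast+
  have "pd i (\<lambda>y. \<Sum>a\<in>UNIV. F y $ k $ a * H y $ a $ l) x
      = (\<Sum>a\<in>UNIV. pd i (\<lambda>y. F y $ k $ a) x * H x $ a $ l)
      + (\<Sum>a\<in>UNIV. F x $ k $ a * pd i (\<lambda>y. H y $ a $ l) x)" for k l
    by (subst pd_sum) (auto intro!: differentiable_mult d simp: pd_mult[OF d] sum.distrib)
  then show ?thesis
    by (simp add: mpd_def vec_eq_iff matrix_matrix_mult_def)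
qed

lemma mpd_commute:
  "open S \<Longrightarrow> smooth_mat S F \<Longrightarrow> x \<in> S \<Longrightarrow> mpd i (mpd j F) x = mpd j (mpd i F) x"
  unfolding mpd_def by (simp add: vec_eq_iff pd_commute[OF _ smooth_matD])

lemma matrix_add_rdistrib: "(B + C) ** A = B ** A + C ** (A :: real^'m^'n)"
  for B :: "real^'n::finite^'k"
  by (simp add: matrix_matrix_mult_def vec_eq_iff distrib_right sum.distrib)

lemma matrix_diff_ldistrib: "A ** (B - C) = A ** B - A ** (C :: real^'m^'n)"
  for A :: "real^'n::finite^'k"
  by (simp add: matrix_matrix_mult_def vec_eq_iff right_diff_distrib sum_subtractf)

lemma matrix_diff_rdistrib: "(B - C) ** A = B ** A - C ** (A :: real^'m^'n)"
  for B :: "real^'n::finite^'k"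
  by (simp add: matrix_matrix_mult_def vec_eq_iff left_diff_distrib sum_subtractf)

lemma transpose_add: "transpose (A + B) = transpose A + transpose B"
  by (simp add: transpose_def vec_eq_iff)

lemma transpose_diff: "transpose (A - B) = transpose A - transpose (B :: real^'m^'n)"
  by (simp add: transpose_def vec_eq_iff)

lemmas matrix_expand = matrix_diff_ldistrib matrix_diff_rdistrib matrix_add_ldistrib
  matrix_add_rdistrib matrix_mul_assoc

abbreviation kronecker :: "'n \<Rightarrow> 'n \<Rightarrow> real" ("\<delta>") where
  "\<delta> i j \<equiv> (if i = j then 1 else 0)"

locale coord_metric =
  fixes S :: "(real^'n::finite) set" and G :: "real^'n \<Rightarrow> real^'n^'n"
  assumes open_dom: "open S"
    and smooth: "\<And>i j. smooth_on S (\<lambda>x. G x $ i $ j)"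
    and sym: "\<And>x i j. x \<in> S \<Longrightarrow> G x $ i $ j = G x $ j $ i"
    and pos: "\<And>x v. x \<in> S \<Longrightarrow> v \<noteq> 0 \<Longrightarrow> v \<bullet> (G x *v v) > 0"
begin

abbreviation \<Gamma> where "\<Gamma> \<equiv> coord_christoffel G"
abbreviation R where "R \<equiv> coord_riemann G"
abbreviation H where "H x \<equiv> matrix_inv (G x)"

text \<open>The connection and its curvature as endomorphisms of the coordinate tangent space: \<open>\<Gamma>m i\<close> is the
  matrix of \<open>z \<mapsto> \<nabla>\<^sub>i z\<close> on constant vectors, and \<open>Rm i j\<close> that of \<open>R(e\<^sub>i,e\<^sub>j)\<close>.\<close>

definition \<Gamma>m :: "'n \<Rightarrow> real^'n \<Rightarrow> real^'n^'n" where
  "\<Gamma>m i x = (\<chi> k j. \<Gamma> k i j x)"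

definition Rm :: "'n \<Rightarrow> 'n \<Rightarrow> real^'n \<Rightarrow> real^'n^'n" where
  "Rm i j x = (\<chi> l k. R l i j k x)"

lemma \<Gamma>m_nth: "\<Gamma>m i x $ k $ j = \<Gamma> k i j x"
  by (simp add: \<Gamma>m_def)

lemma Rm_nth: "Rm i j x $ l $ k = R l i j k x"
  by (simp add: Rm_def)

lemma invertible_G: "x \<in> S \<Longrightarrow> invertible (G x)"
  using pos[of x] by (metis inner_zero_right invertible_left_inverse less_irrefl
      matrix_left_invertible_ker)

lemma transpose_G: "x \<in> S \<Longrightarrow> transpose (G x) = G x"
  using sym by (simp add: transpose_def vec_eq_iff)

lemma G_inv: "x \<in> S \<Longrightarrow> (\<Sum>a\<in>UNIV. G x $ k $ a * H x $ a $ l) = \<delta> k l"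
  "x \<in> S \<Longrightarrow> (\<Sum>a\<in>UNIV. H x $ k $ a * G x $ a $ l) = \<delta> k l"
  using matrix_inv_cancel[OF invertible_G, of x]
  by (simp_all add: matrix_mult_entry mat_def)

lemma smooth_G: "smooth_mat S G"
  by (simp add: smooth_mat_def smooth)

lemma smooth_inv: "smooth_on S (\<lambda>x. H x $ k $ l)"
  by (rule smooth_on_matrix_inv[OF open_dom smooth invertible_G])

lemma smooth_\<Gamma>: "smooth_on S (\<Gamma> k i j)"
  unfolding coord_christoffel_def[abs_def]
  by (intro smooth_on_mult smooth_on_sum smooth_on_add smooth_on_diff smooth_on_const
      smooth_inv smooth_on_pd smooth open_dom)

lemma smooth_\<Gamma>m: "smooth_mat S (\<Gamma>m i)"
  using smooth_\<Gamma> by (simp add: smooth_mat_def \<Gamma>m_nth)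

lemma \<Gamma>_sym: "x \<in> S \<Longrightarrow> \<Gamma> k i j x = \<Gamma> k j i x"
proof -
  assume x: "x \<in> S"
  have "pd l (\<lambda>y. G y $ i $ j) x = pd l (\<lambda>y. G y $ j $ i) x" for l
    by (rule pd_cong_open[OF open_dom x]) (rule sym)
  then show ?thesis
    by (simp add: coord_christoffel_def add.commute)
qed

lemma lower_\<Gamma>:
  assumes x: "x \<in> S"
  shows "(\<Sum>k\<in>UNIV. G x $ m $ k * \<Gamma> k i j x) = (1/2) *
    (pd i (\<lambda>y. G y $ j $ m) x + pd j (\<lambda>y. G y $ i $ m) x - pd m (\<lambda>y. G y $ i $ j) x)"
proof -
  let ?c = "\<lambda>l. pd i (\<lambda>y. G y $ j $ l) x + pd j (\<lambda>y. G y $ i $ l) x - pd l (\<lambda>y. G y $ i $ j) x"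
  have "(\<Sum>k\<in>UNIV. G x $ m $ k * \<Gamma> k i j x)
      = (1/2) * (\<Sum>k\<in>UNIV. \<Sum>l\<in>UNIV. G x $ m $ k * H x $ k $ l * ?c l)"
    by (simp add: coord_christoffel_def sum_distrib_left mult_ac)
  also have "\<dots> = (1/2) * (\<Sum>l\<in>UNIV. (\<Sum>k\<in>UNIV. G x $ m $ k * H x $ k $ l) * ?c l)"
    by (subst sum.swap) (simp add: sum_distrib_right)
  also have "\<dots> = (1/2) * ?c m"
    by (simp add: G_inv(1)[OF x] if_distrib[of "\<lambda>a. a * _"] cong: if_cong)
  finally show ?thesis .
qed

text \<open>The Levi-Civita connection preserves the metric.\<close>

lemma pd_metric:
  assumes x: "x \<in> S"
  shows "pd m (\<lambda>y. G y $ j $ k) x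
    = (\<Sum>a\<in>UNIV. G x $ j $ a * \<Gamma> a m k x) + (\<Sum>a\<in>UNIV. G x $ k $ a * \<Gamma> a m j x)"
proof -
  have "pd l (\<lambda>y. G y $ i $ j) x = pd l (\<lambda>y. G y $ j $ i) x" for l i j
    by (rule pd_cong_open[OF open_dom x]) (rule sym)
  then show ?thesis
    by (simp add: lower_\<Gamma>[OF x] field_simps)
qed

lemma mpd_metric:
  assumes "x \<in> S"
  shows "mpd m G x = G x ** \<Gamma>m m x + transpose (G x ** \<Gamma>m m x)"
  using pd_metric[OF assms]
  by (simp add: mpd_def vec_eq_iff matrix_matrix_mult_def transpose_def \<Gamma>m_nth)

lemma Rm_eq: "x \<in> S \<Longrightarrow> Rm i j x = mpd i (\<Gamma>m j) x - mpd j (\<Gamma>m i) x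
    + (\<Gamma>m i x ** \<Gamma>m j x - \<Gamma>m j x ** \<Gamma>m i x)"
  by (simp add: vec_eq_iff Rm_nth coord_riemann_def mpd_def \<Gamma>m_nth matrix_matrix_mult_def
      sum_subtractf mult.commute)

lemma riemann_antisym12: "R l i j k x = - R l j i k x"
  by (simp add: coord_riemann_def sum_subtractf)

lemma bianchi1:
  assumes "x \<in> S"
  shows "R l i j k x + R l j k i x + R l k i j x = 0"
proof -
  have "pd m (\<Gamma> l i j) x = pd m (\<Gamma> l j i) x" for m i j
    by (rule pd_cong_open[OF open_dom assms]) (rule \<Gamma>_sym)
  then have "pd i (\<Gamma> l k j) x = pd i (\<Gamma> l j k) x" "pd j (\<Gamma> l k i) x = pd j (\<Gamma> l i k) x"
    "pd k (\<Gamma> l j i) x = pd k (\<Gamma> l i j) x" by blast+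
  moreover have "\<Gamma> a k j x = \<Gamma> a j k x" "\<Gamma> a k i x = \<Gamma> a i k x" "\<Gamma> a j i x = \<Gamma> a i j x" for a
    using \<Gamma>_sym[OF assms] by blast+
  ultimately show ?thesis
    by (simp add: coord_riemann_def sum_subtractf)
qed

text \<open>Antisymmetry in the last two indices expresses that second derivatives of the metric
  commute.\<close>

lemma lowered_Rm_antisym:
  assumes x: "x \<in> S"
  shows "G x ** Rm i j x + transpose (G x ** Rm i j x) = 0"
proof -
  have GG: "smooth_mat S (\<lambda>y. G y ** \<Gamma>m m y)" for m
    by (intro smooth_mat_mult open_dom smooth_G smooth_\<Gamma>m)
  have 1: "mpd i (mpd j G) x
    = (G x ** \<Gamma>m i x + transpose (G x ** \<Gamma>m i x)) ** \<Gamma>m j x + G x ** mpd i (\<Gamma>m j) x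
     + transpose ((G x ** \<Gamma>m i x + transpose (G x ** \<Gamma>m i x)) ** \<Gamma>m j x + G x ** mpd i (\<Gamma>m j) x)"
    for i j
  proof -
    have "mpd i (mpd j G) x = mpd i (\<lambda>y. G y ** \<Gamma>m j y + transpose (G y ** \<Gamma>m j y)) x"
      by (rule mpd_cong_open[OF open_dom x mpd_metric])
    then show ?thesis
      by (simp add: mpd_add[OF GG smooth_mat_transpose[OF GG] x] mpd_transpose
          mpd_mult[OF smooth_G smooth_\<Gamma>m x] mpd_metric[OF x])
  qed
  have "mpd i (mpd j G) x - mpd j (mpd i G) x = 0"
    using mpd_commute[OF open_dom smooth_G x] by simp
  moreover have "G x ** Rm i j x + transpose (G x ** Rm i j x)
      = mpd i (mpd j G) x - mpd j (mpd i G) x"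
    unfolding 1 Rm_eq[OF x]
    by (simp add: matrix_expand transpose_add transpose_diff matrix_transpose_mul transpose_G[OF x])
  ultimately show ?thesis by simp
qed

text \<open>The second Bianchi identity, with the covariant derivative taken only in the endomorphism
  slots: the terms from the two form slots cancel in the cyclic sum, as the connection has no
  torsion.  What remains is the commutation of partial derivatives and the Jacobi identity.\<close>

lemma bianchi2:
  assumes x: "x \<in> S"
  shows "(mpd m (Rm i j) x + \<Gamma>m m x ** Rm i j x - Rm i j x ** \<Gamma>m m x)
    + (mpd i (Rm j m) x + \<Gamma>m i x ** Rm j m x - Rm j m x ** \<Gamma>m i x)
    + (mpd j (Rm m i) x + \<Gamma>m j x ** Rm m i x - Rm m i x ** \<Gamma>m j x) = 0"
proof -
  have 1: "mpd m (Rm i j) x = mpd m (mpd i (\<Gamma>m j)) x - mpd m (mpd j (\<Gamma>m i)) x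
    + (mpd m (\<Gamma>m i) x ** \<Gamma>m j x + \<Gamma>m i x ** mpd m (\<Gamma>m j) x
      - (mpd m (\<Gamma>m j) x ** \<Gamma>m i x + \<Gamma>m j x ** mpd m (\<Gamma>m i) x))" for m i j
  proof -
    have s1: "smooth_mat S (mpd i (\<Gamma>m j))" for i j
      by (rule smooth_mat_mpd[OF smooth_\<Gamma>m])
    have s2: "smooth_mat S (\<lambda>y. \<Gamma>m i y ** \<Gamma>m j y)" for i j
      by (rule smooth_mat_mult[OF open_dom smooth_\<Gamma>m smooth_\<Gamma>m])
    have "mpd m (Rm i j) x = mpd m (\<lambda>y. mpd i (\<Gamma>m j) y - mpd j (\<Gamma>m i) y
        + (\<Gamma>m i y ** \<Gamma>m j y - \<Gamma>m j y ** \<Gamma>m i y)) x"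
      by (rule mpd_cong_open[OF open_dom x Rm_eq])
    then show ?thesis
      by (simp add: mpd_add[OF smooth_mat_diff[OF open_dom s1 s1] smooth_mat_diff[OF open_dom s2 s2] x]
          mpd_diff[OF s1 s1 x] mpd_diff[OF s2 s2 x] mpd_mult[OF smooth_\<Gamma>m smooth_\<Gamma>m x])
  qed
  have 2: "mpd m (mpd i (\<Gamma>m j)) x = mpd i (mpd m (\<Gamma>m j)) x"
    "mpd j (mpd m (\<Gamma>m i)) x = mpd m (mpd j (\<Gamma>m i)) x"
    "mpd i (mpd j (\<Gamma>m m)) x = mpd j (mpd i (\<Gamma>m m)) x"
    using mpd_commute[OF open_dom smooth_\<Gamma>m x] by blast+
  show ?thesis
    unfolding 1 Rm_eq[OF x] 2 by (simp add: matrix_expand)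
qed

section \<open>Schur's lemma in coordinates\<close>

text \<open>The endomorphism \<open>z \<mapsto> g(e\<^sub>j,z) e\<^sub>i - g(e\<^sub>i,z) e\<^sub>j\<close>: the curvature \<open>R(e\<^sub>i,e\<^sub>j)\<close> of a space of curvature one.\<close>

definition const_curv_mat :: "'n \<Rightarrow> 'n \<Rightarrow> real^'n \<Rightarrow> real^'n^'n" where
  "const_curv_mat i j x = (\<chi> l k. \<delta> l i * G x $ j $ k - \<delta> l j * G x $ i $ k)"

lemma smooth_const_curv_mat: "smooth_mat S (const_curv_mat i j)"
  unfolding smooth_mat_def const_curv_mat_def vec_lambda_beta
  by (intro allI smooth_on_diff smooth_on_mult smooth_on_const smooth open_dom)

lemma sum_kronecker:
  "(\<Sum>a\<in>(UNIV :: 'b::finite set). h a * \<delta> a i) = (h i :: real)"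
  "(\<Sum>a\<in>(UNIV :: 'b::finite set). h a * \<delta> i a) = (h i :: real)"
  "(\<Sum>a\<in>(UNIV :: 'b::finite set). \<delta> a i * h a) = (h i :: real)"
  "(\<Sum>a\<in>(UNIV :: 'b::finite set). \<delta> i a * h a) = (h i :: real)"
  by (simp_all add: if_distrib[of "\<lambda>a. a * _"] if_distrib[of "\<lambda>a. _ * a"] cong: if_cong)

text \<open>The metric is parallel and the connection is symmetric, so after the derivatives of the metric
  are expressed by Christoffel symbols every term of the cyclic sum occurs twice, with opposite
  signs.\<close>

lemma const_curv_bianchi2:
  assumes x: "x \<in> S"
  defines "D \<equiv> \<lambda>m i j. mpd m (const_curv_mat i j) x
      + \<Gamma>m m x ** const_curv_mat i j x - const_curv_mat i j x ** \<Gamma>m m x"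
  shows "D m i j + D i j m + D j m i = 0"
proof -
  define E where "E k i j = (\<Sum>a\<in>UNIV. G x $ k $ a * \<Gamma> a i j x)" for k i j
  have E_sym: "E k i j = E k j i" for k i j
    by (simp add: E_def \<Gamma>_sym[OF x])
  have d: "(\<lambda>x. G x $ k $ l) differentiable (at x)" for k l
    using smooth_mat_differentiable[OF smooth_G x] .
  have D: "D m i j $ l $ k = \<delta> l i * E k m j - \<delta> l j * E k m i
      + \<Gamma> l m i x * G x $ j $ k - \<Gamma> l m j x * G x $ i $ k" for m i j l k
  proof -
    have "mpd m (const_curv_mat i j) x $ l $ k
        = \<delta> l i * pd m (\<lambda>y. G y $ j $ k) x - \<delta> l j * pd m (\<lambda>y. G y $ i $ k) x"
      unfolding mpd_def const_curv_mat_def vec_lambda_beta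
      by (subst pd_diff) (simp_all only: pd_cmult[OF d] differentiable_mult[OF differentiable_const d])
    also have "\<dots> = \<delta> l i * (E j m k + E k m j) - \<delta> l j * (E i m k + E k m i)"
      by (simp add: pd_metric[OF x] E_def)
    finally have 1: "mpd m (const_curv_mat i j) x $ l $ k
        = \<delta> l i * (E j m k + E k m j) - \<delta> l j * (E i m k + E k m i)" .
    have 2: "(\<Gamma>m m x ** const_curv_mat i j x) $ l $ k
        = \<Gamma> l m i x * G x $ j $ k - \<Gamma> l m j x * G x $ i $ k"
    proof -
      have "(\<Gamma>m m x ** const_curv_mat i j x) $ l $ k
        = (\<Sum>a\<in>UNIV. (\<Gamma> l m a x * G x $ j $ k) * \<delta> a i) - (\<Sum>a\<in>UNIV. (\<Gamma> l m a x * G x $ i $ k) * \<delta> a j)"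
        unfolding sum_subtractf[symmetric]
        by (simp only: matrix_matrix_mult_def const_curv_mat_def \<Gamma>m_nth vec_lambda_beta)
          (simp only: algebra_simps)
      then show ?thesis by (simp only: sum_kronecker)
    qed
    have 3: "(const_curv_mat i j x ** \<Gamma>m m x) $ l $ k = \<delta> l i * E j m k - \<delta> l j * E i m k"
      unfolding E_def sum_distrib_left sum_subtractf[symmetric]
      by (simp only: matrix_matrix_mult_def const_curv_mat_def \<Gamma>m_nth vec_lambda_beta)
        (simp only: algebra_simps)
    show ?thesis
      unfolding D_def vector_add_component vector_minus_component 1 2 3 by (simp add: algebra_simps)
  qed
  show ?thesis
    unfolding vec_eq_iff vector_add_component D zero_index
    using E_sym[of _ j i] E_sym[of _ m i] E_sym[of _ m j]
      \<Gamma>_sym[OF x, of _ j i] \<Gamma>_sym[OF x, of _ m i] \<Gamma>_sym[OF x, of _ m j]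
    by (simp only:) (simp add: algebra_simps)
qed

lemma mpd_scaleR:
  assumes "\<kappa> differentiable (at x)" "smooth_mat S F" "x \<in> S"
  shows "mpd i (\<lambda>y. \<kappa> y *\<^sub>R F y) x = pd i \<kappa> x *\<^sub>R F x + \<kappa> x *\<^sub>R mpd i F x"
  using assms by (simp add: mpd_def vec_eq_iff pd_mult smooth_mat_differentiable)

text \<open>If the curvature is \<open>\<kappa>\<close> times the constant curvature form, subtracting \<open>\<kappa>\<close> times its Bianchi
  identity from the one of the curvature leaves a relation among the derivatives of \<open>\<kappa>\<close>, which in
  dimension at least three forces them to vanish: three distinct indices are needed.\<close>

lemma schur_coord:
  assumes dim: "CARD('n) > 2"
    and curv: "\<And>y i j. y \<in> S \<Longrightarrow> Rm i j y = \<kappa> y *\<^sub>R const_curv_mat i j y"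
    and x: "x \<in> S"
  shows "(\<kappa> has_derivative (\<lambda>h. 0)) (at x)"
proof -
  have diag: "G y $ j $ j > 0" if "y \<in> S" for y j
    using pos[OF that, of "axis j 1"]
    by (simp add: matrix_vector_mult_basis column_def inner_axis' axis_eq_0_iff)
  have others: "\<exists>i j. i \<noteq> m \<and> j \<noteq> m \<and> i \<noteq> j" for m :: 'n
  proof -
    have "\<not> card (UNIV - {m}) \<le> Suc 0"
      using dim by (simp add: card_Diff_singleton)
    then show ?thesis
      by (subst (asm) card_le_Suc0_iff_eq) auto
  qed
  have \<kappa>_diff: "\<kappa> differentiable (at x)"
  proof -
    \<comment> \<open>The curvature function is a quotient of components, hence smooth.\<close>
    obtain i j :: 'n where ij: "i \<noteq> j" using others by blast
    have "smooth_on S (R i i j j)"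
      unfolding coord_riemann_def[abs_def]
      by (intro smooth_on_add smooth_on_sum smooth_on_diff smooth_on_mult smooth_on_pd
          smooth_\<Gamma> open_dom)
    then have "smooth_on S (\<lambda>y. R i i j j y * inverse (G y $ j $ j))"
      using diag by (intro smooth_on_mult smooth_on_inverse smooth open_dom) (auto simp: less_le)
    moreover have "R i i j j y * inverse (G y $ j $ j) = \<kappa> y" if "y \<in> S" for y
    proof -
      have "R i i j j y = \<kappa> y * G y $ j $ j"
        using curv[OF that, of i j] ij
        by (simp add: Rm_nth[symmetric] const_curv_mat_def)
      then show ?thesis using diag[OF that, of j] by simp
    qed
    ultimately have "smooth_on S \<kappa>"
      by (rule smooth_on_cong[OF open_dom, rotated])
    then show ?thesis using x by (rule smooth_on_imp_differentiable)
  qed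
  have "pd m \<kappa> x = 0" for m
  proof -
    obtain i j where ij: "i \<noteq> m" "j \<noteq> m" "i \<noteq> j" using others by blast
    let ?K = const_curv_mat
    let ?D = "\<lambda>m i j. mpd m (?K i j) x + \<Gamma>m m x ** ?K i j x - ?K i j x ** \<Gamma>m m x"
    have d: "mpd m (Rm i j) x + \<Gamma>m m x ** Rm i j x - Rm i j x ** \<Gamma>m m x
        = pd m \<kappa> x *\<^sub>R ?K i j x + \<kappa> x *\<^sub>R ?D m i j" for m i j
    proof -
      have "mpd m (Rm i j) x = mpd m (\<lambda>y. \<kappa> y *\<^sub>R ?K i j y) x"
        by (rule mpd_cong_open[OF open_dom x curv])
      then show ?thesis
        by (simp add: mpd_scaleR[OF \<kappa>_diff smooth_const_curv_mat x] curv[OF x] matrix_scalar_ac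
            scalar_matrix_assoc[symmetric] algebra_simps)
    qed
    have "pd m \<kappa> x *\<^sub>R ?K i j x + pd i \<kappa> x *\<^sub>R ?K j m x + pd j \<kappa> x *\<^sub>R ?K m i x
        + \<kappa> x *\<^sub>R (?D m i j + ?D i j m + ?D j m i) = 0"
      using bianchi2[OF x, of m i j] unfolding d by (simp add: algebra_simps)
    then have "pd m \<kappa> x *\<^sub>R ?K i j x + pd i \<kappa> x *\<^sub>R ?K j m x + pd j \<kappa> x *\<^sub>R ?K m i x = 0"
      unfolding const_curv_bianchi2[OF x] by simp
    \<comment> \<open>As the three indices are distinct, row \<open>i\<close> contains only two terms, proportional to the rows
      \<open>j\<close> and \<open>m\<close> of the metric; the inverse matrix separates these.\<close>
    then have "(pd m \<kappa> x *\<^sub>R ?K i j x + pd i \<kappa> x *\<^sub>R ?K j m x + pd j \<kappa> x *\<^sub>R ?K m i x) $ i $ k = 0" for k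
      by simp
    then have "pd m \<kappa> x * G x $ j $ k = pd j \<kappa> x * G x $ m $ k" for k
      using ij by (simp add: const_curv_mat_def)
    then have "pd m \<kappa> x * (\<Sum>k\<in>UNIV. G x $ j $ k * H x $ k $ j)
        = pd j \<kappa> x * (\<Sum>k\<in>UNIV. G x $ m $ k * H x $ k $ j)"
      by (simp add: sum_distrib_left mult.assoc[symmetric])
    then show ?thesis using ij by (simp add: G_inv[OF x])
  qed
  then have "frechet_derivative \<kappa> (at x) = (\<lambda>h. 0)"
    by (intro ext) (simp add: frechet_derivative_eq_sum_pd[OF \<kappa>_diff])
  then show ?thesis
    using \<kappa>_diff by (simp add: frechet_derivative_works)
qed

end

section \<open>Algebra of curvature forms\<close>

text \<open>Values on coordinate vectors of the bilinear and quadrilinear forms with the given components.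
  The order of the arguments of \<open>form4\<close> is that of \<open>g(R(x,y)z,w)\<close>, so sectional curvatures are its
  values on \<open>v, u, u, v\<close>.\<close>

definition form2 :: "('n::finite \<Rightarrow> 'n \<Rightarrow> real) \<Rightarrow> real^'n \<Rightarrow> real^'n \<Rightarrow> real" where
  "form2 B v w = (\<Sum>i\<in>UNIV. \<Sum>j\<in>UNIV. B i j * v $ i * w $ j)"

definition form4 :: "('n::finite \<Rightarrow> 'n \<Rightarrow> 'n \<Rightarrow> 'n \<Rightarrow> real)
    \<Rightarrow> real^'n \<Rightarrow> real^'n \<Rightarrow> real^'n \<Rightarrow> real^'n \<Rightarrow> real" where
  "form4 T x y z w
    = (\<Sum>i\<in>UNIV. \<Sum>j\<in>UNIV. \<Sum>k\<in>UNIV. \<Sum>m\<in>UNIV. T i j k m * x $ i * y $ j * z $ k * w $ m)"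

lemma form2_left_add: "form2 B (v + v') w = form2 B v w + form2 B v' w"
  by (simp add: form2_def algebra_simps sum.distrib)

lemma form2_left_scale: "form2 B (c *\<^sub>R v) w = c * form2 B v w"
  by (simp add: form2_def algebra_simps sum_distrib_left)

lemma form2_swap: "form2 B w v = form2 (\<lambda>i j. B j i) v w"
  unfolding form2_def by (subst sum.swap) (simp add: ac_simps)

lemma form2_sym:
  assumes "\<And>i j. B i j = B j i"
  shows "form2 B v w = form2 B w v"
proof -
  have "(\<lambda>i j. B j i) = B" by (intro ext) (rule assms)
  then show ?thesis by (simp add: form2_swap[of B w v])
qed

lemma bilinear_form2: "bilinear (form2 B)"
  unfolding bilinear_def
  by (auto intro!: linearI simp: form2_left_add form2_left_scale)
    (simp_all add: form2_swap[of B] form2_left_add form2_left_scale)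

lemma form2_add: "form2 (\<lambda>i j. B i j + C i j) v w = form2 B v w + form2 C v w"
  by (simp add: form2_def algebra_simps sum.distrib)

lemma form2_scale: "form2 (\<lambda>i j. c * B i j) v w = c * form2 B v w"
  by (simp add: form2_def algebra_simps sum_distrib_left)

lemma form2_prod: "form2 (\<lambda>i j. a i * b j) v w = (\<Sum>i\<in>UNIV. a i * v $ i) * (\<Sum>j\<in>UNIV. b j * w $ j)"
  by (simp add: form2_def sum_product algebra_simps)

lemma form2_matrix: "form2 (\<lambda>i j. A $ i $ j) v w = v \<bullet> (A *v w)"
  by (simp add: form2_def inner_vec_def matrix_vector_mult_def sum_distrib_left algebra_simps)

lemma form4_add1: "form4 T (x + x') y z w = form4 T x y z w + form4 T x' y z w"
  by (simp add: form4_def algebra_simps sum.distrib)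

lemma form4_scale1: "form4 T (c *\<^sub>R x) y z w = c * form4 T x y z w"
  by (simp add: form4_def algebra_simps sum_distrib_left)

lemma form4_swap12: "form4 T y x z w = form4 (\<lambda>i j k m. T j i k m) x y z w"
  unfolding form4_def by (subst sum.swap) (simp add: ac_simps)

lemma form4_swap23: "form4 T x z y w = form4 (\<lambda>i j k m. T i k j m) x y z w"
  unfolding form4_def
  by (rule sum.cong[OF refl], subst sum.swap) (simp add: ac_simps)

lemma form4_swap34: "form4 T x y w z = form4 (\<lambda>i j k m. T i j m k) x y z w"
  unfolding form4_def
  by (rule sum.cong[OF refl], rule sum.cong[OF refl], subst sum.swap) (simp add: ac_simps)

lemma form4_add2: "form4 T x (y + y') z w = form4 T x y z w + form4 T x y' z w"
  unfolding form4_swap12[of T x] by (rule form4_add1)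

lemma form4_add3: "form4 T x y (z + z') w = form4 T x y z w + form4 T x y z' w"
  unfolding form4_swap23[of T x y] by (rule form4_add2)

lemma form4_add4: "form4 T x y z (w + w') = form4 T x y z w + form4 T x y z w'"
  unfolding form4_swap34[of T x y z] by (rule form4_add3)

lemma form4_scale2: "form4 T x (c *\<^sub>R y) z w = c * form4 T x y z w"
  unfolding form4_swap12[of T x] by (rule form4_scale1)

lemma form4_scale3: "form4 T x y (c *\<^sub>R z) w = c * form4 T x y z w"
  unfolding form4_swap23[of T x y] by (rule form4_scale2)

lemma form4_scale4: "form4 T x y z (c *\<^sub>R w) = c * form4 T x y z w"
  unfolding form4_swap34[of T x y z] by (rule form4_scale3)

lemmas form4_linear = form4_add1 form4_add2 form4_add3 form4_add4
  form4_scale1 form4_scale2 form4_scale3 form4_scale4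

lemma form4_add: "form4 (\<lambda>i j k m. T i j k m + U i j k m) x y z w = form4 T x y z w + form4 U x y z w"
  by (simp add: form4_def algebra_simps sum.distrib)

lemma form4_diff: "form4 (\<lambda>i j k m. T i j k m - U i j k m) x y z w = form4 T x y z w - form4 U x y z w"
  by (simp add: form4_def algebra_simps sum_subtractf)

lemma form4_minus: "form4 (\<lambda>i j k m. - T i j k m) x y z w = - form4 T x y z w"
  by (simp add: form4_def sum_negf)

lemma form4_scale: "form4 (\<lambda>i j k m. c * T i j k m) x y z w = c * form4 T x y z w"
  by (simp add: form4_def algebra_simps sum_distrib_left)

lemma form4_prod: "form4 (\<lambda>i j k m. B i j * C k m) x y z w = form2 B x y * form2 C z w"
  unfolding form4_def form2_def sum_distrib_right unfolding sum_distrib_left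
  by (simp add: mult_ac)

lemma form4_prod_cross: "form4 (\<lambda>i j k m. B i k * C j m) x y z w = form2 B x z * form2 C y w"
  using form4_prod[of B C x z y w] form4_swap23[of "\<lambda>i j k m. B i j * C k m" x z y w] by simp

lemma form4_prod_outer: "form4 (\<lambda>i j k m. B i m * C j k) x y z w = form2 B x w * form2 C y z"
  using form4_prod_cross[of B C x y w z] form4_swap34[of "\<lambda>i j k m. B i k * C j m" x y w z] by simp

lemma form4_axis: "form4 T (axis i 1) (axis j 1) (axis k 1) (axis m 1) = T i j k m"
proof -
  have "(\<Sum>a\<in>UNIV. h a * axis b 1 $ a) = h b" for h :: "'a \<Rightarrow> real" and b
    by (simp add: axis_def if_distrib[of "\<lambda>a. _ * a"] cong: if_cong)
  then show ?thesis
    by (simp add: form4_def sum_distrib_right[symmetric])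
qed

locale curvature_form =
  fixes T :: "'n::finite \<Rightarrow> 'n \<Rightarrow> 'n \<Rightarrow> 'n \<Rightarrow> real"
  assumes antisym12: "T i j k m = - T j i k m"
    and antisym34: "T i j k m = - T i j m k"
    and cyclic: "T i j k m + T j k i m + T k i j m = 0"
begin

lemma form4_antisym12: "form4 T x y z w = - form4 T y x z w"
proof -
  have "T = (\<lambda>i j k m. - T j i k m)" by (intro ext) (rule antisym12)
  then show ?thesis by (metis form4_swap12 form4_minus)
qed

lemma form4_antisym34: "form4 T x y z w = - form4 T x y w z"
proof -
  have "T = (\<lambda>i j k m. - T i j m k)" by (intro ext) (rule antisym34)
  then show ?thesis by (metis form4_swap34 form4_minus)
qed

lemma form4_cyclic: "form4 T x y z w + form4 T y z x w + form4 T z x y w = 0"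
proof -
  have "form4 T y z x w = form4 (\<lambda>i j k m. T j k i m) x y z w"
    by (simp only: form4_swap23[of T y z x w] form4_swap12[of _ y x z w])
  moreover have "form4 T z x y w = form4 (\<lambda>i j k m. T k i j m) x y z w"
    by (simp only: form4_swap12[of T z x y w] form4_swap23[of _ x z y w])
  ultimately show ?thesis
    by (simp add: form4_add[symmetric] cyclic) (simp add: form4_def)
qed

text \<open>The octahedron argument: the four cyclic sums obtained by rotating the arguments are combined so
  that all terms but the two wanted ones cancel.\<close>

lemma form4_pair_swap: "form4 T x y z w = form4 T z w x y"
  using form4_cyclic[of x y z w] form4_cyclic[of y z w x] form4_cyclic[of z w x y]
    form4_cyclic[of w x y z]
    form4_antisym34[of y z w x] form4_antisym34[of z w y x]
    form4_antisym34[of y w x z] form4_antisym12[of w y z x]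
    form4_antisym12[of w x z y] form4_antisym34[of x w z y]
    form4_antisym12[of x z w y] form4_antisym34[of z x w y]
    form4_antisym12[of w x y z] form4_antisym34[of x y w z]
  by linarith

text \<open>A curvature form is determined by its values on pairs: polarization in the outer vectors makes
  the form antisymmetric in the two middle ones as well, and then the cyclic sum is three times the
  form.\<close>

lemma vanishes_if_sectional_vanishes:
  assumes "\<And>x y. form4 T x y y x = 0"
  shows "T i j k m = 0"
proof -
  have 1: "form4 T x y y w = 0" for x y w
    using assms[of "x + w" y] assms[of x y] assms[of w y] form4_pair_swap[of w y y x]
      form4_antisym12[of y x w y] form4_antisym34[of x y w y]
    by (simp add: form4_linear)
  have 2: "form4 T x y z w = - form4 T x z y w" for x y z w
    using 1[of x "y + z" w] 1[of x y w] 1[of x z w] by (simp add: form4_linear)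
  have "form4 T x y z w = 0" for x y z w
    using form4_cyclic[of x y z w] 2[of y z x w] form4_antisym12[of y x z w] 2[of x z y w]
      form4_antisym12[of z x y w] by linarith
  then show ?thesis using form4_axis[of T i j k m] by metis
qed

end

locale inner_form =
  fixes b :: "real^'n::finite \<Rightarrow> real^'n \<Rightarrow> real"
  assumes bilin: "bilinear b"
    and sym: "b v w = b w v"
    and pos: "v \<noteq> 0 \<Longrightarrow> b v v > 0"
begin

lemmas b_simps = bilinear_ladd[OF bilin] bilinear_radd[OF bilin] bilinear_lmul[OF bilin]
  bilinear_rmul[OF bilin] bilinear_lsub[OF bilin] bilinear_rsub[OF bilin]
  bilinear_lzero[OF bilin] bilinear_rzero[OF bilin]

definition orthonormal :: "real^'n \<Rightarrow> real^'n \<Rightarrow> bool" where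
  "orthonormal v u \<longleftrightarrow> b v v = 1 \<and> b u u = 1 \<and> b v u = 0"

lemma orthonormal_sym: "orthonormal v u \<Longrightarrow> orthonormal u v"
  by (simp add: orthonormal_def sym)

lemma normalize:
  assumes "v \<noteq> 0"
  obtains c e where "c \<noteq> 0" "v = c *\<^sub>R e" "b e e = 1"
proof
  let ?c = "sqrt (b v v)"
  show c: "?c \<noteq> 0" "v = ?c *\<^sub>R ((1 / ?c) *\<^sub>R v)" using pos[OF assms] by auto
  show "b ((1 / ?c) *\<^sub>R v) ((1 / ?c) *\<^sub>R v) = 1"
    using pos[OF assms] by (simp add: b_simps)
qed

text \<open>Orthogonality for \<open>b\<close> to \<open>v\<close> and \<open>w\<close> is orthogonality for the standard inner product to the two
  vectors representing \<open>b v\<close> and \<open>b w\<close>, whose span has dimension at most two.\<close>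

lemma unit_orthogonal_to_pair:
  assumes "CARD('n) > 2"
  obtains u where "b u u = 1" "b v u = 0" "b w u = 0"
proof -
  let ?r = "\<lambda>v. \<Sum>e\<in>Basis. b v e *\<^sub>R e"
  have r: "?r v \<bullet> u = b v u" for v u
  proof -
    have "b v u = b v (\<Sum>e\<in>Basis. (u \<bullet> e) *\<^sub>R e)" by (simp add: euclidean_representation)
    also have "\<dots> = (\<Sum>e\<in>Basis. (u \<bullet> e) * b v e)"
      using bilin by (simp add: bilinear_def linear_sum linear_scale)
    finally show ?thesis by (simp add: inner_sum_left inner_commute[of u] mult.commute)
  qed
  have "dim {?r v, ?r w} \<le> card {?r v, ?r w}"
    by (rule dim_le_card') simp
  also have "\<dots> \<le> 2" by (simp add: card_insert_if)
  also have "\<dots> < DIM(real^'n)" using assms by simp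
  finally obtain u where u: "u \<noteq> 0" "\<And>y. y \<in> span {?r v, ?r w} \<Longrightarrow> orthogonal u y"
    using orthogonal_to_subspace_exists by blast
  have "b v u = 0" "b w u = 0"
    using u(2)[of "?r v"] u(2)[of "?r w"] r
    by (auto simp: orthogonal_def inner_commute span_base)
  moreover obtain c e where ce: "c \<noteq> 0" "u = c *\<^sub>R e" "b e e = 1"
    using normalize[OF u(1)] .
  ultimately show ?thesis
    using that[of e] by (simp add: b_simps)
qed

lemma proportional_if_constant_on_unit:
  assumes B: "bilinear B" "\<And>v w. B v w = B w v" and unit: "\<And>v. b v v = 1 \<Longrightarrow> B v v = \<phi>"
  shows "B v w = \<phi> * b v w"
proof -
  have diag: "B v v = \<phi> * b v v" for v
  proof (cases "v = 0")
    case False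
    then obtain c e where "c \<noteq> 0" "v = c *\<^sub>R e" "b e e = 1" by (rule normalize)
    then show ?thesis
      using unit[of e] by (simp add: b_simps bilinear_lmul[OF B(1)] bilinear_rmul[OF B(1)])
  qed (simp add: b_simps bilinear_lzero[OF B(1)])
  show ?thesis
    using diag[of "v + w"] diag[of v] diag[of w] B(2)[of v w] sym[of v w]
    by (simp add: b_simps bilinear_ladd[OF B(1)] bilinear_radd[OF B(1)] algebra_simps)
qed

text \<open>A unit vector \<open>v\<close> need not be orthogonal to a fixed unit vector \<open>e\<close>, but both are orthogonal to a
  third one, through which the values of \<open>B\<close> at \<open>v\<close> and \<open>e\<close> are compared.\<close>

lemma proportional_if_equal_on_orthonormal:
  assumes dim: "CARD('n) > 2" and B: "bilinear B" "\<And>v w. B v w = B w v"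
    and eq: "\<And>v u. orthonormal v u \<Longrightarrow> B v v = B u u"
  obtains \<phi> where "\<And>v w. B v w = \<phi> * b v w"
proof -
  obtain e where e: "b e e = 1" using unit_orthogonal_to_pair[OF dim] by metis
  have "B v v = B e e" if "b v v = 1" for v
  proof -
    obtain u where "b u u = 1" "b v u = 0" "b e u = 0"
      using unit_orthogonal_to_pair[OF dim] .
    then show ?thesis using eq[of v u] eq[of e u] that e by (simp add: orthonormal_def)
  qed
  then show ?thesis
    using proportional_if_constant_on_unit[OF B] that by blast
qed

text \<open>Three orthonormal vectors separate the two terms of a constant sum.\<close>

lemma constant_on_unit_if_sum_constant:
  assumes dim: "CARD('n) > 2" and eq: "\<And>v u. orthonormal v u \<Longrightarrow> q v + q u = (C :: real)"
    and "b v v = 1"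
  shows "q v = C / 2"
proof -
  obtain u where u: "b u u = 1" "b v u = 0" using unit_orthogonal_to_pair[OF dim] by metis
  obtain w where w: "b w w = 1" "b v w = 0" "b u w = 0"
    using unit_orthogonal_to_pair[OF dim] .
  show ?thesis
    using eq[of v u] eq[of v w] eq[of u w] u w assms(3) by (simp add: orthonormal_def)
qed

end

locale curvature_inner_form = curvature_form T + inner_form b
  for T :: "'n::finite \<Rightarrow> 'n \<Rightarrow> 'n \<Rightarrow> 'n \<Rightarrow> real" and b :: "real^'n \<Rightarrow> real^'n \<Rightarrow> real"
begin

text \<open>By Gram--Schmidt it suffices to have orthonormal pairs: both sides are unchanged when a multiple of one vector is subtracted from the
  other.\<close>

lemma sectional_from_orthonormal:
  assumes "\<And>v u. orthonormal v u \<Longrightarrow> form4 T v u u v = \<kappa>"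
  shows "form4 T v u u v = \<kappa> * (b v v * b u u - (b v u)\<^sup>2)"
proof (cases "v = 0")
  case True
  then show ?thesis using form4_scale1[of T 0 v] by (simp add: b_simps)
next
  case False
  then obtain c e where ce: "v = c *\<^sub>R e" "b e e = 1" by (rule normalize)
  define u' where "u' = u - b e u *\<^sub>R e"
  have u: "u = u' + b e u *\<^sub>R e" by (simp add: u'_def)
  have eu': "b e u' = 0" by (simp add: u'_def b_simps ce)
  have z: "form4 T e e x y = 0" "form4 T x y e e = 0" for x y
    using form4_antisym12[of e e x y] form4_antisym34[of x y e e] by linarith+
  have "form4 T e u u e = form4 T e u' u' e"
    by (subst (1 2) u) (simp add: form4_linear z)
  also have "\<dots> = \<kappa> * b u' u'"
  proof (cases "u' = 0")
    case True
    then show ?thesis using form4_scale2[of T e 0 u' u' e] by (simp add: b_simps)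
  next
    case False
    then obtain d h where dh: "d \<noteq> 0" "u' = d *\<^sub>R h" "b h h = 1" by (rule normalize)
    then have "orthonormal e h" using eu' ce by (simp add: orthonormal_def b_simps)
    then show ?thesis using assms[of e h] dh by (simp add: form4_linear b_simps)
  qed
  also have "b u' u' = b u u - (b e u)\<^sup>2"
    by (simp add: u'_def b_simps ce sym[of u e] power2_eq_square algebra_simps)
  finally have e: "form4 T e u u e = \<kappa> * (b u u - (b e u)\<^sup>2)" .
  have "form4 T v u u v = c * c * form4 T e u u e" "b v v = c * c" "b v u = c * b e u"
    by (simp_all add: ce form4_linear b_simps)
  then show ?thesis
    unfolding e by (simp add: power2_eq_square algebra_simps)
qed

end

text \<open>The difference of the two sides is again a curvature form, and it vanishes on all pairs.\<close>

lemma curvature_form_constant: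
  assumes "curvature_form T" "\<And>i j. g i j = g j i"
    and sect: "\<And>v u. form4 T v u u v = \<kappa> * (form2 g v v * form2 g u u - (form2 g v u)\<^sup>2)"
  shows "T i j k m = \<kappa> * (g i m * g j k - g i k * g j m)"
proof -
  interpret curvature_form T by fact
  let ?D = "\<lambda>i j k m. T i j k m - \<kappa> * (g i m * g j k - g i k * g j m)"
  interpret D: curvature_form ?D
  proof
    fix i j k m
    show "?D i j k m = - ?D j i k m" using antisym12[of i j k m] by (simp add: algebra_simps)
    show "?D i j k m = - ?D i j m k" using antisym34[of i j k m] by (simp add: algebra_simps)
    show "?D i j k m + ?D j k i m + ?D k i j m = 0"
      using cyclic[of i j k m] assms(2)[of j i] assms(2)[of k i] assms(2)[of k j]
      by (simp add: algebra_simps)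
  qed
  have "form4 ?D x y y x = 0" for x y
    unfolding form4_diff form4_scale form4_prod_outer form4_prod_cross sect
    using form2_sym[of g y x] assms(2) by (simp add: power2_eq_square)
  from D.vanishes_if_sectional_vanishes[OF this] show ?thesis by (metis eq_iff_diff_eq_0)
qed

section \<open>The curvature form of a coordinate metric\<close>

context coord_metric
begin

definition Rl :: "real^'n \<Rightarrow> 'n \<Rightarrow> 'n \<Rightarrow> 'n \<Rightarrow> 'n \<Rightarrow> real" where
  "Rl x i j k m = (\<Sum>l\<in>UNIV. G x $ l $ m * R l i j k x)"

abbreviation gform :: "real^'n \<Rightarrow> real^'n \<Rightarrow> real^'n \<Rightarrow> real" where
  "gform x \<equiv> form2 (\<lambda>i j. G x $ i $ j)"

lemma curvature_form_Rl:
  assumes x: "x \<in> S"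
  shows "curvature_form (Rl x)"
proof
  fix i j k m
  show "Rl x i j k m = - Rl x j i k m"
    unfolding Rl_def by (subst riemann_antisym12) (simp add: sum_negf)
  have "(G x ** Rm i j x + transpose (G x ** Rm i j x)) $ m $ k = 0"
    unfolding lowered_Rm_antisym[OF x] by simp
  then show "Rl x i j k m = - Rl x i j m k"
    by (simp add: Rl_def matrix_matrix_mult_def transpose_def Rm_nth sym[OF x, of _ m]
        sym[OF x, of _ k])
  show "Rl x i j k m + Rl x j k i m + Rl x k i j m = 0"
    using bianchi1[OF x] by (simp add: Rl_def sum.distrib[symmetric] distrib_left[symmetric])
qed

lemma inner_form_gform:
  assumes x: "x \<in> S"
  shows "inner_form (gform x)"
proof
  show "bilinear (gform x)" by (rule bilinear_form2)
  show "gform x v w = gform x w v" for v w by (rule form2_sym) (rule sym[OF x])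
  show "gform x v v > 0" if "v \<noteq> 0" for v using pos[OF x that] by (simp add: form2_matrix)
qed

lemma curvature_inner_form: "x \<in> S \<Longrightarrow> curvature_inner_form (Rl x) (gform x)"
  by (simp add: curvature_inner_form_def curvature_form_Rl inner_form_gform)

lemma raise_Rl:
  assumes x: "x \<in> S"
  shows "(\<Sum>m\<in>UNIV. H x $ l $ m * Rl x i j k m) = R l i j k x"
proof -
  have "(\<Sum>m\<in>UNIV. H x $ l $ m * Rl x i j k m)
      = (\<Sum>a\<in>UNIV. (\<Sum>m\<in>UNIV. H x $ l $ m * G x $ m $ a) * R a i j k x)"
    unfolding Rl_def sum_distrib_left sum_distrib_right
    by (subst sum.swap) (simp add: sym[OF x] mult.assoc)
  then show ?thesis by (simp only: G_inv[OF x] sum_kronecker)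
qed

text \<open>The sectional curvatures at a point determine the whole curvature form, which is therefore the
  one of constant curvature; raising an index brings it into the shape to which the second Bianchi
  identity was applied.\<close>

lemma schur:
  assumes dim: "CARD('n) > 2"
    and sect: "\<And>y v u. y \<in> S \<Longrightarrow> inner_form.orthonormal (gform y) v u \<Longrightarrow> form4 (Rl y) v u u v = \<kappa> y"
    and x: "x \<in> S"
  shows "(\<kappa> has_derivative (\<lambda>h. 0)) (at x)"
proof (rule schur_coord[OF dim _ x])
  fix y i j assume y: "y \<in> S"
  interpret curvature_inner_form "Rl y" "gform y" by (rule curvature_inner_form[OF y])
  have "Rl y i j k m = \<kappa> y * (G y $ i $ m * G y $ j $ k - G y $ i $ k * G y $ j $ m)" for k m
    by (rule curvature_form_constant[OF curvature_form_Rl[OF y] coord_metric.sym[OF coord_metric_axioms y]])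
      (rule sectional_from_orthonormal[OF sect[OF y]])
  note * = this
  have "R l i j k y = \<kappa> y * (\<delta> l i * G y $ j $ k - \<delta> l j * G y $ i $ k)" for l k
  proof -
    have "R l i j k y = (\<Sum>m\<in>UNIV. \<kappa> y * G y $ j $ k * (H y $ l $ m * G y $ m $ i))
        - (\<Sum>m\<in>UNIV. \<kappa> y * G y $ i $ k * (H y $ l $ m * G y $ m $ j))"
      unfolding raise_Rl[OF y, symmetric] * sum_subtractf[symmetric]
      by (simp add: coord_metric.sym[OF coord_metric_axioms y, of _ i]
          coord_metric.sym[OF coord_metric_axioms y, of _ j] algebra_simps)
    then show ?thesis
      unfolding sum_distrib_left[symmetric] G_inv[OF y] by (simp add: algebra_simps)
  qed
  then show "Rm i j y = \<kappa> y *\<^sub>R const_curv_mat i j y"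
    by (simp add: vec_eq_iff Rm_nth const_curv_mat_def)
qed

end

section \<open>Conformal change of a coordinate metric\<close>

locale coord_conformal = coord_metric S G
  for S :: "(real^'n::finite) set" and G :: "real^'n \<Rightarrow> real^'n^'n" +
  fixes F :: "real^'n \<Rightarrow> real"
  assumes smooth_F: "smooth_on S F"
begin

abbreviation G' where "G' \<equiv> \<lambda>x. exp (- 2 * F x) *\<^sub>R G x"

abbreviation dF where "dF i x \<equiv> pd i F x"

definition gradF :: "'n \<Rightarrow> real^'n \<Rightarrow> real" where
  "gradF k x = (\<Sum>l\<in>UNIV. H x $ k $ l * dF l x)"

definition hess :: "'n \<Rightarrow> 'n \<Rightarrow> real^'n \<Rightarrow> real" where
  "hess i j x = pd i (pd j F) x - (\<Sum>a\<in>UNIV. \<Gamma> a i j x * dF a x)"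

text \<open>Component \<open>l\<close> of the covariant derivative of the gradient in direction \<open>i\<close>; lowering \<open>l\<close> turns it
  into the Hessian (\<open>lower_nabla_grad\<close>).\<close>

definition nabla_grad :: "'n \<Rightarrow> 'n \<Rightarrow> real^'n \<Rightarrow> real" where
  "nabla_grad i l x = pd i (gradF l) x + (\<Sum>a\<in>UNIV. \<Gamma> l i a x * gradF a x)"

definition norm_grad :: "real^'n \<Rightarrow> real" where
  "norm_grad x = (\<Sum>a\<in>UNIV. gradF a x * dF a x)"

sublocale conf: coord_metric S G'
proof
  show "smooth_on S (\<lambda>x. (exp (- 2 * F x) *\<^sub>R G x) $ i $ j)" for i j
    unfolding vector_scaleR_component real_scaleR_def
    by (intro smooth_on_mult smooth_on_exp smooth_on_const smooth_F smooth open_dom)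
  show "v \<bullet> (exp (- 2 * F x) *\<^sub>R G x *v v) > 0" if "x \<in> S" "v \<noteq> 0" for x v
    using pos[OF that] by (simp add: scaleR_matrix_vector_assoc[symmetric])
qed (auto simp: open_dom sym)

lemma smooth_gradF: "smooth_on S (gradF k)"
  unfolding gradF_def[abs_def]
  by (intro smooth_on_sum smooth_on_mult smooth_inv smooth_on_pd smooth_F open_dom)

lemma hess_sym: "x \<in> S \<Longrightarrow> hess i j x = hess j i x"
  by (simp add: hess_def pd_commute[OF open_dom smooth_F, of x i] \<Gamma>_sym[of x _ i])

lemma lower_gradF: "x \<in> S \<Longrightarrow> (\<Sum>a\<in>UNIV. G x $ m $ a * gradF a x) = dF m x"
proof -
  assume x: "x \<in> S"
  have "(\<Sum>a\<in>UNIV. G x $ m $ a * gradF a x)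
      = (\<Sum>l\<in>UNIV. (\<Sum>a\<in>UNIV. G x $ m $ a * H x $ a $ l) * dF l x)"
    unfolding gradF_def sum_distrib_left sum_distrib_right
    by (subst sum.swap) (simp add: mult.assoc)
  then show ?thesis by (simp only: G_inv[OF x] sum_kronecker)
qed

text \<open>This is the derivative of the identity \<open>lower_gradF\<close>.\<close>

lemma lower_pd_gradF:
  assumes x: "x \<in> S"
  shows "(\<Sum>a\<in>UNIV. G x $ m $ a * pd i (gradF a) x)
    = pd i (pd m F) x - (\<Sum>a\<in>UNIV. pd i (\<lambda>y. G y $ m $ a) x * gradF a x)"
proof -
  have d: "(\<lambda>y. G y $ m $ a) differentiable (at x)" "gradF a differentiable (at x)" for a
    using smooth_on_imp_differentiable[OF smooth x] smooth_on_imp_differentiable[OF smooth_gradF x] by blast+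
  have "pd i (pd m F) x = pd i (\<lambda>y. \<Sum>a\<in>UNIV. G y $ m $ a * gradF a y) x"
    by (rule pd_cong_open[OF open_dom x]) (simp add: lower_gradF)
  also have "\<dots> = (\<Sum>a\<in>UNIV. pd i (\<lambda>y. G y $ m $ a) x * gradF a x + G x $ m $ a * pd i (gradF a) x)"
    by (subst pd_sum) (auto intro!: differentiable_mult d simp: pd_mult[OF d])
  finally show ?thesis by (simp add: sum.distrib)
qed

lemma contract_\<Gamma>_dF:
  assumes x: "x \<in> S"
  shows "(\<Sum>a\<in>UNIV. \<Gamma> a i j x * dF a x)
    = (\<Sum>a\<in>UNIV. (\<Sum>b\<in>UNIV. G x $ a $ b * \<Gamma> b i j x) * gradF a x)"
proof -
  have "(\<Sum>a\<in>UNIV. \<Gamma> a i j x * dF a x)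
      = (\<Sum>b\<in>UNIV. \<Sum>a\<in>UNIV. \<Gamma> b i j x * (G x $ b $ a * gradF a x))"
    by (simp add: lower_gradF[OF x, symmetric] sum_distrib_left)
  then show ?thesis
    unfolding sum_distrib_right by (subst sum.swap) (simp add: sym[OF x] mult_ac)
qed

lemma lower_nabla_grad:
  assumes x: "x \<in> S"
  shows "(\<Sum>l\<in>UNIV. G x $ m $ l * nabla_grad i l x) = hess i m x"
proof -
  have 1: "(\<Sum>l\<in>UNIV. G x $ m $ l * (\<Sum>a\<in>UNIV. \<Gamma> l i a x * gradF a x))
      = (\<Sum>a\<in>UNIV. (\<Sum>l\<in>UNIV. G x $ m $ l * \<Gamma> l i a x) * gradF a x)"
    unfolding sum_distrib_left sum_distrib_right by (subst sum.swap) (simp add: mult.assoc)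
  show ?thesis
    unfolding nabla_grad_def distrib_left sum.distrib 1 lower_pd_gradF[OF x] hess_def
      contract_\<Gamma>_dF[OF x] pd_metric[OF x]
    by (simp add: sum.distrib distrib_right)
qed

text \<open>The Lie derivative of the metric along a gradient is twice the Hessian: lowering the index of the
  differentiated gradient produces derivatives of the metric, which assemble to a Christoffel symbol.\<close>

lemma lie_grad:
  assumes x: "x \<in> S"
  shows "(\<Sum>k\<in>UNIV. gradF k x * pd k (\<lambda>y. G y $ i $ j) x + G x $ k $ j * pd i (gradF k) x
      + G x $ i $ k * pd j (gradF k) x) = 2 * hess i j x"
proof -
  have s: "pd a (\<lambda>y. G y $ k $ l) x = pd a (\<lambda>y. G y $ l $ k) x" for a k l
    by (rule pd_cong_open[OF open_dom x]) (rule sym)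
  have 1: "(\<Sum>k\<in>UNIV. G x $ k $ j * pd i (gradF k) x)
    = pd i (pd j F) x - (\<Sum>a\<in>UNIV. pd i (\<lambda>y. G y $ j $ a) x * gradF a x)"
    using lower_pd_gradF[OF x, of j i] by (simp add: sym[OF x, of _ j])
  have 2: "2 * (\<Sum>a\<in>UNIV. \<Gamma> a i j x * dF a x) = (\<Sum>a\<in>UNIV. pd i (\<lambda>y. G y $ j $ a) x * gradF a x)
     + (\<Sum>a\<in>UNIV. pd j (\<lambda>y. G y $ i $ a) x * gradF a x) - (\<Sum>a\<in>UNIV. gradF a x * pd a (\<lambda>y. G y $ i $ j) x)"
    unfolding contract_\<Gamma>_dF[OF x] lower_\<Gamma>[OF x] sum_distrib_left sum.distrib[symmetric]
      sum_subtractf[symmetric]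
    by (rule sum.cong[OF refl]) (simp add: algebra_simps)
  show ?thesis
    unfolding sum.distrib 1 lower_pd_gradF[OF x] hess_def right_diff_distrib 2
    by (simp add: pd_commute[OF open_dom smooth_F x, of i j])
qed

lemma inv_G': "x \<in> S \<Longrightarrow> matrix_inv (G' x) = exp (2 * F x) *\<^sub>R H x"
proof -
  assume x: "x \<in> S"
  let ?B = "exp (2 * F x) *\<^sub>R H x"
  have "G' x ** ?B = mat 1"
    by (simp add: matrix_scalar_ac scalar_matrix_assoc[symmetric] matrix_inv_cancel[OF invertible_G[OF x]]
        exp_minus)
  then have "matrix_inv (G' x) ** (G' x ** ?B) = matrix_inv (G' x)" by simp
  then show ?thesis
    by (simp only: matrix_mul_assoc matrix_inv_cancel[OF conf.invertible_G[OF x]] matrix_mul_lid)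
qed

lemma pd_G':
  assumes x: "x \<in> S"
  shows "pd a (\<lambda>y. G' y $ i $ j) x
    = exp (- 2 * F x) * (pd a (\<lambda>y. G y $ i $ j) x - 2 * dF a x * G x $ i $ j)"
proof -
  have F: "F differentiable (at x)" by (rule smooth_on_imp_differentiable[OF smooth_F x])
  have F2: "(\<lambda>y. - 2 * F y) differentiable (at x)" "pd a (\<lambda>y. - 2 * F y) x = - 2 * dF a x"
    using F pd_cmult[OF F, where c="- 2"] by (auto intro: differentiable_mult)
  have G: "(\<lambda>y. G y $ i $ j) differentiable (at x)" by (rule smooth_on_imp_differentiable[OF smooth x])
  note e = pd_real_comp[where h=exp, OF F2(1) DERIV_exp]
  have "pd a (\<lambda>y. exp (- 2 * F y) * G y $ i $ j) x
    = exp (- 2 * F x) * (- 2 * dF a x) * G x $ i $ j + exp (- 2 * F x) * pd a (\<lambda>y. G y $ i $ j) x"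
    unfolding pd_mult[OF e(2) G] e(1) F2(2) by (rule refl)
  then show ?thesis by (simp add: algebra_simps)
qed

text \<open>The difference of the Levi-Civita connections of \<open>G'\<close> and \<open>G\<close>.\<close>

definition Sc :: "'n \<Rightarrow> 'n \<Rightarrow> 'n \<Rightarrow> real^'n \<Rightarrow> real" where
  "Sc l i k x = G x $ i $ k * gradF l x - \<delta> l i * dF k x - \<delta> l k * dF i x"

lemma \<Gamma>_conf:
  assumes x: "x \<in> S"
  shows "conf.\<Gamma> k i j x = \<Gamma> k i j x + Sc k i j x"
proof -
  let ?c = "\<lambda>l. pd i (\<lambda>y. G y $ j $ l) x + pd j (\<lambda>y. G y $ i $ l) x - pd l (\<lambda>y. G y $ i $ j) x"
  have e: "exp (2 * F x) * exp (- 2 * F x) = 1" by (simp add: exp_minus)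
  have "(exp (2 * F x) *\<^sub>R H x) $ k $ l * (pd i (\<lambda>y. G' y $ j $ l) x + pd j (\<lambda>y. G' y $ i $ l) x
        - pd l (\<lambda>y. G' y $ i $ j) x)
      = H x $ k $ l * ?c l + 2 * (G x $ i $ j * (H x $ k $ l * dF l x)
        - (H x $ k $ l * G x $ l $ j) * dF i x - (H x $ k $ l * G x $ l $ i) * dF j x)" for l
  proof -
    have "(exp (2 * F x) *\<^sub>R H x) $ k $ l * (pd i (\<lambda>y. G' y $ j $ l) x + pd j (\<lambda>y. G' y $ i $ l) x
        - pd l (\<lambda>y. G' y $ i $ j) x)
      = (exp (2 * F x) * exp (- 2 * F x)) * H x $ k $ l * (?c l - 2 * (dF i x * G x $ j $ l
        + dF j x * G x $ i $ l - dF l x * G x $ i $ j))"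
      unfolding pd_G'[OF x] by (simp add: algebra_simps)
    then show ?thesis
      unfolding e by (simp add: sym[OF x, of l] algebra_simps)
  qed
  then have "conf.\<Gamma> k i j x = (1/2) * (\<Sum>l\<in>UNIV. H x $ k $ l * ?c l + 2 * (G x $ i $ j * (H x $ k $ l * dF l x)
        - (H x $ k $ l * G x $ l $ j) * dF i x - (H x $ k $ l * G x $ l $ i) * dF j x))"
    unfolding coord_christoffel_def[of G'] inv_G'[OF x] by simp
  also have "\<dots> = \<Gamma> k i j x + (G x $ i $ j * gradF k x
      - (\<Sum>l\<in>UNIV. H x $ k $ l * G x $ l $ j) * dF i x - (\<Sum>l\<in>UNIV. H x $ k $ l * G x $ l $ i) * dF j x)"
    unfolding gradF_def coord_christoffel_def sum_distrib_left sum_distrib_right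
      sum.distrib[symmetric] sum_subtractf[symmetric]
    by (rule sum.cong[OF refl]) (simp add: algebra_simps)
  finally show ?thesis
    by (simp only: G_inv[OF x] Sc_def mult_1_left)
qed

lemma contract_Sc:
  "(\<Sum>m\<in>UNIV. h m * Sc l i m x)
    = gradF l x * (\<Sum>m\<in>UNIV. G x $ i $ m * h m) - \<delta> l i * (\<Sum>m\<in>UNIV. h m * dF m x) - h l * dF i x"
  "(\<Sum>m\<in>UNIV. Sc m j k x * h m)
    = G x $ j $ k * (\<Sum>m\<in>UNIV. gradF m x * h m) - h j * dF k x - h k * dF j x"
proof -
  have "(\<Sum>m\<in>UNIV. h m * Sc l i m x) = (\<Sum>m\<in>UNIV. gradF l x * (G x $ i $ m * h m)
      - \<delta> l i * (h m * dF m x) - (h m * dF i x) * \<delta> l m)"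
    unfolding Sc_def by (rule sum.cong[OF refl]) (simp add: algebra_simps)
  then show "(\<Sum>m\<in>UNIV. h m * Sc l i m x)
    = gradF l x * (\<Sum>m\<in>UNIV. G x $ i $ m * h m) - \<delta> l i * (\<Sum>m\<in>UNIV. h m * dF m x) - h l * dF i x"
    by (simp only: sum_subtractf sum_kronecker sum_distrib_left)
  have "(\<Sum>m\<in>UNIV. Sc m j k x * h m) = (\<Sum>m\<in>UNIV. G x $ j $ k * (gradF m x * h m)
      - (h m * dF k x) * \<delta> m j - (h m * dF j x) * \<delta> m k)"
    unfolding Sc_def by (rule sum.cong[OF refl]) (simp add: algebra_simps)
  then show "(\<Sum>m\<in>UNIV. Sc m j k x * h m)
    = G x $ j $ k * (\<Sum>m\<in>UNIV. gradF m x * h m) - h j * dF k x - h k * dF j x"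
    by (simp only: sum_subtractf sum_kronecker sum_distrib_left)
qed

lemma pd_Sc:
  assumes x: "x \<in> S"
  shows "Sc l j k differentiable (at x)"
    and "pd i (Sc l j k) x = pd i (\<lambda>y. G y $ j $ k) x * gradF l x + G x $ j $ k * pd i (gradF l) x
      - \<delta> l j * pd i (pd k F) x - \<delta> l k * pd i (pd j F) x"
proof -
  have d: "(\<lambda>y. G y $ j $ k) differentiable (at x)" "gradF l differentiable (at x)"
    "\<And>a. pd a F differentiable (at x)"
    using smooth_on_imp_differentiable[OF smooth x] smooth_on_imp_differentiable[OF smooth_gradF x]
      smooth_on_imp_differentiable[OF smooth_on_pd[OF smooth_F] x] by blast+
  note d1 = differentiable_mult[OF d(1,2)]
  note d2 = differentiable_mult[OF differentiable_const d(3)]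
  note d3 = differentiable_diff[OF d1 d2]
  show "Sc l j k differentiable (at x)"
    unfolding Sc_def[abs_def] by (rule differentiable_diff[OF d3 d2])
  show "pd i (Sc l j k) x = pd i (\<lambda>y. G y $ j $ k) x * gradF l x + G x $ j $ k * pd i (gradF l) x
      - \<delta> l j * pd i (pd k F) x - \<delta> l k * pd i (pd j F) x"
    unfolding Sc_def[abs_def] pd_diff[OF d3 d2] pd_diff[OF d1 d2] pd_mult[OF d(1,2)] pd_cmult[OF d(3)]
    by (rule refl)
qed

text \<open>The form \<open>Hess F + dF \<otimes> dF\<close>, which is the weight in the second kind of weighted curvature.\<close>

definition Hf :: "real^'n \<Rightarrow> 'n \<Rightarrow> 'n \<Rightarrow> real" where
  "Hf x i j = hess i j x + dF i x * dF j x"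

text \<open>The curvature of the connection \<open>\<Gamma> + Sc\<close> is that of \<open>\<Gamma>\<close>, plus the covariant derivative of \<open>Sc\<close>,
  which contributes the Hessian terms, plus the commutators of \<open>Sc\<close> with itself, which contribute the
  terms quadratic in \<open>dF\<close>. Terms symmetric in \<open>i\<close> and \<open>j\<close> cancel.\<close>

lemma riemann_conf:
  assumes x: "x \<in> S"
  shows "conf.R l i j k x = R l i j k x + \<delta> l i * Hf x j k - \<delta> l j * Hf x i k
    + G x $ j $ k * (nabla_grad i l x + dF i x * gradF l x)
    - G x $ i $ k * (nabla_grad j l x + dF j x * gradF l x)
    - norm_grad x * (\<delta> l i * G x $ j $ k - \<delta> l j * G x $ i $ k)"
proof -
  define E where "E k i j = (\<Sum>a\<in>UNIV. G x $ k $ a * \<Gamma> a i j x)" for k i j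
  have E_sym: "E k i j = E k j i" for k i j
    by (simp add: E_def \<Gamma>_sym[OF x])
  define N where "N i l = (\<Sum>m\<in>UNIV. gradF m x * \<Gamma> l i m x)" for i l
  define C where "C j k = (\<Sum>m\<in>UNIV. \<Gamma> m j k x * dF m x)" for j k
  define P where "P i j = (\<Sum>m\<in>UNIV. \<Gamma> m j k x * \<Gamma> l i m x)" for i j
  have pd\<Gamma>: "pd i (conf.\<Gamma> l j k) x = pd i (\<Gamma> l j k) x + pd i (Sc l j k) x" for i j
  proof -
    have "pd i (conf.\<Gamma> l j k) x = pd i (\<lambda>y. \<Gamma> l j k y + Sc l j k y) x"
      by (rule pd_cong_open[OF open_dom x \<Gamma>_conf])
    then show ?thesis
      by (simp add: pd_add[OF smooth_on_imp_differentiable[OF smooth_\<Gamma> x] pd_Sc(1)[OF x]])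
  qed
  have dG: "pd i (\<lambda>y. G y $ j $ k) x = E j i k + E k i j" for i j
    by (simp add: pd_metric[OF x] E_def)
  have prod: "(\<Sum>m\<in>UNIV. conf.\<Gamma> m j k x * conf.\<Gamma> l i m x) = P i j
     + (gradF l x * E i j k - \<delta> l i * C j k - \<Gamma> l j k x * dF i x)
     + (G x $ j $ k * N i l - \<Gamma> l i j x * dF k x - \<Gamma> l i k x * dF j x)
     + (G x $ j $ k * (- \<delta> l i * norm_grad x) - Sc l i j x * dF k x - Sc l i k x * dF j x)" for i j
  proof -
    have "(\<Sum>m\<in>UNIV. gradF m x * Sc l i m x) = - \<delta> l i * norm_grad x"
      unfolding contract_Sc(1) lower_gradF[OF x] norm_grad_def[symmetric] by simp
    then show ?thesis
      unfolding \<Gamma>_conf[OF x] distrib_left distrib_right sum.distrib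
        contract_Sc(2)[of j k x "\<lambda>m. Sc l i m x"]
        contract_Sc(2)[of j k x "\<lambda>m. \<Gamma> l i m x"] contract_Sc(1)[of "\<lambda>m. \<Gamma> m j k x"]
        E_def[symmetric] N_def[symmetric] C_def[symmetric] P_def[symmetric]
      by simp
  qed
  have nab: "nabla_grad i l x = pd i (gradF l) x + N i l" for i
    by (simp add: nabla_grad_def N_def mult.commute)
  have Hf: "Hf x j k = pd j (pd k F) x - C j k + dF j x * dF k x" for j k
    by (simp add: Hf_def hess_def C_def)
  have Sc_sum: "- (Sc l i j x * dF k x) - Sc l i k x * dF j x + Sc l j i x * dF k x + Sc l j k x * dF i x
      = G x $ j $ k * dF i x * gradF l x - G x $ i $ k * dF j x * gradF l x
        + \<delta> l i * dF j x * dF k x - \<delta> l j * dF i x * dF k x"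
    unfolding Sc_def using sym[OF x, of j i] by (simp only: algebra_simps)
  have "conf.R l i j k x - R l i j k x = (pd i (Sc l j k) x - pd j (Sc l i k) x)
    + ((\<Sum>m\<in>UNIV. conf.\<Gamma> m j k x * conf.\<Gamma> l i m x) - P i j)
    - ((\<Sum>m\<in>UNIV. conf.\<Gamma> m i k x * conf.\<Gamma> l j m x) - P j i)"
    unfolding coord_riemann_def sum_subtractf pd\<Gamma> P_def by simp
  also have "\<dots> = \<delta> l i * Hf x j k - \<delta> l j * Hf x i k
    + G x $ j $ k * (nabla_grad i l x + dF i x * gradF l x)
    - G x $ i $ k * (nabla_grad j l x + dF j x * gradF l x)
    - norm_grad x * (\<delta> l i * G x $ j $ k - \<delta> l j * G x $ i $ k)"
    unfolding prod pd_Sc(2)[OF x] dG nab Hf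
    using Sc_sum pd_commute[OF open_dom smooth_F x, of i j] E_sym[of k i j] E_sym[of _ k]
      \<Gamma>_sym[OF x, of l i j]
    by (simp only: algebra_simps)
  finally show ?thesis by simp
qed

lemma Rl_conf:
  assumes x: "x \<in> S"
  shows "conf.Rl x i j k m = exp (- 2 * F x) * (Rl x i j k m
    + G x $ i $ m * Hf x j k - G x $ j $ m * Hf x i k + Hf x i m * G x $ j $ k - Hf x j m * G x $ i $ k
    - norm_grad x * (G x $ i $ m * G x $ j $ k - G x $ i $ k * G x $ j $ m))"
proof -
  have up: "(\<Sum>l\<in>UNIV. G x $ l $ m * (nabla_grad i l x + dF i x * gradF l x)) = Hf x i m" for i
  proof -
    have "(\<Sum>l\<in>UNIV. G x $ l $ m * (nabla_grad i l x + dF i x * gradF l x))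
        = (\<Sum>l\<in>UNIV. G x $ m $ l * nabla_grad i l x) + dF i x * (\<Sum>l\<in>UNIV. G x $ m $ l * gradF l x)"
      unfolding sum_distrib_left sum.distrib[symmetric]
      by (rule sum.cong[OF refl]) (simp add: sym[OF x, of _ m] algebra_simps)
    then show ?thesis
      by (simp add: lower_nabla_grad[OF x] lower_gradF[OF x] Hf_def)
  qed
  have "conf.Rl x i j k m = exp (- 2 * F x) * (\<Sum>l\<in>UNIV. G x $ l $ m * conf.R l i j k x)"
    unfolding conf.Rl_def sum_distrib_left by (rule sum.cong[OF refl]) simp
  also have "(\<Sum>l\<in>UNIV. G x $ l $ m * conf.R l i j k x)
    = (\<Sum>l\<in>UNIV. G x $ l $ m * R l i j k x
      + (G x $ l $ m * \<delta> l i) * Hf x j k - (G x $ l $ m * \<delta> l j) * Hf x i k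
      + G x $ j $ k * (G x $ l $ m * (nabla_grad i l x + dF i x * gradF l x))
      - G x $ i $ k * (G x $ l $ m * (nabla_grad j l x + dF j x * gradF l x))
      - norm_grad x * G x $ j $ k * (G x $ l $ m * \<delta> l i)
      + norm_grad x * G x $ i $ k * (G x $ l $ m * \<delta> l j))"
    unfolding riemann_conf[OF x] by (rule sum.cong[OF refl]) (simp only: algebra_simps)
  also have "\<dots> = Rl x i j k m
    + G x $ i $ m * Hf x j k - G x $ j $ m * Hf x i k + Hf x i m * G x $ j $ k - Hf x j m * G x $ i $ k
    - norm_grad x * (G x $ i $ m * G x $ j $ k - G x $ i $ k * G x $ j $ m)"
    unfolding sum.distrib sum_subtractf sum_distrib_left[symmetric] sum_distrib_right[symmetric]
      sum_kronecker up Rl_def[symmetric]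
    by (simp add: algebra_simps)
  finally show ?thesis .
qed

text \<open>On an orthonormal pair the mixed terms of the conformally changed curvature vanish.\<close>

lemma sectional_conf:
  assumes x: "x \<in> S" and vu: "gform x v v = 1" "gform x u u = 1" "gform x v u = 0"
  shows "form4 (conf.Rl x) v u u v = exp (- 2 * F x) *
    (form4 (Rl x) v u u v + form2 (Hf x) v v + form2 (Hf x) u u - norm_grad x)"
proof -
  have "gform x u v = 0" using vu(3) inner_form.sym[OF inner_form_gform[OF x], of u v] by simp
  moreover have "conf.Rl x = (\<lambda>i j k m. exp (- 2 * F x) * (Rl x i j k m
    + G x $ i $ m * Hf x j k - Hf x i k * G x $ j $ m + Hf x i m * G x $ j $ k - G x $ i $ k * Hf x j m
    - norm_grad x * (G x $ i $ m * G x $ j $ k - G x $ i $ k * G x $ j $ m)))"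
    unfolding Rl_conf[OF x] by (intro ext) (simp only: mult.commute)
  ultimately show ?thesis
    using vu by (simp only: form4_scale form4_add form4_diff form4_prod_outer form4_prod_cross) simp
qed

end

section \<open>Charts and tangent spaces\<close>

locale manifold =
  fixes M :: "'a topology" and A :: "('a, 'n::finite) chart set"
  assumes manifold: "smooth_manifold M A"
begin

abbreviation dom :: "('a, 'n) chart \<Rightarrow> (real^'n) set" where
  "dom c \<equiv> snd c ` fst c"

definition overlap :: "('a, 'n) chart \<Rightarrow> ('a, 'n) chart \<Rightarrow> (real^'n) set" where
  "overlap c d = snd c ` (fst c \<inter> fst d)"

lemma atlas: "smooth_atlas M A" and chart: "c \<in> A \<Longrightarrow> chart_on M c"
  using manifold by (auto simp: smooth_manifold_def smooth_atlas_def)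

lemma open_chart: "c \<in> A \<Longrightarrow> openin M (fst c)" and open_dom: "c \<in> A \<Longrightarrow> open (dom c)"
  and homeo: "c \<in> A \<Longrightarrow> homeomorphic_map (subtopology M (fst c)) (top_of_set (dom c)) (snd c)"
  using chart by (auto simp: chart_on_def)

lemma topspace_chart: "c \<in> A \<Longrightarrow> topspace (subtopology M (fst c)) = fst c"
  by (simp add: inf_absorb2 openin_subset[OF open_chart])

lemma inj_chart: "c \<in> A \<Longrightarrow> inj_on (snd c) (fst c)"
  by (metis homeomorphic_imp_injective_map homeo topspace_chart)

lemma charts_at_iff: "c \<in> charts_at A p \<longleftrightarrow> c \<in> A \<and> p \<in> fst c"
  by (simp add: charts_at_def)

lemma ex_chart_at: "p \<in> topspace M \<Longrightarrow> \<exists>c. c \<in> charts_at A p"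
  using atlas by (auto simp: smooth_atlas_def charts_at_iff simp del: split_paired_Ex)

lemma chart_at_topspace: "c \<in> charts_at A p \<Longrightarrow> p \<in> topspace M"
  by (metis charts_at_iff open_chart openin_subset subsetD)

lemma chart_inv_chart: "c \<in> A \<Longrightarrow> p \<in> fst c \<Longrightarrow> chart_inv c (snd c p) = p"
  by (simp add: chart_inv_def inv_into_f_f inj_chart)

lemma chart_inv_at: "c \<in> charts_at A p \<Longrightarrow> chart_inv c (snd c p) = p"
  by (simp add: charts_at_iff chart_inv_chart)

lemma snd_in_dom: "c \<in> charts_at A p \<Longrightarrow> snd c p \<in> dom c"
  by (simp add: charts_at_iff)

lemma snd_in_overlap: "c \<in> charts_at A p \<Longrightarrow> d \<in> charts_at A p \<Longrightarrow> snd c p \<in> overlap c d"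
  by (simp add: charts_at_iff overlap_def)

lemma overlap_obtain:
  assumes "c \<in> A" "d \<in> A" "x \<in> overlap c d"
  obtains p where "c \<in> charts_at A p" "d \<in> charts_at A p" "x = snd c p" "chart_inv c x = p"
    "transition c d x = snd d p"
  using assms by (auto simp: overlap_def charts_at_iff chart_inv_chart transition_def)

lemma dom_obtain:
  assumes "c \<in> A" "x \<in> dom c"
  obtains p where "c \<in> charts_at A p" "x = snd c p" "chart_inv c x = p"
  using assms by (auto simp: charts_at_iff chart_inv_chart)

lemma transition_at: "c \<in> charts_at A p \<Longrightarrow> transition c d (snd c p) = snd d p"
  by (simp add: transition_def chart_inv_at)

lemma open_image_chart:
  assumes c: "c \<in> A" and U: "openin M U" "U \<subseteq> fst c"
  shows "open (snd c ` U)"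
proof -
  have "openin (subtopology M (fst c)) U"
    using U by (auto simp: openin_subtopology)
  then have "openin (top_of_set (dom c)) (snd c ` U)"
    using homeomorphic_imp_open_map[OF homeo[OF c]] by (auto simp: open_map_def)
  then show ?thesis
    using open_dom[OF c] openin_open_trans by blast
qed

lemma open_overlap: "c \<in> A \<Longrightarrow> d \<in> A \<Longrightarrow> open (overlap c d)"
  unfolding overlap_def by (rule open_image_chart) (auto simp: open_chart)

lemma smooth_transition: "c \<in> A \<Longrightarrow> d \<in> A \<Longrightarrow> smooth_on (overlap c d) (\<lambda>x. transition c d x $ i)"
  using atlas by (auto simp: smooth_atlas_def overlap_def)

definition jac :: "('a, 'n) chart \<Rightarrow> ('a, 'n) chart \<Rightarrow> 'a \<Rightarrow> real^'n \<Rightarrow> real^'n" where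
  "jac c d p = frechet_derivative (transition c d) (at (snd c p))"

lemma transition_has_derivative:
  assumes "c \<in> charts_at A p" "d \<in> charts_at A p"
  shows "(transition c d has_derivative jac c d p) (at (snd c p))"
proof -
  have "(\<lambda>x. transition c d x $ i) differentiable (at (snd c p))" for i
    using assms smooth_on_imp_differentiable[OF smooth_transition snd_in_overlap[OF assms]]
    by (auto simp: charts_at_iff)
  then have "transition c d differentiable (at (snd c p))"
    by (subst differentiable_componentwise_within) (auto simp: Basis_vec_def inner_axis)
  then show ?thesis
    unfolding jac_def by (simp add: frechet_derivative_works)
qed

lemma linear_jac: "c \<in> charts_at A p \<Longrightarrow> d \<in> charts_at A p \<Longrightarrow> linear (jac c d p)"
  using transition_has_derivative has_derivative_linear by blast

lemma jac_nth:
  assumes "c \<in> charts_at A p" "d \<in> charts_at A p"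
  shows "jac c d p v $ a = (\<Sum>i\<in>UNIV. pd i (\<lambda>x. transition c d x $ a) (snd c p) * v $ i)"
proof -
  have *: "((\<lambda>x. transition c d x $ a) has_derivative (\<lambda>v. jac c d p v $ a)) (at (snd c p))"
    using bounded_linear.has_derivative[OF bounded_linear_vec_nth transition_has_derivative[OF assms]] .
  then have "jac c d p v $ a = frechet_derivative (\<lambda>x. transition c d x $ a) (at (snd c p)) v"
    using frechet_derivative_at by metis
  also have "\<dots> = (\<Sum>i\<in>UNIV. v $ i * pd i (\<lambda>x. transition c d x $ a) (snd c p))"
    by (rule frechet_derivative_eq_sum_pd) (use * in \<open>auto simp: differentiable_def\<close>)
  finally show ?thesis by (simp add: mult.commute)
qed

lemma jac_self:
  assumes "c \<in> charts_at A p"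
  shows "jac c c p v = v"
proof -
  have c: "c \<in> A" using assms by (simp add: charts_at_iff)
  have "(transition c c has_derivative id) (at (snd c p))"
  proof (rule has_derivative_transform_within_open)
    show "(id has_derivative id) (at (snd c p))" by (simp add: id_def has_derivative_ident)
    show "open (dom c)" "snd c p \<in> dom c" using open_dom[OF c] snd_in_dom[OF assms] by auto
    show "id x = transition c c x" if "x \<in> dom c" for x
      using that c by (auto simp: transition_def chart_inv_chart)
  qed
  then show ?thesis
    unfolding jac_def using frechet_derivative_at by (metis id_apply)
qed

lemma jac_comp:
  assumes c: "c \<in> charts_at A p" and d: "d \<in> charts_at A p" and e: "e \<in> charts_at A p"
  shows "jac d e p (jac c d p v) = jac c e p v"
proof -
  have A: "c \<in> A" "d \<in> A" "e \<in> A" using assms by (auto simp: charts_at_iff)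
  let ?W = "snd c ` (fst c \<inter> fst d \<inter> fst e)"
  have "(transition d e \<circ> transition c d has_derivative jac d e p \<circ> jac c d p) (at (snd c p))"
    using diff_chain_at[OF transition_has_derivative[OF c d], of "transition d e"]
      transition_has_derivative[OF d e] by (simp add: transition_at[OF c])
  then have "(transition c e has_derivative jac d e p \<circ> jac c d p) (at (snd c p))"
  proof (rule has_derivative_transform_within_open)
    show "open ?W" by (rule open_image_chart[OF A(1)]) (auto intro!: openin_Int open_chart A)
    show "snd c p \<in> ?W" using assms by (auto simp: charts_at_iff)
    show "(transition d e \<circ> transition c d) x = transition c e x" if "x \<in> ?W" for x
      using that A by (auto simp: transition_def chart_inv_chart)
  qed
  then have "jac c e p = jac d e p \<circ> jac c d p"
    unfolding jac_def[of c e] using frechet_derivative_at by metis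
  then show ?thesis by simp
qed

text \<open>Inverse of the evaluation of tangent vectors at the chart \<open>c\<close>; it identifies the tangent space
  with the coordinate space, so that statements about all orthonormal pairs become statements about
  coordinate vectors.\<close>

definition lift :: "('a, 'n) chart \<Rightarrow> 'a \<Rightarrow> real^'n \<Rightarrow> ('a, 'n) tvec" where
  "lift c p v = (\<lambda>d. if d \<in> charts_at A p then jac c d p v else 0)"

lemma coord_vec_eq_lift: "coord_vec A c p i = lift c p (axis i 1)"
  by (simp add: coord_vec_def lift_def jac_def fun_eq_iff)

lemma lift_tangent: "c \<in> charts_at A p \<Longrightarrow> lift c p v \<in> tangent_space A p"
  by (auto simp: tangent_space_def lift_def jac_def[symmetric] jac_comp)

lemma lift_self: "c \<in> charts_at A p \<Longrightarrow> lift c p v c = v"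
  by (simp add: lift_def jac_self)

lemma tangentD:
  "V \<in> tangent_space A p \<Longrightarrow> c \<in> charts_at A p \<Longrightarrow> d \<in> charts_at A p \<Longrightarrow> V d = jac c d p (V c)"
  unfolding tangent_space_def jac_def by blast

lemma tangent_off_charts: "V \<in> tangent_space A p \<Longrightarrow> d \<notin> charts_at A p \<Longrightarrow> V d = 0"
  unfolding tangent_space_def by blast

lemma lift_of_tangent:
  assumes "V \<in> tangent_space A p" "c \<in> charts_at A p"
  shows "lift c p (V c) = V"
proof
  show "lift c p (V c) d = V d" for d
    using tangentD[OF assms, of d] tangent_off_charts[OF assms(1), of d] by (simp add: lift_def)
qed

lemma lift_linear_combination:
  assumes "c \<in> charts_at A p"
  shows "lift c p (a *\<^sub>R v + b *\<^sub>R w) = (\<lambda>d. a *\<^sub>R lift c p v d + b *\<^sub>R lift c p w d)"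
  using linear_jac[OF assms] by (auto simp: fun_eq_iff lift_def linear_add linear_scale)

end

section \<open>Riemannian manifolds\<close>

locale riemannian_manifold = manifold M A
  for M :: "'a topology" and A :: "('a, 'n::finite) chart set" +
  fixes g :: "('a, 'n) metric"
  assumes metric: "riemannian_metric M A g"
begin

abbreviation Gc :: "('a, 'n) chart \<Rightarrow> real^'n \<Rightarrow> real^'n^'n" where
  "Gc c \<equiv> metric_matrix A c g"

abbreviation gc :: "('a, 'n) chart \<Rightarrow> 'a \<Rightarrow> real^'n \<Rightarrow> real^'n \<Rightarrow> real" where
  "gc c p \<equiv> form2 (\<lambda>i j. Gc c (snd c p) $ i $ j)"

lemma g_sym:
  "p \<in> topspace M \<Longrightarrow> V \<in> tangent_space A p \<Longrightarrow> W \<in> tangent_space A p \<Longrightarrow> g p V W = g p W V"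
  using metric by (auto simp: riemannian_metric_def)

lemma g_linear:
  "p \<in> topspace M \<Longrightarrow> V \<in> tangent_space A p \<Longrightarrow> W \<in> tangent_space A p \<Longrightarrow> Z \<in> tangent_space A p
    \<Longrightarrow> g p (\<lambda>c. a *\<^sub>R V c + b *\<^sub>R W c) Z = a * g p V Z + b * g p W Z"
  using metric unfolding riemannian_metric_def by blast

lemma g_pos:
  "p \<in> topspace M \<Longrightarrow> V \<in> tangent_space A p \<Longrightarrow> V \<noteq> (\<lambda>c. 0) \<Longrightarrow> g p V V > 0"
  using metric unfolding riemannian_metric_def by blast

lemma bilinear_g_lift:
  assumes c: "c \<in> charts_at A p"
  shows "bilinear (\<lambda>v w. g p (lift c p v) (lift c p w))"
proof -
  note p = chart_at_topspace[OF c]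
  note t = lift_tangent[OF c]
  have l: "g p (lift c p (a *\<^sub>R v + b *\<^sub>R v')) (lift c p w)
      = a * g p (lift c p v) (lift c p w) + b * g p (lift c p v') (lift c p w)" for a b v v' w
    unfolding lift_linear_combination[OF c] by (rule g_linear[OF p t t t])
  have lin: "linear (\<lambda>v. g p (lift c p v) (lift c p w))" for w
    using l[of 1 _ 1 _ w] l[of _ _ 0 0 w] by (intro linearI) simp_all
  then have "linear (\<lambda>w. g p (lift c p v) (lift c p w))" for v
    using g_sym[OF p t t, of v] by simp
  with lin show ?thesis by (simp add: bilinear_def)
qed

lemma metric_matrix_at:
  "c \<in> charts_at A p \<Longrightarrow> Gc c (snd c p) $ i $ j = g p (lift c p (axis i 1)) (lift c p (axis j 1))"
  by (simp add: metric_matrix_def coord_vec_eq_lift chart_inv_at)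

lemma g_lift:
  assumes c: "c \<in> charts_at A p"
  shows "g p (lift c p v) (lift c p w) = gc c p v w"
proof -
  let ?b = "\<lambda>v w. g p (lift c p v) (lift c p w)"
  have lin: "linear (?b v)" "linear (\<lambda>v. ?b v w)" for v w
    using bilinear_g_lift[OF c] by (simp_all add: bilinear_def)
  have expand: "u = (\<Sum>i\<in>UNIV. u $ i *\<^sub>R axis i 1)" for u :: "real^'n"
    using basis_expansion[of u] by (simp add: scalar_mult_eq_scaleR)
  have "?b v w = (\<Sum>i\<in>UNIV. v $ i * ?b (axis i 1) w)"
    by (subst expand[of v]) (simp add: linear_sum[OF lin(2)] linear_scale[OF lin(2)])
  also have "\<dots> = (\<Sum>i\<in>UNIV. v $ i * (\<Sum>j\<in>UNIV. w $ j * ?b (axis i 1) (axis j 1)))"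
    by (subst expand[of w]) (simp add: linear_sum[OF lin(1)] linear_scale[OF lin(1)])
  finally show ?thesis
    by (simp add: form2_def metric_matrix_at[OF c] sum_distrib_left mult_ac)
qed

lemma g_eq:
  assumes "c \<in> charts_at A p" "V \<in> tangent_space A p" "W \<in> tangent_space A p"
  shows "g p V W = gc c p (V c) (W c)"
  using g_lift[OF assms(1), of "V c" "W c"] assms by (simp add: lift_of_tangent)

lemma coord_metric_Gc:
  assumes c: "c \<in> A"
  shows "coord_metric (dom c) (Gc c)"
proof
  show "open (dom c)" by (rule open_dom[OF c])
  show "smooth_on (dom c) (\<lambda>x. Gc c x $ i $ j)" for i j
    using metric c by (auto simp: riemannian_metric_def)
  fix x assume x: "x \<in> dom c"
  obtain p where p: "c \<in> charts_at A p" "x = snd c p" using dom_obtain[OF c x] .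
  show "Gc c x $ i $ j = Gc c x $ j $ i" for i j
    using metric_matrix_at[OF p(1)] g_sym[OF chart_at_topspace[OF p(1)] lift_tangent[OF p(1)] lift_tangent[OF p(1)]]
    by (simp add: p(2))
  show "v \<bullet> (Gc c x *v v) > 0" if "v \<noteq> 0" for v
  proof -
    have "lift c p v \<noteq> (\<lambda>c. 0)" using lift_self[OF p(1), of v] that by auto
    then have "g p (lift c p v) (lift c p v) > 0"
      by (rule g_pos[OF chart_at_topspace[OF p(1)] lift_tangent[OF p(1)]])
    then show ?thesis by (simp add: g_lift[OF p(1)] form2_matrix p(2))
  qed
qed

lemma coord_metric_at: "c \<in> charts_at A p \<Longrightarrow> coord_metric (dom c) (Gc c)"
  by (simp add: charts_at_iff coord_metric_Gc)

lemma gc_jac: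
  assumes "c \<in> charts_at A p" "d \<in> charts_at A p"
  shows "gc c p v w = gc d p (jac c d p v) (jac c d p w)"
proof -
  have "gc c p v w = g p (lift c p v) (lift c p w)" by (simp add: g_lift[OF assms(1)])
  also have "\<dots> = gc d p (lift c p v d) (lift c p w d)"
    by (intro g_eq lift_tangent assms)
  finally show ?thesis using assms by (simp add: lift_def)
qed

abbreviation curv :: "('a, 'n) chart \<Rightarrow> 'a \<Rightarrow> 'n \<Rightarrow> 'n \<Rightarrow> 'n \<Rightarrow> 'n \<Rightarrow> real" where
  "curv c p \<equiv> coord_metric.Rl (Gc c) (snd c p)"

lemma curvature_inner_form_at: "c \<in> charts_at A p \<Longrightarrow> curvature_inner_form (curv c p) (gc c p)"
  by (rule coord_metric.curvature_inner_form[OF coord_metric_at snd_in_dom])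

lemma inner_form_at: "c \<in> charts_at A p \<Longrightarrow> inner_form (gc c p)"
  by (rule coord_metric.inner_form_gform[OF coord_metric_at snd_in_dom])

text \<open>The curvature in the sum that defines the sectional curvature is the one with its last index
  lowered; only the order of summation differs.\<close>

lemma sec_eq:
  assumes c: "c \<in> charts_at A p" and V: "V \<in> tangent_space A p" "U \<in> tangent_space A p"
  shows "sec A c g p V U = form4 (curv c p) (V c) (U c) (U c) (V c)
    / (gc c p (V c) (V c) * gc c p (U c) (U c) - (gc c p (V c) (U c))\<^sup>2)"
proof -
  let ?R = "\<lambda>l i j k. riemann A c g l i j k (snd c p)"
  let ?G = "\<lambda>l m. Gc c (snd c p) $ l $ m"
  have "(\<Sum>l\<in>UNIV. \<Sum>m\<in>UNIV. ?G l m * V c $ m *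
        (\<Sum>i\<in>UNIV. \<Sum>j\<in>UNIV. \<Sum>k\<in>UNIV. ?R l i j k * V c $ i * U c $ j * U c $ k))
     = (\<Sum>l\<in>UNIV. \<Sum>m\<in>UNIV. \<Sum>i\<in>UNIV. \<Sum>j\<in>UNIV. \<Sum>k\<in>UNIV.
          ?G l m * ?R l i j k * V c $ i * U c $ j * U c $ k * V c $ m)"
    by (simp add: sum_distrib_left mult_ac)
  also have "\<dots> = (\<Sum>i\<in>UNIV. \<Sum>j\<in>UNIV. \<Sum>k\<in>UNIV. \<Sum>m\<in>UNIV. \<Sum>l\<in>UNIV.
          ?G l m * ?R l i j k * V c $ i * U c $ j * U c $ k * V c $ m)"
  proof -
    have sw: "(\<Sum>l\<in>UNIV. \<Sum>m\<in>UNIV. \<Sum>i\<in>UNIV. \<Sum>j\<in>UNIV. \<Sum>k\<in>UNIV. h l m i j k)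
      = (\<Sum>i\<in>UNIV. \<Sum>j\<in>UNIV. \<Sum>k\<in>UNIV. \<Sum>m\<in>UNIV. \<Sum>l\<in>UNIV. (h l m i j k :: real))"
      for h :: "'n \<Rightarrow> 'n \<Rightarrow> 'n \<Rightarrow> 'n \<Rightarrow> 'n \<Rightarrow> real"
    proof -
      have "(\<Sum>l\<in>UNIV. \<Sum>m\<in>UNIV. \<Sum>i\<in>UNIV. \<Sum>j\<in>UNIV. \<Sum>k\<in>UNIV. h l m i j k)
        = (\<Sum>(l,m,i,j,k)\<in>UNIV. h l m i j k)"
        by (simp add: sum.cartesian_product UNIV_Times_UNIV)
      also have "\<dots> = (\<Sum>(i,j,k,m,l)\<in>UNIV. h l m i j k)"
        by (rule sum.reindex_bij_witness[of _ "\<lambda>(i,j,k,m,l). (l,m,i,j,k)" "\<lambda>(l,m,i,j,k). (i,j,k,m,l)"])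
          auto
      also have "\<dots> = (\<Sum>i\<in>UNIV. \<Sum>j\<in>UNIV. \<Sum>k\<in>UNIV. \<Sum>m\<in>UNIV. \<Sum>l\<in>UNIV. h l m i j k)"
        by (simp add: sum.cartesian_product UNIV_Times_UNIV)
      finally show ?thesis .
    qed
    show ?thesis by (rule sw)
  qed
  also have "\<dots> = form4 (curv c p) (V c) (U c) (U c) (V c)"
    unfolding form4_def coord_metric.Rl_def[OF coord_metric_at[OF c]] riemann_eq_coord
    by (simp add: sum_distrib_right)
  finally show ?thesis
    unfolding sec_def g_eq[OF c V(1) V(1)] g_eq[OF c V(2) V(2)] g_eq[OF c V] by simp
qed

definition on_frame :: "('a, 'n) chart \<Rightarrow> 'a \<Rightarrow> real^'n \<Rightarrow> real^'n \<Rightarrow> bool" where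
  "on_frame c p v u \<longleftrightarrow> inner_form.orthonormal (gc c p) v u"

lemma on_frame_iff:
  "c \<in> charts_at A p \<Longrightarrow> on_frame c p v u \<longleftrightarrow> gc c p v v = 1 \<and> gc c p u u = 1 \<and> gc c p v u = 0"
  by (simp add: on_frame_def inner_form.orthonormal_def[OF inner_form_at])

lemma orthonormal_pairI:
  assumes "c \<in> charts_at A p" "on_frame c p v u"
  shows "orthonormal_pair A g p (lift c p v) (lift c p u)"
  using assms by (simp add: orthonormal_pair_def lift_tangent g_lift on_frame_iff)

lemma orthonormal_pairD:
  assumes "c \<in> charts_at A p" "orthonormal_pair A g p V U"
  shows "on_frame c p (V c) (U c)" "V \<in> tangent_space A p" "U \<in> tangent_space A p"
  using assms by (auto simp: orthonormal_pair_def g_eq on_frame_iff)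

lemma sec_orthonormal:
  assumes c: "c \<in> charts_at A p" and "orthonormal_pair A g p V U"
  shows "sec A c g p V U = form4 (curv c p) (V c) (U c) (U c) (V c)"
  using orthonormal_pairD[OF assms] by (simp add: sec_eq[OF c] on_frame_iff[OF c])

lemma curv_swap:
  assumes c: "c \<in> charts_at A p"
  shows "form4 (curv c p) v u u v = form4 (curv c p) u v v u"
proof -
  interpret curvature_inner_form "curv c p" "gc c p" by (rule curvature_inner_form_at[OF c])
  show ?thesis using form4_antisym12[of v u u v] form4_antisym34[of u v u v] by linarith
qed

text \<open>Orthonormal pairs suffice, since the sectional curvature depends on the plane only; the
  denominator is nonzero for independent vectors by the Cauchy--Schwarz inequality, which is proved
  here by evaluating the metric on a multiple of the part of \<open>U\<close> orthogonal to \<open>V\<close>.\<close>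

lemma constant_curvature_iff:
  "constant_sectional_curvature M A g \<longleftrightarrow>
    (\<exists>\<kappa>. \<forall>p c v u. c \<in> charts_at A p \<longrightarrow> on_frame c p v u \<longrightarrow> form4 (curv c p) v u u v = \<kappa>)"
  (is "_ \<longleftrightarrow> ?rhs")
proof
  assume "constant_sectional_curvature M A g"
  then obtain \<kappa> where \<kappa>: "\<forall>p\<in>topspace M. \<forall>c\<in>charts_at A p.
     \<forall>V\<in>tangent_space A p. \<forall>U\<in>tangent_space A p.
       (\<forall>a b. (\<lambda>d. a *\<^sub>R V d + b *\<^sub>R U d) = (\<lambda>d. 0) \<longrightarrow> a = 0 \<and> b = 0) \<longrightarrow> sec A c g p V U = \<kappa>"
    unfolding constant_sectional_curvature_def by (elim exE)
  have "form4 (curv c p) v u u v = \<kappa>" if c: "c \<in> charts_at A p" and vu: "on_frame c p v u" for p c v u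
  proof -
    interpret inner_form "gc c p" by (rule inner_form_at[OF c])
    have ind: "a = 0 \<and> b = 0" if "(\<lambda>d. a *\<^sub>R lift c p v d + b *\<^sub>R lift c p u d) = (\<lambda>d. 0)" for a b
    proof -
      have 0: "a *\<^sub>R v + b *\<^sub>R u = 0"
        using fun_cong[OF that, of c] by (simp add: lift_self[OF c])
      have "gc c p (a *\<^sub>R v + b *\<^sub>R u) v = a" "gc c p (a *\<^sub>R v + b *\<^sub>R u) u = b"
        using vu sym[of u v] by (simp_all add: b_simps on_frame_iff[OF c])
      then show ?thesis unfolding 0 by (simp add: b_simps)
    qed
    then have "sec A c g p (lift c p v) (lift c p u) = \<kappa>"
      by (intro \<kappa>[THEN bspec, OF chart_at_topspace[OF c], THEN bspec, OF c, THEN bspec,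
            OF lift_tangent[OF c], THEN bspec, OF lift_tangent[OF c], THEN mp] allI impI ind)
    then show ?thesis
      using sec_orthonormal[OF c orthonormal_pairI[OF c vu]] by (simp add: lift_self[OF c])
  qed
  then show ?rhs by (intro exI allI impI)
next
  assume ?rhs
  then obtain \<kappa> where \<kappa>': "\<forall>p c v u. c \<in> charts_at A p \<longrightarrow> on_frame c p v u \<longrightarrow>
    form4 (curv c p) v u u v = \<kappa>" by (elim exE)
  note \<kappa> = \<kappa>'[rule_format]
  have "sec A c g p V U = \<kappa>"
    if c: "c \<in> charts_at A p" and V: "V \<in> tangent_space A p" "U \<in> tangent_space A p"
      and ind: "\<forall>a b. (\<lambda>d. a *\<^sub>R V d + b *\<^sub>R U d) = (\<lambda>d. 0) \<longrightarrow> a = 0 \<and> b = 0" for p c V U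
  proof -
    interpret curvature_inner_form "curv c p" "gc c p" by (rule curvature_inner_form_at[OF c])
    let ?b = "gc c p" and ?v = "V c" and ?u = "U c"
    have indc: "a = 0 \<and> b = 0" if "a *\<^sub>R ?v + b *\<^sub>R ?u = 0" for a b
    proof -
      have "(\<lambda>d. a *\<^sub>R V d + b *\<^sub>R U d) = lift c p (a *\<^sub>R ?v + b *\<^sub>R ?u)"
        by (simp add: lift_linear_combination[OF c] lift_of_tangent[OF _ c] V)
      also have "\<dots> = (\<lambda>d. 0)"
        using linear_jac[OF c] by (auto simp: that lift_def fun_eq_iff linear_0)
      finally show ?thesis using ind by blast
    qed
    have v: "?v \<noteq> 0" using indc[of 1 0] by auto
    then have vv: "?b ?v ?v > 0" by (rule pos)
    define w where "w = (- ?b ?v ?u) *\<^sub>R ?v + (?b ?v ?v) *\<^sub>R ?u"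
    have "w \<noteq> 0" using indc[of "- ?b ?v ?u" "?b ?v ?v"] vv by (auto simp: w_def)
    then have "?b w w > 0" by (rule pos)
    moreover have "?b w w = ?b ?v ?v * (?b ?v ?v * ?b ?u ?u - (?b ?v ?u)\<^sup>2)"
      unfolding w_def using sym[of ?u ?v] by (simp add: b_simps power2_eq_square algebra_simps)
    ultimately have "?b ?v ?v * ?b ?u ?u - (?b ?v ?u)\<^sup>2 \<noteq> 0" by auto
    moreover have "form4 (curv c p) ?v ?u ?u ?v = \<kappa> * (?b ?v ?v * ?b ?u ?u - (?b ?v ?u)\<^sup>2)"
      by (rule sectional_from_orthonormal) (use \<kappa>[OF c] in \<open>simp add: on_frame_def\<close>)
    ultimately show ?thesis
      unfolding sec_eq[OF c V] by simp
  qed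
  then show "constant_sectional_curvature M A g"
    unfolding constant_sectional_curvature_def by (intro exI ballI impI)
qed

text \<open>A level set and its complement are both open, by the constancy on coordinate balls, and the
  manifold is connected.\<close>

lemma locally_constant_imp_constant:
  fixes \<kappa> :: "'a \<Rightarrow> real"
  assumes "\<And>c x. c \<in> A \<Longrightarrow> x \<in> dom c \<Longrightarrow> ((\<kappa> \<circ> chart_inv c) has_derivative (\<lambda>h. 0)) (at x)"
  shows "\<exists>k. \<forall>p\<in>topspace M. \<kappa> p = k"
proof (rule ccontr)
  assume neg: "\<not> ?thesis"
  have nbhd: "\<exists>U. openin M U \<and> p \<in> U \<and> (\<forall>q\<in>U. \<kappa> q = \<kappa> p)" if p: "p \<in> topspace M" for p
  proof -
    obtain c where c: "c \<in> charts_at A p" using ex_chart_at[OF p] by blast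
    then have cA: "c \<in> A" by (simp add: charts_at_iff)
    obtain r where r: "r > 0" "ball (snd c p) r \<subseteq> dom c"
      using open_dom[OF cA] snd_in_dom[OF c] by (meson open_contains_ball)
    let ?U = "{q \<in> fst c. snd c q \<in> ball (snd c p) r}"
    have "openin (subtopology M (fst c)) {q \<in> topspace (subtopology M (fst c)). snd c q \<in> ball (snd c p) r}"
      using homeomorphic_imp_continuous_map[OF homeo[OF cA]] r(2)
      by (intro openin_continuous_map_preimage) (auto intro: open_subset)
    then have "openin M ?U"
      using open_chart[OF cA] by (simp only: topspace_chart[OF cA] openin_trans_full)
    moreover have "\<kappa> q = \<kappa> p" if q: "q \<in> ?U" for q
    proof -
      have "(\<kappa> \<circ> chart_inv c) (snd c q) = (\<kappa> \<circ> chart_inv c) (snd c p)"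
      proof (rule has_derivative_zero_unique[where f="\<kappa> \<circ> chart_inv c" and s="ball (snd c p) r"])
        show "convex (ball (snd c p) r)" by simp
        fix x assume "x \<in> ball (snd c p) r"
        then have "x \<in> dom c" by (rule subsetD[OF r(2)])
        then show "((\<kappa> \<circ> chart_inv c) has_derivative (\<lambda>h. 0)) (at x within ball (snd c p) r)"
          by (rule has_derivative_at_withinI[OF assms[OF cA]])
      next
        show "snd c q \<in> ball (snd c p) r" using q by simp
        show "snd c p \<in> ball (snd c p) r" using r(1) by simp
      qed
      then show ?thesis using q c cA by (simp add: chart_inv_chart chart_inv_at)
    qed
    moreover have "p \<in> ?U" using r c by (simp add: charts_at_iff)
    ultimately show ?thesis by blast
  qed
  from neg obtain p0 where p0: "p0 \<in> topspace M" by blast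
  let ?E = "{p \<in> topspace M. \<kappa> p = \<kappa> p0}" and ?F = "{p \<in> topspace M. \<kappa> p \<noteq> \<kappa> p0}"
  have "openin M ?E"
  proof (subst openin_subopen, intro ballI)
    fix p assume p: "p \<in> ?E"
    then obtain U where U: "openin M U" "p \<in> U" "\<forall>q\<in>U. \<kappa> q = \<kappa> p" using nbhd by blast
    have "U \<subseteq> ?E" using openin_subset[OF U(1)] U(3) p by auto
    with U show "\<exists>T. openin M T \<and> p \<in> T \<and> T \<subseteq> ?E" by blast
  qed
  moreover have "openin M ?F"
  proof (subst openin_subopen, intro ballI)
    fix p assume p: "p \<in> ?F"
    then obtain U where U: "openin M U" "p \<in> U" "\<forall>q\<in>U. \<kappa> q = \<kappa> p" using nbhd by blast
    have "U \<subseteq> ?F" using openin_subset[OF U(1)] U(3) p by auto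
    with U show "\<exists>T. openin M T \<and> p \<in> T \<and> T \<subseteq> ?F" by blast
  qed
  moreover have "topspace M \<subseteq> ?E \<union> ?F" "?E \<inter> ?F = {}" "?E \<noteq> {}" using p0 by auto
  moreover have "?F \<noteq> {}" using neg by blast
  moreover have "connected_space M" using manifold by (simp add: smooth_manifold_def)
  ultimately show False unfolding connected_space_def by meson
qed

text \<open>The curvature function is a function on the manifold, so its local constancy in the charts can be
  glued together.\<close>

lemma schur_global:
  assumes dim: "CARD('n) > 2"
    and sect: "\<And>p c v u. c \<in> charts_at A p \<Longrightarrow> on_frame c p v u \<Longrightarrow> form4 (curv c p) v u u v = \<kappa> p"
  shows "constant_sectional_curvature M A g"
proof -
  have "((\<kappa> \<circ> chart_inv c) has_derivative (\<lambda>h. 0)) (at x)" if c: "c \<in> A" and x: "x \<in> dom c" for c x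
  proof (rule coord_metric.schur[OF coord_metric_Gc[OF c] dim _ x])
    fix y v u assume y: "y \<in> dom c"
      and vu: "inner_form.orthonormal (form2 (\<lambda>i j. Gc c y $ i $ j)) v u"
    obtain q where "c \<in> charts_at A q" "y = snd c q" "chart_inv c y = q"
      using dom_obtain[OF c y] .
    then show "form4 (coord_metric.Rl (Gc c) y) v u u v = (\<kappa> \<circ> chart_inv c) y"
      using sect[of c q v u] vu by (simp add: on_frame_def)
  qed
  then obtain k where "\<And>p. p \<in> topspace M \<Longrightarrow> \<kappa> p = k"
    using locally_constant_imp_constant[of \<kappa>] by blast
  then show ?thesis
    unfolding constant_curvature_iff using sect chart_at_topspace by metis
qed

end

section \<open>The Lie derivative of the metric\<close>

definition lie_comp :: "(real^'n::finite \<Rightarrow> real^'n^'n) \<Rightarrow> ('n \<Rightarrow> real^'n \<Rightarrow> real) \<Rightarrow> real^'n \<Rightarrow> 'n \<Rightarrow> 'n \<Rightarrow> real" where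
  "lie_comp G X x i j = (\<Sum>k\<in>UNIV. X k x * pd k (\<lambda>y. G y $ i $ j) x
     + G x $ k $ j * pd i (X k) x + G x $ i $ k * pd j (X k) x)"

lemma lie_metric_eq:
  "lie_metric A c X g p V W = form2 (lie_comp (metric_matrix A c g) (vf_comp c X) (snd c p)) (V c) (W c)"
  by (simp add: lie_metric_def form2_def lie_comp_def)

lemma sum_swap_pairs:
  fixes h :: "'b::finite \<Rightarrow> 'c::finite \<Rightarrow> 'd::finite \<Rightarrow> 'e::finite \<Rightarrow> real"
  shows "(\<Sum>i\<in>UNIV. \<Sum>j\<in>UNIV. \<Sum>a\<in>UNIV. \<Sum>b\<in>UNIV. h i j a b)
    = (\<Sum>a\<in>UNIV. \<Sum>b\<in>UNIV. \<Sum>i\<in>UNIV. \<Sum>j\<in>UNIV. h i j a b)"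
proof -
  have "(\<Sum>i\<in>UNIV. \<Sum>j\<in>UNIV. \<Sum>a\<in>UNIV. \<Sum>b\<in>UNIV. h i j a b) = (\<Sum>(i,j,a,b)\<in>UNIV. h i j a b)"
    by (simp add: sum.cartesian_product UNIV_Times_UNIV)
  also have "\<dots> = (\<Sum>(a,b,i,j)\<in>UNIV. h i j a b)"
    by (rule sum.reindex_bij_witness[of _ "\<lambda>(a,b,i,j). (i,j,a,b)" "\<lambda>(i,j,a,b). (a,b,i,j)"]) auto
  also have "\<dots> = (\<Sum>a\<in>UNIV. \<Sum>b\<in>UNIV. \<Sum>i\<in>UNIV. \<Sum>j\<in>UNIV. h i j a b)"
    by (simp add: sum.cartesian_product UNIV_Times_UNIV)
  finally show ?thesis .
qed

lemma form2_transform: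
  assumes "\<And>i j. B i j = (\<Sum>a\<in>UNIV. \<Sum>b\<in>UNIV. C a b * J a i * J b j)"
    and "\<And>a. v' $ a = (\<Sum>i\<in>UNIV. J a i * v $ i)" "\<And>a. w' $ a = (\<Sum>i\<in>UNIV. J a i * w $ i)"
  shows "form2 B v w = form2 C v' w'"
proof -
  have "form2 B v w = (\<Sum>i\<in>UNIV. \<Sum>j\<in>UNIV. \<Sum>a\<in>UNIV. \<Sum>b\<in>UNIV.
      C a b * J a i * J b j * v $ i * w $ j)"
    by (simp add: form2_def assms(1) sum_distrib_right)
  also have "\<dots> = (\<Sum>a\<in>UNIV. \<Sum>b\<in>UNIV. \<Sum>i\<in>UNIV. \<Sum>j\<in>UNIV.
      C a b * J a i * J b j * v $ i * w $ j)"
    by (rule sum_swap_pairs)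
  also have "\<dots> = form2 C v' w'"
  proof -
    have "(\<Sum>i\<in>UNIV. \<Sum>j\<in>UNIV. C a b * J a i * J b j * v $ i * w $ j) = C a b * v' $ a * w' $ b" for a b
    proof -
      have "C a b * v' $ a * w' $ b = C a b * ((\<Sum>i\<in>UNIV. J a i * v $ i) * (\<Sum>j\<in>UNIV. J b j * w $ j))"
        by (simp only: assms(2,3) mult.assoc)
      then show ?thesis
        unfolding sum_product unfolding sum_distrib_left by (simp add: mult_ac)
    qed
    then show ?thesis by (simp add: form2_def)
  qed
  finally show ?thesis .
qed

lemma sum_swap3:
  "(\<Sum>k\<in>(UNIV :: 'c::finite set). \<Sum>a\<in>(UNIV :: 'a::finite set). \<Sum>b\<in>(UNIV :: 'b::finite set). h k a b)
    = (\<Sum>a\<in>UNIV. \<Sum>b\<in>UNIV. \<Sum>k\<in>UNIV. (h k a b :: real))"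
proof -
  have "(\<Sum>k\<in>UNIV. \<Sum>a\<in>UNIV. \<Sum>b\<in>UNIV. h k a b) = (\<Sum>a\<in>UNIV. \<Sum>k\<in>UNIV. \<Sum>b\<in>UNIV. h k a b)"
    by (rule sum.swap)
  also have "\<dots> = (\<Sum>a\<in>UNIV. \<Sum>b\<in>UNIV. \<Sum>k\<in>UNIV. h k a b)"
    by (rule sum.cong[OF refl], rule sum.swap)
  finally show ?thesis .
qed

text \<open>The components of the Lie derivative transform as a tensor: the second derivatives of the
  coordinate change \<open>\<tau>\<close> produced by the metric and by the vector field cancel.\<close>

lemma lie_comp_transform:
  fixes \<tau> :: "real^'n::finite \<Rightarrow> real^'n"
  assumes S: "open S" "x \<in> S" and \<tau>: "\<And>a. smooth_on S (\<lambda>y. \<tau> y $ a)"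
    and G': "\<And>a b. (\<lambda>y. G' y $ a $ b) differentiable (at (\<tau> x))"
    and X': "\<And>a. X' a differentiable (at (\<tau> x))"
    and X: "\<And>a. X a differentiable (at x)"
    and GG': "\<And>y i j. y \<in> S \<Longrightarrow> G y $ i $ j
      = (\<Sum>a\<in>UNIV. \<Sum>b\<in>UNIV. G' (\<tau> y) $ a $ b * pd i (\<lambda>y. \<tau> y $ a) y * pd j (\<lambda>y. \<tau> y $ b) y)"
    and XX': "\<And>y a. y \<in> S \<Longrightarrow> X' a (\<tau> y) = (\<Sum>k\<in>UNIV. pd k (\<lambda>y. \<tau> y $ a) y * X k y)"
  shows "lie_comp G X x i j
    = (\<Sum>a\<in>UNIV. \<Sum>b\<in>UNIV. lie_comp G' X' (\<tau> x) a b * pd i (\<lambda>y. \<tau> y $ a) x * pd j (\<lambda>y. \<tau> y $ b) x)"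
proof -
  define J where "J a i = pd i (\<lambda>y. \<tau> y $ a)" for a i
  define K where "K a i k = pd k (J a i) x" for a i k
  have K_sym: "K a i k = K a k i" for a i k
    unfolding K_def J_def by (rule pd_commute[OF S(1) \<tau> S(2)])
  have J_diff: "J a i differentiable (at x)" for a i
    unfolding J_def by (rule smooth_on_imp_differentiable[OF smooth_on_pd[OF \<tau>] S(2)])
  have \<tau>_diff: "(\<lambda>y. \<tau> y $ a) differentiable (at x)" for a
    by (rule smooth_on_imp_differentiable[OF \<tau> S(2)])
  let ?g = "\<lambda>a b. G' (\<tau> x) $ a $ b" and ?J = "\<lambda>a i. J a i x"
  define P where "P c a b = pd c (\<lambda>y. G' y $ a $ b) (\<tau> x)" for c a b
  define XG where "XG a b = (\<Sum>c\<in>UNIV. X' c (\<tau> x) * P c a b)" for a b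
  define Y where "Y a i = (\<Sum>c\<in>UNIV. ?J c i * pd c (X' a) (\<tau> x))" for a i
  define Z where "Z a i = (\<Sum>k\<in>UNIV. X k x * K a i k)" for a i
  note Gcomp = pd_comp[where f="\<lambda>y. G' y $ a $ b" for a b, OF \<tau>_diff G']
  note Xcomp = pd_comp[where f="X' a" for a, OF \<tau>_diff X']
  have dG: "pd k (\<lambda>y. G y $ i $ j) x = (\<Sum>a\<in>UNIV. \<Sum>b\<in>UNIV.
      (\<Sum>c\<in>UNIV. ?J c k * P c a b) * ?J a i * ?J b j
      + ?g a b * K a i k * ?J b j + ?g a b * ?J a i * K b j k)" for k i j
  proof -
    have d1: "(\<lambda>y. G' (\<tau> y) $ a $ b * J a i y) differentiable (at x)" for a b
      by (rule differentiable_mult[OF Gcomp(1) J_diff])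
    have d2: "(\<lambda>y. G' (\<tau> y) $ a $ b * J a i y * J b j y) differentiable (at x)" for a b
      by (rule differentiable_mult[OF d1 J_diff])
    have "pd k (\<lambda>y. G y $ i $ j) x
        = pd k (\<lambda>y. \<Sum>a\<in>UNIV. \<Sum>b\<in>UNIV. G' (\<tau> y) $ a $ b * J a i y * J b j y) x"
      by (rule pd_cong_open[OF S]) (simp add: GG' J_def)
    also have "\<dots> = (\<Sum>a\<in>UNIV. \<Sum>b\<in>UNIV. pd k (\<lambda>y. G' (\<tau> y) $ a $ b * J a i y * J b j y) x)"
      by (subst pd_sum; (intro differentiable_sum finite ballI d2)?)
        (intro sum.cong refl pd_sum d2)
    finally show ?thesis
      unfolding pd_mult[OF d1 J_diff] pd_mult[OF Gcomp(1) J_diff] Gcomp(2)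
      by (simp add: J_def[symmetric] K_def P_def algebra_simps)
  qed
  have JX: "(\<Sum>k\<in>UNIV. ?J a k * pd i (X k) x) = Y a i - Z a i" for a i
  proof -
    have "pd i (\<lambda>y. X' a (\<tau> y)) x = pd i (\<lambda>y. \<Sum>k\<in>UNIV. J a k y * X k y) x"
      by (rule pd_cong_open[OF S]) (simp add: XX' J_def)
    also have "\<dots> = (\<Sum>k\<in>UNIV. K a k i * X k x + ?J a k * pd i (X k) x)"
      by (subst pd_sum) (simp_all add: pd_mult[OF J_diff X] differentiable_mult[OF J_diff X] K_def)
    also have "\<dots> = Z a i + (\<Sum>k\<in>UNIV. ?J a k * pd i (X k) x)"
      by (simp add: sum.distrib Z_def K_sym[of a _ i] mult.commute)
    finally show ?thesis
      unfolding Xcomp(2) by (simp add: Y_def J_def)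
  qed
  have X'x: "X' c (\<tau> x) = (\<Sum>k\<in>UNIV. ?J c k * X k x)" for c
    by (simp add: XX'[OF S(2)] J_def)
  have 1: "(\<Sum>k\<in>UNIV. X k x * pd k (\<lambda>y. G y $ i $ j) x) = (\<Sum>a\<in>UNIV. \<Sum>b\<in>UNIV.
      XG a b * ?J a i * ?J b j + ?g a b * Z a i * ?J b j + ?g a b * ?J a i * Z b j)" for i j
  proof -
    have XG: "(\<Sum>k\<in>UNIV. X k x * (\<Sum>c\<in>UNIV. ?J c k * P c a b)) = XG a b" for a b
      unfolding XG_def X'x sum_distrib_left sum_distrib_right
      by (subst sum.swap) (simp add: mult_ac)
    have "(\<Sum>k\<in>UNIV. X k x * pd k (\<lambda>y. G y $ i $ j) x)
      = (\<Sum>a\<in>UNIV. \<Sum>b\<in>UNIV. \<Sum>k\<in>UNIV. X k x * ((\<Sum>c\<in>UNIV. ?J c k * P c a b) * ?J a i * ?J b j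
      + ?g a b * K a i k * ?J b j + ?g a b * ?J a i * K b j k))"
      unfolding dG sum_distrib_left[of "X _ x"] by (rule sum_swap3)
    also have "\<dots> = (\<Sum>a\<in>UNIV. \<Sum>b\<in>UNIV. \<Sum>k\<in>UNIV. (X k x * (\<Sum>c\<in>UNIV. ?J c k * P c a b)) * (?J a i * ?J b j)
      + (?g a b * ?J b j) * (X k x * K a i k) + (?g a b * ?J a i) * (X k x * K b j k))"
      by (intro sum.cong refl) (simp only: algebra_simps)
    also have "\<dots> = (\<Sum>a\<in>UNIV. \<Sum>b\<in>UNIV. XG a b * (?J a i * ?J b j)
      + (?g a b * ?J b j) * Z a i + (?g a b * ?J a i) * Z b j)"
      unfolding sum.distrib[of _ _ "UNIV :: 'n set"] sum_distrib_left[symmetric] sum_distrib_right[symmetric]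
        XG Z_def by (rule refl)
    finally show ?thesis by (simp add: mult_ac)
  qed
  have 2: "(\<Sum>k\<in>UNIV. G x $ k $ j * pd i (X k) x)
      = (\<Sum>a\<in>UNIV. \<Sum>b\<in>UNIV. ?g a b * ?J b j * (Y a i - Z a i))" for i j
  proof -
    have "(\<Sum>k\<in>UNIV. G x $ k $ j * pd i (X k) x)
      = (\<Sum>k\<in>UNIV. \<Sum>a\<in>UNIV. \<Sum>b\<in>UNIV. ?g a b * ?J b j * (?J a k * pd i (X k) x))"
      unfolding GG'[OF S(2)] J_def[symmetric] sum_distrib_right by (simp add: mult_ac)
    also have "\<dots> = (\<Sum>a\<in>UNIV. \<Sum>b\<in>UNIV. \<Sum>k\<in>UNIV. ?g a b * ?J b j * (?J a k * pd i (X k) x))"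
      by (rule sum_swap3)
    finally show ?thesis by (simp only: sum_distrib_left[symmetric] JX)
  qed
  have 3: "(\<Sum>k\<in>UNIV. G x $ i $ k * pd j (X k) x)
      = (\<Sum>a\<in>UNIV. \<Sum>b\<in>UNIV. ?g a b * ?J a i * (Y b j - Z b j))" for i j
  proof -
    have "(\<Sum>k\<in>UNIV. G x $ i $ k * pd j (X k) x)
      = (\<Sum>k\<in>UNIV. \<Sum>a\<in>UNIV. \<Sum>b\<in>UNIV. ?g a b * ?J a i * (?J b k * pd j (X k) x))"
      unfolding GG'[OF S(2)] J_def[symmetric] sum_distrib_right by (simp add: mult_ac)
    also have "\<dots> = (\<Sum>a\<in>UNIV. \<Sum>b\<in>UNIV. \<Sum>k\<in>UNIV. ?g a b * ?J a i * (?J b k * pd j (X k) x))"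
      by (rule sum_swap3)
    finally show ?thesis by (simp only: sum_distrib_left[symmetric] JX)
  qed
  have l: "lie_comp G X x i j = (\<Sum>a\<in>UNIV. \<Sum>b\<in>UNIV.
      XG a b * ?J a i * ?J b j + ?g a b * Y a i * ?J b j + ?g a b * ?J a i * Y b j)"
    unfolding lie_comp_def sum.distrib[of _ _ "UNIV :: 'n set"] 1 2 3
    by (simp add: sum.distrib[symmetric] algebra_simps)
  have 4: "(\<Sum>a\<in>UNIV. \<Sum>b\<in>UNIV. (\<Sum>c\<in>UNIV. ?g c b * pd a (X' c) (\<tau> x)) * ?J a i * ?J b j)
      = (\<Sum>a\<in>UNIV. \<Sum>b\<in>UNIV. ?g a b * Y a i * ?J b j)" (is "?l = ?r")
  proof -
    have "?l = (\<Sum>a\<in>UNIV. \<Sum>b\<in>UNIV. \<Sum>c\<in>UNIV. ?g c b * (?J a i * pd a (X' c) (\<tau> x)) * ?J b j)"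
      unfolding sum_distrib_right by (simp add: mult_ac)
    also have "\<dots> = (\<Sum>b\<in>UNIV. \<Sum>c\<in>UNIV. \<Sum>a\<in>UNIV. ?g c b * (?J a i * pd a (X' c) (\<tau> x)) * ?J b j)"
      by (rule sum_swap3)
    also have "\<dots> = (\<Sum>b\<in>UNIV. \<Sum>c\<in>UNIV. ?g c b * Y c i * ?J b j)"
      by (simp add: Y_def sum_distrib_left sum_distrib_right)
    also have "\<dots> = ?r" by (rule sum.swap)
    finally show ?thesis .
  qed
  have 5: "(\<Sum>a\<in>UNIV. \<Sum>b\<in>UNIV. (\<Sum>c\<in>UNIV. ?g a c * pd b (X' c) (\<tau> x)) * ?J a i * ?J b j)
      = (\<Sum>a\<in>UNIV. \<Sum>b\<in>UNIV. ?g a b * ?J a i * Y b j)" (is "?l = ?r")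
  proof (rule sum.cong[OF refl])
    fix a :: 'n
    have "(\<Sum>b\<in>UNIV. (\<Sum>c\<in>UNIV. ?g a c * pd b (X' c) (\<tau> x)) * ?J a i * ?J b j)
      = (\<Sum>b\<in>UNIV. \<Sum>c\<in>UNIV. ?g a c * ?J a i * (?J b j * pd b (X' c) (\<tau> x)))"
      unfolding sum_distrib_right by (simp add: mult_ac)
    also have "\<dots> = (\<Sum>c\<in>UNIV. \<Sum>b\<in>UNIV. ?g a c * ?J a i * (?J b j * pd b (X' c) (\<tau> x)))"
      by (rule sum.swap)
    finally show "(\<Sum>b\<in>UNIV. (\<Sum>c\<in>UNIV. ?g a c * pd b (X' c) (\<tau> x)) * ?J a i * ?J b j)
      = (\<Sum>b\<in>UNIV. ?g a b * ?J a i * Y b j)"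
      by (simp add: Y_def sum_distrib_left)
  qed
  show ?thesis
    unfolding l J_def[symmetric] lie_comp_def[of G'] sum.distrib[of _ _ "UNIV :: 'n set"]
      distrib_right 4 5 XG_def P_def by (simp add: sum_distrib_right)
qed

context riemannian_manifold
begin

lemma Gc_transform:
  assumes A: "c \<in> A" "d \<in> A" and x: "x \<in> overlap c d"
  shows "Gc c x $ i $ j = (\<Sum>a\<in>UNIV. \<Sum>b\<in>UNIV. Gc d (transition c d x) $ a $ b
    * pd i (\<lambda>y. transition c d y $ a) x * pd j (\<lambda>y. transition c d y $ b) x)"
proof -
  obtain p where p: "c \<in> charts_at A p" "d \<in> charts_at A p" "x = snd c p" "transition c d x = snd d p"
    using overlap_obtain[OF A x] by metis
  have s: "(\<Sum>i\<in>UNIV. h i * axis k 1 $ i) = h k" for h :: "'n \<Rightarrow> real" and k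
    by (simp add: axis_def if_distrib[of "\<lambda>a. _ * a"] cong: if_cong)
  have J: "jac c d p (axis i 1) $ a = pd i (\<lambda>y. transition c d y $ a) x" for i a
    unfolding jac_nth[OF p(1,2)] s p(3) by (rule refl)
  have "Gc c x $ i $ j = gc c p (axis i 1) (axis j 1)"
    unfolding form2_def p(3) s
    by (simp add: axis_def if_distrib[of "\<lambda>a. a * _"] if_distrib[of "\<lambda>a. _ * a"] cong: if_cong)
  also have "\<dots> = gc d p (jac c d p (axis i 1)) (jac c d p (axis j 1))"
    by (rule gc_jac[OF p(1,2)])
  finally show ?thesis
    by (simp add: form2_def J p(4))
qed

text \<open>This makes the factor relating the Lie derivative to the metric, which is found in one chart at a
  point, valid in all charts around it.\<close>

lemma lie_metric_chart_independent:
  assumes X: "smooth_vector_field M A X"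
    and c: "c \<in> charts_at A p" and d: "d \<in> charts_at A p"
    and V: "V \<in> tangent_space A p" and W: "W \<in> tangent_space A p"
  shows "lie_metric A c X g p V W = lie_metric A d X g p V W"
proof -
  have A: "c \<in> A" "d \<in> A" using c d by (auto simp: charts_at_iff)
  let ?\<tau> = "transition c d" and ?x = "snd c p"
  have Xdiff: "vf_comp c X i differentiable (at y)" if "c \<in> A" "y \<in> dom c" for c i y
    using X that by (intro smooth_on_imp_differentiable[where S="dom c"]) (auto simp: smooth_vector_field_def)
  have 1: "lie_comp (Gc c) (vf_comp c X) ?x i j = (\<Sum>a\<in>UNIV. \<Sum>b\<in>UNIV.
    lie_comp (Gc d) (vf_comp d X) (snd d p) a b * pd i (\<lambda>y. ?\<tau> y $ a) ?x * pd j (\<lambda>y. ?\<tau> y $ b) ?x)" for i j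
    unfolding transition_at[OF c, of d, symmetric]
  proof (rule lie_comp_transform[OF open_overlap[OF A] snd_in_overlap[OF c d] smooth_transition[OF A]])
    show "(\<lambda>y. Gc d y $ a $ b) differentiable (at (?\<tau> ?x))" for a b
      unfolding transition_at[OF c]
      by (rule smooth_on_imp_differentiable[OF coord_metric.smooth[OF coord_metric_at[OF d]] snd_in_dom[OF d]])
    show "vf_comp d X a differentiable (at (?\<tau> ?x))" for a
      unfolding transition_at[OF c] by (rule Xdiff[OF A(2) snd_in_dom[OF d]])
    show "vf_comp c X a differentiable (at ?x)" for a
      by (rule Xdiff[OF A(1) snd_in_dom[OF c]])
    fix y assume y: "y \<in> overlap c d"
    show "Gc c y $ i $ j = (\<Sum>a\<in>UNIV. \<Sum>b\<in>UNIV. Gc d (?\<tau> y) $ a $ b * pd i (\<lambda>y. ?\<tau> y $ a) y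
        * pd j (\<lambda>y. ?\<tau> y $ b) y)" for i j
      by (rule Gc_transform[OF A y])
    obtain q where q: "c \<in> charts_at A q" "d \<in> charts_at A q" "y = snd c q" "?\<tau> y = snd d q"
      using overlap_obtain[OF A y] by metis
    have "X q \<in> tangent_space A q"
      using X chart_at_topspace[OF q(1)] by (auto simp: smooth_vector_field_def)
    note tq = tangentD[OF this q(1,2)]
    have "vf_comp d X a (?\<tau> y) = X q d $ a" for a
      by (simp only: vf_comp_def q(4) chart_inv_at[OF q(2)])
    moreover have "vf_comp c X k y = X q c $ k" for k
      by (simp only: vf_comp_def q(3) chart_inv_at[OF q(1)])
    ultimately show "vf_comp d X a (?\<tau> y) = (\<Sum>k\<in>UNIV. pd k (\<lambda>y. ?\<tau> y $ a) y * vf_comp c X k y)" for a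
      by (simp only: tq jac_nth[OF q(1,2)] q(3)[symmetric])
  qed
  show ?thesis
    unfolding lie_metric_eq
    by (rule form2_transform[OF 1]) (simp_all add: jac_nth[OF c d] tangentD[OF V c d] tangentD[OF W c d])
qed

lemma lie_comp_sym:
  assumes c: "c \<in> charts_at A p"
  shows "lie_comp (Gc c) X (snd c p) i j = lie_comp (Gc c) X (snd c p) j i"
proof -
  interpret coord_metric "dom c" "Gc c" by (rule coord_metric_at[OF c])
  have "pd k (\<lambda>y. Gc c y $ i $ j) (snd c p) = pd k (\<lambda>y. Gc c y $ j $ i) (snd c p)" for k
    by (rule pd_cong_open[OF open_dom snd_in_dom[OF c]]) (rule sym)
  then show ?thesis
    unfolding lie_comp_def by (intro sum.cong refl) (simp add: sym[OF snd_in_dom[OF c]])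
qed

lemma lie_metric_lift:
  "c \<in> charts_at A p \<Longrightarrow> lie_metric A c X g p (lift c p v) (lift c p w)
    = form2 (lie_comp (Gc c) (vf_comp c X) (snd c p)) v w"
  by (simp add: lie_metric_eq lift_self)

end

section \<open>The gradient and the conformal metric\<close>

locale riemannian_manifold_function = riemannian_manifold M A g
  for M :: "'a topology" and A :: "('a, 'n::finite) chart set" and g :: "('a, 'n) metric" +
  fixes f :: "'a \<Rightarrow> real"
  assumes smooth_f: "smooth_function A f"
begin

abbreviation Fc :: "('a, 'n) chart \<Rightarrow> real^'n \<Rightarrow> real" where
  "Fc c \<equiv> f \<circ> chart_inv c"

lemma smooth_Fc: "c \<in> A \<Longrightarrow> smooth_on (dom c) (Fc c)"
  using smooth_f by (simp add: smooth_function_def)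

lemma coord_conformal_Fc: "c \<in> A \<Longrightarrow> coord_conformal (dom c) (Gc c) (Fc c)"
  by (simp add: coord_conformal_def coord_conformal_axioms_def coord_metric_Gc smooth_Fc)

lemma coord_conformal_at: "c \<in> charts_at A p \<Longrightarrow> coord_conformal (dom c) (Gc c) (Fc c)"
  by (simp add: charts_at_iff coord_conformal_Fc)

abbreviation gradf :: "('a, 'n) vfield" where
  "gradf \<equiv> grad A g f"

lemma grad_comp:
  assumes c: "c \<in> charts_at A p"
  shows "gradf p c $ i = coord_conformal.gradF (Gc c) (Fc c) i (snd c p)"
  unfolding coord_conformal.gradF_def[OF coord_conformal_at[OF c]]
  using c by (simp add: grad_def matrix_vector_mult_def)

lemma vf_comp_grad:
  assumes c: "c \<in> A" and x: "x \<in> dom c"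
  shows "vf_comp c gradf i x = coord_conformal.gradF (Gc c) (Fc c) i x"
proof -
  obtain p where p: "c \<in> charts_at A p" "x = snd c p" "chart_inv c x = p" using dom_obtain[OF c x] .
  show ?thesis by (simp only: vf_comp_def p(3) grad_comp[OF p(1)] p(2)[symmetric])
qed

definition dform :: "('a, 'n) chart \<Rightarrow> 'a \<Rightarrow> real^'n \<Rightarrow> real" where
  "dform c p v = (\<Sum>i\<in>UNIV. pd i (Fc c) (snd c p) * v $ i)"

text \<open>The differential is a covector: this is the chain rule.\<close>

lemma dform_jac:
  assumes c: "c \<in> charts_at A p" and d: "d \<in> charts_at A p"
  shows "dform c p v = dform d p (jac c d p v)"
proof -
  have A: "c \<in> A" "d \<in> A" using c d by (auto simp: charts_at_iff)
  let ?\<tau> = "transition c d" and ?x = "snd c p"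
  have \<tau>: "(\<lambda>y. ?\<tau> y $ a) differentiable (at ?x)" for a
    by (rule smooth_on_imp_differentiable[OF smooth_transition[OF A] snd_in_overlap[OF c d]])
  have Fd: "Fc d differentiable (at (?\<tau> ?x))"
    unfolding transition_at[OF c] by (rule smooth_on_imp_differentiable[OF smooth_Fc[OF A(2)] snd_in_dom[OF d]])
  have "Fc c y = Fc d (?\<tau> y)" if "y \<in> overlap c d" for y
  proof -
    obtain q where q: "c \<in> charts_at A q" "d \<in> charts_at A q" "y = snd c q" "chart_inv c y = q"
      "?\<tau> y = snd d q" using overlap_obtain[OF A \<open>y \<in> overlap c d\<close>] .
    show ?thesis by (simp only: o_apply q(4,5) chart_inv_at[OF q(2)])
  qed
  then have "pd i (Fc c) ?x = pd i (\<lambda>y. Fc d (?\<tau> y)) ?x" for i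
    by (rule pd_cong_open[OF open_overlap[OF A] snd_in_overlap[OF c d]])
  also have "pd i (\<lambda>y. Fc d (?\<tau> y)) ?x
      = (\<Sum>a\<in>UNIV. pd i (\<lambda>y. ?\<tau> y $ a) ?x * pd a (Fc d) (snd d p))" for i
    unfolding pd_comp(2)[OF \<tau> Fd] transition_at[OF c] by (rule refl)
  finally have "dform c p v = (\<Sum>i\<in>UNIV. \<Sum>a\<in>UNIV. pd i (\<lambda>y. ?\<tau> y $ a) ?x * pd a (Fc d) (snd d p) * v $ i)"
    unfolding dform_def by (simp add: sum_distrib_right)
  also have "\<dots> = (\<Sum>a\<in>UNIV. \<Sum>i\<in>UNIV. pd i (\<lambda>y. ?\<tau> y $ a) ?x * pd a (Fc d) (snd d p) * v $ i)"
    by (rule sum.swap)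
  finally show ?thesis
    by (simp add: dform_def jac_nth[OF c d] sum_distrib_left mult_ac)
qed

lemma gc_grad:
  assumes c: "c \<in> charts_at A p"
  shows "gc c p (gradf p c) v = dform c p v"
proof -
  interpret coord_conformal "dom c" "Gc c" "Fc c" by (rule coord_conformal_at[OF c])
  note x = snd_in_dom[OF c]
  have "gc c p (gradf p c) v = (\<Sum>j\<in>UNIV. (\<Sum>i\<in>UNIV. Gc c (snd c p) $ j $ i * gradF i (snd c p)) * v $ j)"
    unfolding form2_def grad_comp[OF c] sum_distrib_right
    by (subst sum.swap) (simp add: sym[OF x])
  then show ?thesis
    by (simp only: lower_gradF[OF x] dform_def)
qed

text \<open>The gradient is the vector dual to the differential, so its coordinates transform as those of
  a tangent vector.\<close>

lemma grad_tangent: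
  assumes "p \<in> topspace M"
  shows "gradf p \<in> tangent_space A p"
proof -
  have "gradf p d = jac c d p (gradf p c)" if c: "c \<in> charts_at A p" and d: "d \<in> charts_at A p" for c d
  proof -
    interpret inner_form "gc d p" by (rule inner_form_at[OF d])
    let ?w = "gradf p d - jac c d p (gradf p c)"
    have "gc d p (jac c d p (gradf p c)) u = gc d p (gradf p d) u" for u
    proof -
      have u: "u = jac c d p (jac d c p u)" using jac_comp[OF d c d] jac_self[OF d] by simp
      have "gc d p (jac c d p (gradf p c)) u = gc c p (gradf p c) (jac d c p u)"
        by (subst u) (rule gc_jac[OF c d, symmetric])
      also have "\<dots> = dform d p (jac c d p (jac d c p u))"
        by (simp only: gc_grad[OF c] dform_jac[OF c d])
      finally show ?thesis by (simp only: gc_grad[OF d] u[symmetric])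
    qed
    then have "gc d p ?w ?w = 0" by (simp add: b_simps)
    then have "?w = 0" using pos[of ?w] by force
    then show ?thesis by simp
  qed
  moreover have "gradf p c = 0" if "c \<notin> charts_at A p" for c
    using that by (simp add: grad_def)
  ultimately show ?thesis
    unfolding tangent_space_def jac_def[symmetric] by (intro CollectI conjI ballI allI impI)
qed

lemma smooth_grad: "smooth_vector_field M A gradf"
proof -
  have "smooth_on (dom c) (vf_comp c gradf i)" if c: "c \<in> A" for c i
  proof (rule smooth_on_cong[OF open_dom[OF c]])
    show "smooth_on (dom c) (coord_conformal.gradF (Gc c) (Fc c) i)"
      by (rule coord_conformal.smooth_gradF[OF coord_conformal_Fc[OF c]])
  qed (simp add: vf_comp_grad[OF c])
  then show ?thesis by (simp add: smooth_vector_field_def grad_tangent)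
qed

abbreviation Hc :: "('a, 'n) chart \<Rightarrow> 'a \<Rightarrow> real^'n \<Rightarrow> real^'n \<Rightarrow> real" where
  "Hc c p \<equiv> form2 (coord_conformal.Hf (Gc c) (Fc c) (snd c p))"

lemma Hc_sym:
  assumes c: "c \<in> charts_at A p"
  shows "Hc c p v w = Hc c p w v"
proof (rule form2_sym)
  interpret coord_conformal "dom c" "Gc c" "Fc c" by (rule coord_conformal_at[OF c])
  show "Hf (snd c p) i j = Hf (snd c p) j i" for i j
    by (simp add: Hf_def hess_sym[OF snd_in_dom[OF c], of i j])
qed

text \<open>The weight of the second kind of weighted curvature, expressed on the left by tangent vectors and
  on the right by coordinates; of the left-hand side it is known that it does not depend on the chart.\<close>

lemma Hc_eq:
  assumes c: "c \<in> charts_at A p" and V: "V \<in> tangent_space A p"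
  shows "(1/2) * lie_metric A c gradf g p V V + (g p (gradf p) V)\<^sup>2 = Hc c p (V c) (V c)"
proof -
  interpret coord_conformal "dom c" "Gc c" "Fc c" by (rule coord_conformal_at[OF c])
  have cA: "c \<in> A" using c by (simp add: charts_at_iff)
  note x = snd_in_dom[OF c]
  have pd: "pd i (vf_comp c gradf k) (snd c p) = pd i (gradF k) (snd c p)" for i k
    by (rule pd_cong_open[OF open_dom x]) (rule vf_comp_grad[OF cA])
  have "lie_comp (Gc c) (vf_comp c gradf) (snd c p) = (\<lambda>i j. 2 * hess i j (snd c p))"
    unfolding lie_comp_def pd vf_comp_grad[OF cA x] lie_grad[OF x] by (rule refl)
  then have "lie_metric A c gradf g p V V = 2 * form2 (\<lambda>i j. hess i j (snd c p)) (V c) (V c)"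
    by (simp only: lie_metric_eq form2_scale)
  moreover have "g p (gradf p) V = dform c p (V c)"
    by (simp only: g_eq[OF c grad_tangent[OF chart_at_topspace[OF c]] V] gc_grad[OF c])
  moreover have "Hc c p (V c) (V c) = form2 (\<lambda>i j. hess i j (snd c p)) (V c) (V c)
      + dform c p (V c) * dform c p (V c)"
    unfolding Hf_def form2_add form2_prod dform_def by (rule refl)
  ultimately show ?thesis by (simp add: power2_eq_square)
qed

lemma Hc_chart_independent:
  assumes c: "c \<in> charts_at A p" and d: "d \<in> charts_at A p"
  shows "Hc c p v v = Hc d p (jac c d p v) (jac c d p v)"
proof -
  let ?V = "lift c p v"
  have V: "?V \<in> tangent_space A p" by (rule lift_tangent[OF c])
  show ?thesis
    using Hc_eq[OF c V] Hc_eq[OF d V] lie_metric_chart_independent[OF smooth_grad c d V V] d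
    by (simp add: lift_self[OF c]) (simp add: lift_def)
qed

lemma sec_bar_eq:
  assumes c: "c \<in> charts_at A p" and VU: "orthonormal_pair A g p V U"
  shows "sec_bar_X A c g gradf p V U = form4 (curv c p) (V c) (U c) (U c) (V c) + Hc c p (V c) (V c)"
  using Hc_eq[OF c orthonormal_pairD(2)[OF c VU]] sec_orthonormal[OF c VU]
  by (simp add: sec_bar_X_def)

lemma norm_grad_eq:
  assumes c: "c \<in> charts_at A p"
  shows "coord_conformal.norm_grad (Gc c) (Fc c) (snd c p) = g p (gradf p) (gradf p)"
proof -
  have t: "gradf p \<in> tangent_space A p" by (rule grad_tangent[OF chart_at_topspace[OF c]])
  have "coord_conformal.norm_grad (Gc c) (Fc c) (snd c p) = dform c p (gradf p c)"
    by (simp add: coord_conformal.norm_grad_def[OF coord_conformal_at[OF c]] dform_def grad_comp[OF c]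
        mult.commute)
  then show ?thesis by (simp only: g_eq[OF c t t] gc_grad[OF c])
qed

abbreviation g' :: "('a, 'n) metric" where
  "g' \<equiv> \<lambda>p V W. exp (- 2 * f p) * g p V W"

lemma metric_matrix_conf: "metric_matrix A c g' = (\<lambda>x. exp (- 2 * Fc c x) *\<^sub>R Gc c x)"
  by (intro ext) (simp add: metric_matrix_def vec_eq_iff)

sublocale conf: riemannian_manifold M A g'
proof
  have "smooth_on (dom c) (\<lambda>x. metric_matrix A c g' x $ i $ j)" if c: "c \<in> A" for c i j
  proof -
    interpret coord_conformal "dom c" "Gc c" "Fc c" by (rule coord_conformal_Fc[OF c])
    show ?thesis unfolding metric_matrix_conf by (rule conf.smooth)
  qed
  then show "riemannian_metric M A g'"
    unfolding riemannian_metric_def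
    by (auto simp: g_sym g_linear g_pos distrib_left)
qed

lemma conf_frame:
  assumes c: "c \<in> charts_at A p"
  shows "conf.on_frame c p v u \<longleftrightarrow> on_frame c p (exp (- f p) *\<^sub>R v) (exp (- f p) *\<^sub>R u)"
proof -
  interpret inner_form "gc c p" by (rule inner_form_at[OF c])
  have "conf.gc c p v w = gc c p (exp (- f p) *\<^sub>R v) (exp (- f p) *\<^sub>R w)" for v w
  proof -
    have "exp (- f p) * exp (- f p) = exp (- 2 * f p)" by (simp add: exp_add[symmetric])
    then have "gc c p (exp (- f p) *\<^sub>R v) (exp (- f p) *\<^sub>R w) = exp (- 2 * f p) * gc c p v w"
      by (simp add: b_simps mult.assoc[symmetric])
    then show ?thesis
      by (simp only: metric_matrix_conf vector_scaleR_component real_scaleR_def form2_scale o_apply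
          chart_inv_at[OF c])
  qed
  then show ?thesis by (simp only: conf.on_frame_iff[OF c] on_frame_iff[OF c])
qed

text \<open>For a \<open>g\<close>-orthonormal pair the left-hand side is the lowered curvature of \<open>g'\<close>, not yet divided by
  the squared \<open>g'\<close>-area \<open>e\<^sup>-\<^sup>4\<^sup>f\<close> of the pair.\<close>

lemma conf_curv:
  assumes c: "c \<in> charts_at A p" and vu: "on_frame c p v u"
  shows "form4 (conf.curv c p) v u u v = exp (- 2 * f p) *
    (form4 (curv c p) v u u v + Hc c p v v + Hc c p u u - g p (gradf p) (gradf p))"
proof -
  interpret C: coord_conformal "dom c" "Gc c" "Fc c" by (rule coord_conformal_at[OF c])
  show ?thesis
    unfolding metric_matrix_conf norm_grad_eq[OF c, symmetric]
    using C.sectional_conf[OF snd_in_dom[OF c], of v u] vu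
    by (simp add: on_frame_iff[OF c] chart_inv_at[OF c])
qed

text \<open>Stretching a \<open>g\<close>-orthonormal pair by \<open>e\<^sup>f\<close> makes it \<open>g'\<close>-orthonormal; the four factors \<open>e\<^sup>f\<close> turn
  \<open>e\<^sup>-\<^sup>2\<^sup>f\<close> into \<open>e\<^sup>2\<^sup>f\<close>.\<close>

lemma conf_curv_unit:
  assumes c: "c \<in> charts_at A p" and vu: "on_frame c p v u"
  shows "form4 (conf.curv c p) (exp (f p) *\<^sub>R v) (exp (f p) *\<^sub>R u) (exp (f p) *\<^sub>R u) (exp (f p) *\<^sub>R v)
    = exp (2 * f p) *
    (form4 (curv c p) v u u v + Hc c p v v + Hc c p u u - g p (gradf p) (gradf p))"
proof -
  have "exp (f p) * (exp (f p) * (exp (f p) * (exp (f p) * exp (- 2 * f p)))) = exp (2 * f p)"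
    by (simp only: exp_add[symmetric]) simp
  then show ?thesis
    unfolding form4_linear conf_curv[OF assms] by (simp only: mult.assoc[symmetric])
qed

end

section \<open>Weighted sectional curvature depending only on the point\<close>

context riemannian_manifold
begin

text \<open>Interchanging \<open>v\<close> and \<open>u\<close> leaves the sectional curvature unchanged, so the Lie derivative takes
  equal values on orthonormal vectors.\<close>

lemma sec_X_eq_imp:
  assumes dim: "CARD('n) > 2" and X: "smooth_vector_field M A X" and \<psi>: "sec_X_eq M A g X \<psi>"
  shows "constant_sectional_curvature M A g \<and> conformal_field M A g X"
proof -
  let ?L = "\<lambda>c p. form2 (lie_comp (Gc c) (vf_comp c X) (snd c p))"
  have sum: "form4 (curv c p) v u u v + ?L c p v v / 2 = \<psi> p"
    if c: "c \<in> charts_at A p" and vu: "on_frame c p v u" for c p v u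
  proof -
    note o = orthonormal_pairI[OF c vu]
    have "sec_X A c g X p (lift c p v) (lift c p u) = \<psi> p"
      using \<psi> chart_at_topspace[OF c] c o unfolding sec_X_eq_def by blast
    then show ?thesis
      by (simp add: sec_X_def sec_orthonormal[OF c o] lie_metric_lift[OF c] lift_self[OF c])
  qed
  have ex: "\<exists>\<phi>. \<forall>c\<in>charts_at A p. \<forall>V\<in>tangent_space A p. \<forall>W\<in>tangent_space A p.
      lie_metric A c X g p V W = \<phi> * g p V W" if p: "p \<in> topspace M" for p
  proof -
    obtain c where c: "c \<in> charts_at A p" using ex_chart_at[OF p] by blast
    interpret inner_form "gc c p" by (rule inner_form_at[OF c])
    have "?L c p v w = ?L c p w v" for v w
      by (rule form2_sym) (rule lie_comp_sym[OF c])
    moreover have "?L c p v v = ?L c p u u" if "orthonormal v u" for v u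
      using sum[OF c, of v u] sum[OF c, of u v] that orthonormal_sym[OF that] curv_swap[OF c, of v u]
      by (simp add: on_frame_def)
    ultimately obtain \<phi> where \<phi>: "\<And>v w. ?L c p v w = \<phi> * gc c p v w"
      using proportional_if_equal_on_orthonormal[OF dim bilinear_form2] by metis
    have "lie_metric A d X g p V W = \<phi> * g p V W"
      if "d \<in> charts_at A p" "V \<in> tangent_space A p" "W \<in> tangent_space A p" for d V W
    proof -
      have "lie_metric A d X g p V W = lie_metric A c X g p V W"
        by (rule lie_metric_chart_independent[OF X that(1) c that(2,3)])
      also have "\<dots> = \<phi> * g p V W"
        by (simp only: lie_metric_eq \<phi> g_eq[OF c that(2,3)])
      finally show ?thesis .
    qed
    then show ?thesis by blast
  qed
  define \<phi> where "\<phi> p = (SOME \<phi>. \<forall>c\<in>charts_at A p. \<forall>V\<in>tangent_space A p. \<forall>W\<in>tangent_space A p.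
      lie_metric A c X g p V W = \<phi> * g p V W)" for p
  have \<phi>: "\<forall>c\<in>charts_at A p. \<forall>V\<in>tangent_space A p. \<forall>W\<in>tangent_space A p.
      lie_metric A c X g p V W = \<phi> p * g p V W" if "p \<in> topspace M" for p
    unfolding \<phi>_def by (rule someI_ex[OF ex[OF that]])
  have "form4 (curv c p) v u u v = \<psi> p - \<phi> p / 2"
    if c: "c \<in> charts_at A p" and vu: "on_frame c p v u" for p c v u
  proof -
    have "lie_metric A c X g p (lift c p v) (lift c p v) = \<phi> p * g p (lift c p v) (lift c p v)"
      using \<phi>[OF chart_at_topspace[OF c]] c lift_tangent[OF c] by blast
    then have "?L c p v v = \<phi> p"
      using vu by (simp add: lie_metric_lift[OF c] g_lift[OF c] on_frame_iff[OF c])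
    then show ?thesis using sum[OF c vu] by simp
  qed
  then have "constant_sectional_curvature M A g"
    by (rule schur_global[OF dim])
  moreover have "conformal_field M A g X"
    unfolding conformal_field_def using \<phi> by blast
  ultimately show ?thesis by blast
qed

lemma sec_X_eq_if:
  assumes "constant_sectional_curvature M A g" "conformal_field M A g X"
  shows "\<exists>\<psi>. sec_X_eq M A g X \<psi>"
proof -
  obtain \<kappa> where \<kappa>: "\<forall>p c v u. c \<in> charts_at A p \<longrightarrow> on_frame c p v u \<longrightarrow> form4 (curv c p) v u u v = \<kappa>"
    using assms(1) unfolding constant_curvature_iff by (elim exE)
  obtain \<phi> where \<phi>: "\<forall>p\<in>topspace M. \<forall>c\<in>charts_at A p. \<forall>V\<in>tangent_space A p.
      \<forall>W\<in>tangent_space A p. lie_metric A c X g p V W = \<phi> p * g p V W"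
    using assms(2) unfolding conformal_field_def by (elim exE)
  have "sec_X A c g X p V U = \<kappa> + \<phi> p / 2"
    if p: "p \<in> topspace M" and c: "c \<in> charts_at A p" and VU: "orthonormal_pair A g p V U" for p c V U
  proof -
    have "lie_metric A c X g p V V = \<phi> p * g p V V"
      using \<phi> p c orthonormal_pairD(2)[OF c VU] by blast
    moreover have "g p V V = 1" using VU by (simp add: orthonormal_pair_def)
    ultimately show ?thesis
      using \<kappa>[rule_format, OF c orthonormal_pairD(1)[OF c VU]] sec_orthonormal[OF c VU]
      by (simp add: sec_X_def)
  qed
  then have "sec_X_eq M A g X (\<lambda>p. \<kappa> + \<phi> p / 2)"
    by (simp add: sec_X_eq_def)
  then show ?thesis by blast
qed

end

context riemannian_manifold_function
begin

text \<open>The weight is a multiple \<open>\<mu>\<close> of the metric, so the curvatures of both metrics depend only on the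
  point and Schur's lemma applies to each.\<close>

lemma sec_bar_f_eq_imp:
  assumes dim: "CARD('n) > 2" and \<psi>: "sec_bar_f_eq M A g f \<psi>"
  shows "constant_sectional_curvature M A g \<and> constant_sectional_curvature M A g'"
proof -
  have sum: "form4 (curv c p) v u u v + Hc c p v v = \<psi> p"
    if c: "c \<in> charts_at A p" and vu: "on_frame c p v u" for c p v u
  proof -
    note o = orthonormal_pairI[OF c vu]
    have "sec_bar_X A c g gradf p (lift c p v) (lift c p u) = \<psi> p"
      using \<psi> chart_at_topspace[OF c] c o unfolding sec_bar_f_eq_def sec_bar_X_eq_def by blast
    then show ?thesis by (simp add: sec_bar_eq[OF c o] lift_self[OF c])
  qed
  have ex: "\<exists>\<mu>. \<forall>c\<in>charts_at A p. \<forall>v. gc c p v v = 1 \<longrightarrow> Hc c p v v = \<mu>" if p: "p \<in> topspace M" for p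
  proof -
    obtain c where c: "c \<in> charts_at A p" using ex_chart_at[OF p] by blast
    interpret inner_form "gc c p" by (rule inner_form_at[OF c])
    have "Hc c p v v = Hc c p u u" if "orthonormal v u" for v u
      using sum[OF c, of v u] sum[OF c, of u v] that orthonormal_sym[OF that] curv_swap[OF c, of v u]
      by (simp add: on_frame_def)
    then obtain \<mu> where \<mu>: "\<And>v w. Hc c p v w = \<mu> * gc c p v w"
      using proportional_if_equal_on_orthonormal[OF dim bilinear_form2 Hc_sym[OF c]] by metis
    have "Hc d p v v = \<mu>" if d: "d \<in> charts_at A p" and v: "gc d p v v = 1" for d v
      using v unfolding Hc_chart_independent[OF d c] gc_jac[OF d c, of v v] \<mu> by simp
    then show ?thesis by (intro exI ballI allI impI)
  qed
  define \<mu> where "\<mu> p = (SOME \<mu>. \<forall>c\<in>charts_at A p. \<forall>v. gc c p v v = 1 \<longrightarrow> Hc c p v v = \<mu>)" for p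
  have \<mu>: "Hc c p v v = \<mu> p" if "c \<in> charts_at A p" "gc c p v v = 1" for c p v
    using someI_ex[OF ex[OF chart_at_topspace[OF that(1)]], folded \<mu>_def, THEN bspec, OF that(1)]
      that(2) by simp
  have \<kappa>: "form4 (curv c p) v u u v = \<psi> p - \<mu> p"
    if c: "c \<in> charts_at A p" and vu: "on_frame c p v u" for p c v u
    using sum[OF c vu] \<mu>[OF c, of v] vu by (simp add: on_frame_iff[OF c])
  have "form4 (conf.curv c p) v u u v
      = exp (2 * f p) * (\<psi> p + \<mu> p - g p (gradf p) (gradf p))"
    if c: "c \<in> charts_at A p" and vu: "conf.on_frame c p v u" for p c v u
  proof -
    let ?v = "exp (- f p) *\<^sub>R v" and ?u = "exp (- f p) *\<^sub>R u"
    have o: "on_frame c p ?v ?u" using vu by (simp only: conf_frame[OF c])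
    have "Hc c p ?v ?v = \<mu> p" "Hc c p ?u ?u = \<mu> p"
      using \<mu>[OF c, of ?v] \<mu>[OF c, of ?u] o on_frame_iff[OF c, of ?v ?u] by blast+
    moreover have "exp (f p) *\<^sub>R ?v = v" "exp (f p) *\<^sub>R ?u = u"
      by (simp_all add: exp_minus)
    ultimately show ?thesis
      using conf_curv_unit[OF c o] \<kappa>[OF c o] by (simp only:) simp
  qed
  then have "constant_sectional_curvature M A g'"
    by (rule conf.schur_global[OF dim])
  moreover have "constant_sectional_curvature M A g"
    by (rule schur_global[OF dim \<kappa>])
  ultimately show ?thesis by blast
qed

text \<open>The two constant curvatures prescribe the sum of the weights of two orthonormal vectors, hence by
  the existence of a third one the weight of each.\<close>

lemma sec_bar_f_eq_if:
  assumes dim: "CARD('n) > 2"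
    and "constant_sectional_curvature M A g" "constant_sectional_curvature M A g'"
  shows "\<exists>\<psi>. sec_bar_f_eq M A g f \<psi>"
proof -
  obtain \<kappa> where \<kappa>: "\<forall>p c v u. c \<in> charts_at A p \<longrightarrow> on_frame c p v u \<longrightarrow> form4 (curv c p) v u u v = \<kappa>"
    using assms(2) unfolding constant_curvature_iff by (elim exE)
  obtain \<kappa>' where \<kappa>': "\<forall>p c v u. c \<in> charts_at A p \<longrightarrow> conf.on_frame c p v u \<longrightarrow>
      form4 (conf.curv c p) v u u v = \<kappa>'"
    using assms(3) unfolding conf.constant_curvature_iff by (elim exE)
  define C where "C p = exp (- 2 * f p) * \<kappa>' - \<kappa> + g p (gradf p) (gradf p)" for p
  have sum: "Hc c p v v + Hc c p u u = C p" if c: "c \<in> charts_at A p" and vu: "on_frame c p v u" for c p v u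
  proof -
    have "conf.on_frame c p (exp (f p) *\<^sub>R v) (exp (f p) *\<^sub>R u)"
      using vu by (simp only: conf_frame[OF c]) (simp add: exp_minus)
    then have "\<kappa>' = exp (2 * f p) * (\<kappa> + Hc c p v v + Hc c p u u - g p (gradf p) (gradf p))"
      using conf_curv_unit[OF c vu] \<kappa>'[rule_format, OF c] \<kappa>[rule_format, OF c vu] by (simp only:)
    moreover have "exp (- 2 * f p) * exp (2 * f p) = 1" by (simp add: exp_minus)
    ultimately have "exp (- 2 * f p) * \<kappa>' = \<kappa> + Hc c p v v + Hc c p u u - g p (gradf p) (gradf p)"
      by (simp only: mult.assoc[symmetric] mult_1_left)
    then show ?thesis by (simp add: C_def)
  qed
  have "sec_bar_X A c g gradf p V U = \<kappa> + C p / 2"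
    if c: "c \<in> charts_at A p" and VU: "orthonormal_pair A g p V U" for p c V U
  proof -
    interpret inner_form "gc c p" by (rule inner_form_at[OF c])
    note o = orthonormal_pairD(1)[OF c VU]
    have "Hc c p (V c) (V c) = C p / 2"
      by (rule constant_on_unit_if_sum_constant[OF dim, where q="\<lambda>v. Hc c p v v"])
        (use sum[OF c] o in \<open>auto simp: on_frame_def orthonormal_def\<close>)
    then show ?thesis
      using sec_bar_eq[OF c VU] \<kappa>[rule_format, OF c o] by simp
  qed
  then have "sec_bar_f_eq M A g f (\<lambda>p. \<kappa> + C p / 2)"
    by (simp add: sec_bar_f_eq_def sec_bar_X_eq_def)
  then show ?thesis by blast
qed

end

theorem proposition1p1:
  fixes M :: "'a topology"
    and A :: "('a, 'n::finite) chart set"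
    and g :: "('a, 'n) metric"
    and X :: "('a, 'n) vfield"
    and f :: "'a \<Rightarrow> real"
  assumes "smooth_manifold M A"
    and "CARD('n) > 2"
    and "riemannian_metric M A g"
    and "smooth_vector_field M A X"
    and "smooth_function A f"
  shows "((\<exists>\<psi>. sec_X_eq M A g X \<psi>) \<longleftrightarrow>
            constant_sectional_curvature M A g \<and> conformal_field M A g X) \<and>
         ((\<exists>\<psi>. sec_bar_f_eq M A g f \<psi>) \<longleftrightarrow>
            constant_sectional_curvature M A g \<and>
            constant_sectional_curvature M A (\<lambda>p V W. exp (- 2 * f p) * g p V W))"
proof -
  interpret riemannian_manifold_function M A g f
    by unfold_locales (fact assms)+
  have "(\<exists>\<psi>. sec_X_eq M A g X \<psi>) \<longleftrightarrow>
      constant_sectional_curvature M A g \<and> conformal_field M A g X"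
    using sec_X_eq_imp[OF assms(2,4)] sec_X_eq_if[of X] by (intro iffI) (elim exE, simp, simp)
  moreover have "(\<exists>\<psi>. sec_bar_f_eq M A g f \<psi>) \<longleftrightarrow>
      constant_sectional_curvature M A g \<and> constant_sectional_curvature M A g'"
    using sec_bar_f_eq_imp[OF assms(2)] sec_bar_f_eq_if[OF assms(2)]
    by (intro iffI) (elim exE, simp, simp)
  ultimately show ?thesis by (rule conjI)
qed

end
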